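(* Let $F=\frac{(b\alpha+\beta)^2}{\alpha}$ be a singular square metric on an $n$-dimensional manifold with $n\geq3$. Suppose $\beta$ is conformal with respect to $\alpha$, with conformal factor $c(x)$. Then $F$ has constant Ricci curvature (respectively, constant flag curvature) if and only if there is a constant $\mu$ such that $\alpha$ has constant Ricci curvature (respectively, constant sectional curvature) $\mu$, and $\beta$ is closed with its conformal factor satisfying $c(x)^2=-\mu b^2$.
   Context: Setting: manifolds are connected. $\alpha=\sqrt{a_{ij}(x)y^iy^j}$ is a Riemannian metric and $\beta=b_i(x)y^i$ is a nowhere-vanishing 1-form on an $n$-dimensional manifold; $b=b(x)=\sqrt{a^{ij}b_ib_j}$ is the length of $\beta$ with respect to $\alpha$ (not assumed constant). The singular square metric is the (non-regular) Finsler metric $F=\frac{(b\alpha+\beta)^2}{\alpha}$; its curvatures are considered at those $y\neq 0$ where its fundamental tensor is nondegenerate (i.e. where $b^2\alpha^2-\beta^2\neq0$). Curvature: for a Finsler metric $F$, $g_{ij}=\frac12[F^2]_{y^iy^j}$ with inverse $(g^{ij})$, the spray coefficients are $G^i=\frac14g^{il}\{[F^2]_{x^ky^l}y^k-[F^2]_{x^l}\}$, the Riemann tensor is ${}^FR^i{}_k=2G^i_{x^k}-G^i_{x^ly^k}y^l+2G^lG^i_{y^ky^l}-G^i_{y^l}G^l_{y^k}$, and ${}^FRic_{00}={}^FR^m{}_m$. $F$ has constant Ricci curvature $K$ (a constant) if ${}^FRic_{00}=(n-1)KF^2$, and constant flag curvature $K$ (a constant) if ${}^FR^i{}_k=K(F^2\delta^i{}_k-Fy^iF_{y^k})$.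 The same normalization is used for $\alpha$: constant Ricci curvature $\mu$ means ${}^{\alpha}Ric_{00}=(n-1)\mu\alpha^2$, and constant sectional curvature $\mu$ means ${}^{\alpha}R^i{}_k=\mu(\alpha^2\delta^i{}_k-y^iy_k)$ with $y_k=a_{kj}y^j$. $\beta$ is conformal with respect to $\alpha$ with conformal factor $c(x)$ if $\frac12(b_{i|j}+b_{j|i})=c(x)a_{ij}$, where $_{|}$ is the covariant derivative with respect to the Levi-Civita connection of $\alpha$. *)

theory Defs
  imports "HOL-Analysis.Analysis"
begin

section \<open>Partial derivatives and smooth functions on open sets of coordinate space\<close>

definition partial :: "'n::finite \<Rightarrow> (real^'n \<Rightarrow> real) \<Rightarrow> real^'n \<Rightarrow> real" where
  "partial k f x = frechet_derivative f (at x) (axis k 1)"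

primrec Ck_on :: "nat \<Rightarrow> (real^'n::finite) set \<Rightarrow> (real^'n \<Rightarrow> real) \<Rightarrow> bool" where
  "Ck_on 0 S f = continuous_on S f"
| "Ck_on (Suc r) S f =
     ((\<forall>x\<in>S. f differentiable (at x)) \<and> (\<forall>k. Ck_on r S (partial k f)))"

definition smooth_on :: "(real^'n::finite) set \<Rightarrow> (real^'n \<Rightarrow> real) \<Rightarrow> bool" where
  "smooth_on S f \<longleftrightarrow> (\<forall>r. Ck_on r S f)"


section \<open>Smooth manifolds modelled on \<open>real^'n\<close>\<close>

type_synonym ('m, 'n) chart = "'m set \<times> ('m \<Rightarrow> real^'n)"

definition is_chart :: "'m topology \<Rightarrow> ('m, 'n::finite) chart \<Rightarrow> bool" where
  "is_chart X C \<longleftrightarrow> (case C of (U, \<phi>) \<Rightarrow>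
     openin X U \<and> open (\<phi> ` U) \<and>
     homeomorphic_map (subtopology X U) (top_of_set (\<phi> ` U)) \<phi>)"

definition transition :: "('m, 'n::finite) chart \<Rightarrow> ('m, 'n) chart \<Rightarrow> real^'n \<Rightarrow> real^'n" where
  "transition C D = snd D \<circ> inv_into (fst C) (snd C)"

definition smooth_manifold :: "'m topology \<Rightarrow> ('m, 'n::finite) chart set \<Rightarrow> bool" where
  "smooth_manifold X \<A> \<longleftrightarrow>
     Hausdorff_space X \<and> second_countable X \<and>
     (\<forall>C\<in>\<A>. is_chart X C) \<and> (\<Union>C\<in>\<A>. fst C) = topspace X \<and>
     (\<forall>C\<in>\<A>. \<forall>D\<in>\<A>. \<forall>i.
        smooth_on (snd C ` (fst C \<inter> fst D)) (\<lambda>x. transition C D x $ i))"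


section \<open>Tensor fields in components\<close>

text \<open>
  A tensor field is given by its components in every chart of the atlas: \<open>a C x\<close> and \<open>b C x\<close>
  are the components with respect to the chart \<open>C\<close> at the coordinate point \<open>x\<close>. Only the
  values on the image of \<open>C\<close> matter. \<open>jac\<close> is the Jacobian matrix
  \<open>\<partial>x\<^sub>D\<^sup>k / \<partial>x\<^sub>C\<^sup>i\<close> (row \<open>k\<close>, column \<open>i\<close>).
\<close>

definition jac :: "('m, 'n::finite) chart \<Rightarrow> ('m, 'n) chart \<Rightarrow> real^'n \<Rightarrow> real^'n^'n" where
  "jac C D x = (\<chi> k i. partial i (\<lambda>u. transition C D u $ k) x)"

definition riemannian_metric ::
  "('m, 'n::finite) chart set \<Rightarrow> (('m, 'n) chart \<Rightarrow> real^'n \<Rightarrow> real^'n^'n) \<Rightarrow> bool" where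
  "riemannian_metric \<A> a \<longleftrightarrow>
     (\<forall>C\<in>\<A>. \<forall>i j. smooth_on (snd C ` fst C) (\<lambda>x. a C x $ i $ j)) \<and>
     (\<forall>C\<in>\<A>. \<forall>x\<in>snd C ` fst C.
        (\<forall>i j. a C x $ i $ j = a C x $ j $ i) \<and> (\<forall>y. y \<noteq> 0 \<longrightarrow> 0 < y \<bullet> (a C x *v y))) \<and>
     (\<forall>C\<in>\<A>. \<forall>D\<in>\<A>. \<forall>p\<in>fst C \<inter> fst D. \<forall>i j.
        a C (snd C p) $ i $ j =
          (\<Sum>k\<in>UNIV. \<Sum>l\<in>UNIV. a D (snd D p) $ k $ l *
             jac C D (snd C p) $ k $ i * jac C D (snd C p) $ l $ j))"

definition one_form ::
  "('m, 'n::finite) chart set \<Rightarrow> (('m, 'n) chart \<Rightarrow> real^'n \<Rightarrow> real^'n) \<Rightarrow> bool" where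
  "one_form \<A> b \<longleftrightarrow>
     (\<forall>C\<in>\<A>. \<forall>i. smooth_on (snd C ` fst C) (\<lambda>x. b C x $ i)) \<and>
     (\<forall>C\<in>\<A>. \<forall>D\<in>\<A>. \<forall>p\<in>fst C \<inter> fst D. \<forall>i.
        b C (snd C p) $ i = (\<Sum>k\<in>UNIV. b D (snd D p) $ k * jac C D (snd C p) $ k $ i))"

definition nowhere_vanishing ::
  "('m, 'n::finite) chart set \<Rightarrow> (('m, 'n) chart \<Rightarrow> real^'n \<Rightarrow> real^'n) \<Rightarrow> bool" where
  "nowhere_vanishing \<A> b \<longleftrightarrow> (\<forall>C\<in>\<A>. \<forall>x\<in>snd C ` fst C. b C x \<noteq> 0)"

definition closed_form ::
  "('m, 'n::finite) chart set \<Rightarrow> (('m, 'n) chart \<Rightarrow> real^'n \<Rightarrow> real^'n) \<Rightarrow> bool" where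
  "closed_form \<A> b \<longleftrightarrow> (\<forall>C\<in>\<A>. \<forall>x\<in>snd C ` fst C. \<forall>i j.
     partial i (\<lambda>u. b C u $ j) x = partial j (\<lambda>u. b C u $ i) x)"

definition christoffel ::
  "(real^'n::finite \<Rightarrow> real^'n^'n) \<Rightarrow> real^'n \<Rightarrow> 'n \<Rightarrow> 'n \<Rightarrow> 'n \<Rightarrow> real" where
  "christoffel a x k i j = 1/2 * (\<Sum>l\<in>UNIV. matrix_inv (a x) $ k $ l *
     (partial i (\<lambda>u. a u $ j $ l) x + partial j (\<lambda>u. a u $ i $ l) x
        - partial l (\<lambda>u. a u $ i $ j) x))"

text \<open>\<open>cov_deriv a b x i j\<close> is \<open>b\<^sub>i\<^sub>|\<^sub>j\<close>.\<close>

definition cov_deriv ::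
  "(real^'n::finite \<Rightarrow> real^'n^'n) \<Rightarrow> (real^'n \<Rightarrow> real^'n) \<Rightarrow> real^'n \<Rightarrow> 'n \<Rightarrow> 'n \<Rightarrow> real" where
  "cov_deriv a b x i j =
     partial j (\<lambda>u. b u $ i) x - (\<Sum>k\<in>UNIV. christoffel a x k i j * b x $ k)"

definition conformal_form ::
  "('m, 'n::finite) chart set \<Rightarrow> (('m, 'n) chart \<Rightarrow> real^'n \<Rightarrow> real^'n^'n) \<Rightarrow>
   (('m, 'n) chart \<Rightarrow> real^'n \<Rightarrow> real^'n) \<Rightarrow> ('m \<Rightarrow> real) \<Rightarrow> bool" where
  "conformal_form \<A> a b c \<longleftrightarrow> (\<forall>C\<in>\<A>. \<forall>p\<in>fst C. \<forall>i j.
     1/2 * (cov_deriv (a C) (b C) (snd C p) i j + cov_deriv (a C) (b C) (snd C p) j i)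
       = c p * a C (snd C p) $ i $ j)"


section \<open>Curvature of a Finsler metric\<close>

text \<open>
  In a chart a Finsler metric is a function \<open>F x y\<close> of the coordinates \<open>x\<close> and the
  components \<open>y\<close> of the tangent vector.
\<close>

definition fundamental_tensor ::
  "(real^'n::finite \<Rightarrow> real^'n \<Rightarrow> real) \<Rightarrow> real^'n \<Rightarrow> real^'n \<Rightarrow> real^'n^'n" where
  "fundamental_tensor F x y =
     (\<chi> i j. 1/2 * partial j (\<lambda>v. partial i (\<lambda>w. (F x w)\<^sup>2) v) y)"

definition spray ::
  "(real^'n::finite \<Rightarrow> real^'n \<Rightarrow> real) \<Rightarrow> real^'n \<Rightarrow> real^'n \<Rightarrow> real^'n" where
  "spray F x y = (\<chi> i. 1/4 * (\<Sum>l\<in>UNIV. matrix_inv (fundamental_tensor F x y) $ i $ l *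
     ((\<Sum>k\<in>UNIV. partial l (\<lambda>v. partial k (\<lambda>u. (F u v)\<^sup>2) x) y * y $ k)
        - partial l (\<lambda>u. (F u y)\<^sup>2) x)))"

definition riemann ::
  "(real^'n::finite \<Rightarrow> real^'n \<Rightarrow> real) \<Rightarrow> real^'n \<Rightarrow> real^'n \<Rightarrow> real^'n^'n" where
  "riemann F x y = (\<chi> i k.
     2 * partial k (\<lambda>u. spray F u y $ i) x
     - (\<Sum>l\<in>UNIV. partial k (\<lambda>v. partial l (\<lambda>u. spray F u v $ i) x) y * y $ l)
     + 2 * (\<Sum>l\<in>UNIV. spray F x y $ l * partial l (\<lambda>v. partial k (\<lambda>w. spray F x w $ i) v) y)
     - (\<Sum>l\<in>UNIV. partial l (\<lambda>v. spray F x v $ i) y * partial k (\<lambda>v. spray F x v $ l) y))"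

definition ricci ::
  "(real^'n::finite \<Rightarrow> real^'n \<Rightarrow> real) \<Rightarrow> real^'n \<Rightarrow> real^'n \<Rightarrow> real" where
  "ricci F x y = (\<Sum>m\<in>UNIV. riemann F x y $ m $ m)"

text \<open>
  The metrics may be non-regular, so the curvature conditions are imposed only in the nonzero
  directions in which the fundamental tensor is nondegenerate.
\<close>

definition nondegenerate ::
  "(real^'n::finite \<Rightarrow> real^'n \<Rightarrow> real) \<Rightarrow> real^'n \<Rightarrow> real^'n \<Rightarrow> bool" where
  "nondegenerate F x y \<longleftrightarrow> y \<noteq> 0 \<and> invertible (fundamental_tensor F x y)"

definition constant_ricci ::
  "('m, 'n::finite) chart set \<Rightarrow> (('m, 'n) chart \<Rightarrow> real^'n \<Rightarrow> real^'n \<Rightarrow> real) \<Rightarrow> real \<Rightarrow> bool" where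
  "constant_ricci \<A> F K \<longleftrightarrow> (\<forall>C\<in>\<A>. \<forall>x\<in>snd C ` fst C. \<forall>y. nondegenerate (F C) x y \<longrightarrow>
     ricci (F C) x y = (real CARD('n) - 1) * K * (F C x y)\<^sup>2)"

definition constant_flag ::
  "('m, 'n::finite) chart set \<Rightarrow> (('m, 'n) chart \<Rightarrow> real^'n \<Rightarrow> real^'n \<Rightarrow> real) \<Rightarrow> real \<Rightarrow> bool" where
  "constant_flag \<A> F K \<longleftrightarrow> (\<forall>C\<in>\<A>. \<forall>x\<in>snd C ` fst C. \<forall>y. nondegenerate (F C) x y \<longrightarrow>
     (\<forall>i k. riemann (F C) x y $ i $ k =
        K * ((F C x y)\<^sup>2 * (if i = k then 1 else 0) - F C x y * y $ i * partial k (F C x) y)))"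


section \<open>Riemannian metrics and singular square metrics\<close>

definition alpha ::
  "(('m, 'n::finite) chart \<Rightarrow> real^'n \<Rightarrow> real^'n^'n) \<Rightarrow> ('m, 'n) chart \<Rightarrow> real^'n \<Rightarrow> real^'n \<Rightarrow> real"
  where "alpha a C x y = sqrt (\<Sum>i\<in>UNIV. \<Sum>j\<in>UNIV. a C x $ i $ j * y $ i * y $ j)"

definition beta ::
  "(('m, 'n::finite) chart \<Rightarrow> real^'n \<Rightarrow> real^'n) \<Rightarrow> ('m, 'n) chart \<Rightarrow> real^'n \<Rightarrow> real^'n \<Rightarrow> real"
  where "beta b C x y = (\<Sum>i\<in>UNIV. b C x $ i * y $ i)"

definition form_length ::
  "(('m, 'n::finite) chart \<Rightarrow> real^'n \<Rightarrow> real^'n^'n) \<Rightarrow> (('m, 'n) chart \<Rightarrow> real^'n \<Rightarrow> real^'n) \<Rightarrow>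
   ('m, 'n) chart \<Rightarrow> real^'n \<Rightarrow> real" where
  "form_length a b C x =
     sqrt (\<Sum>i\<in>UNIV. \<Sum>j\<in>UNIV. matrix_inv (a C x) $ i $ j * b C x $ i * b C x $ j)"

definition singular_square_metric ::
  "(('m, 'n::finite) chart \<Rightarrow> real^'n \<Rightarrow> real^'n^'n) \<Rightarrow> (('m, 'n) chart \<Rightarrow> real^'n \<Rightarrow> real^'n) \<Rightarrow>
   ('m, 'n) chart \<Rightarrow> real^'n \<Rightarrow> real^'n \<Rightarrow> real" where
  "singular_square_metric a b C x y =
     (form_length a b C x * alpha a C x y + beta b C x y)\<^sup>2 / alpha a C x y"

definition constant_sectional ::
  "('m, 'n::finite) chart set \<Rightarrow> (('m, 'n) chart \<Rightarrow> real^'n \<Rightarrow> real^'n^'n) \<Rightarrow> real \<Rightarrow> bool" where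
  "constant_sectional \<A> a \<mu> \<longleftrightarrow> (\<forall>C\<in>\<A>. \<forall>x\<in>snd C ` fst C. \<forall>y. y \<noteq> 0 \<longrightarrow>
     (\<forall>i k. riemann (alpha a C) x y $ i $ k =
        \<mu> * ((alpha a C x y)\<^sup>2 * (if i = k then 1 else 0)
              - y $ i * (\<Sum>j\<in>UNIV. a C x $ k $ j * y $ j))))"

end

theory Submission
  imports Defs
begin

text \<open>
  Write \<open>b\<^sub>i\<^sub>|\<^sub>j = c a\<^sub>i\<^sub>j + s\<^sub>i\<^sub>j\<close> with \<open>s\<close> skew, \<open>s\<^sub>j = b\<^sup>i s\<^sub>i\<^sub>j\<close> and \<open>\<Delta> = b\<alpha> - \<beta>\<close>; an index \<open>0\<close> denotes
  contraction with \<open>y\<close>. The spray of \<open>F\<close> is the spray of \<open>\<alpha>\<close> plus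
  \<open>D\<^sup>i = (2\<alpha>\<^sup>2/\<Delta>) s\<^sup>i\<^sub>0 - (\<alpha>\<^sup>3/b\<Delta>) s\<^sup>i + (c\<alpha>/b + s\<^sub>0\<alpha>\<beta>/b\<Delta>\<^sup>2) y\<^sup>i - (s\<^sub>0\<alpha>\<^sup>3/b\<Delta>\<^sup>2) b\<^sup>i\<close>.

  If \<open>F\<close> has constant Ricci curvature, let \<open>y\<close> tend to the degenerate direction \<open>b\<^sup>i\<close> along
  \<open>b\<^sup>i + \<epsilon>u\<^sup>i\<close> with \<open>u\<close> orthogonal to \<open>b\<close> and \<open>s\<close>: the coefficient of \<open>\<epsilon>\<^sup>-\<^sup>6\<close> in the Ricci curvature is a
  nonzero multiple of \<open>s\<^sub>i s\<^sup>i\<close>, so \<open>s\<^sub>i = 0\<close>. Then \<open>cb\<^sub>k\<close> is half the differential of \<open>b\<^sup>2\<close>, hence closed,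
  which gives \<open>c s\<^sub>i\<^sub>j = 0\<close>. Where \<open>s\<^sub>i\<^sub>j\<close> does not vanish, \<open>\<beta>\<close> is therefore a Killing form of
  constant length, and the Ricci curvature on a plane through \<open>b\<^sup>i\<close> is a rational function of the
  direction that can only agree with a multiple of \<open>F\<^sup>2\<close> if \<open>s\<^sub>i\<^sub>j = 0\<close>.

  So \<open>\<beta>\<close> is closed and \<open>D\<^sup>i = (c\<alpha>/b) y\<^sup>i\<close>, i.e. \<open>F\<close> is projectively related to \<open>\<alpha>\<close> and, with \<open>f = c/b\<close>, its
  Ricci curvature is that of \<open>\<alpha>\<close> plus \<open>(n - 1)(f\<^sup>2\<alpha>\<^sup>2 - f\<^sub>|\<^sub>0\<alpha>)\<close>. Comparing the parts of the Einstein
  equation that are even and odd in \<open>y\<close> shows \<open>K = 0\<close> and \<open>df = 0\<close>, whence \<open>\<mu> = -f\<^sup>2\<close>. Conversely, for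
  constant \<open>f\<close> the Riemann tensor of \<open>F\<close> is that of \<open>\<alpha>\<close> minus \<open>\<mu>(\<alpha>\<^sup>2\<delta>\<^sup>i\<^sub>k - y\<^sup>i y\<^sub>k)\<close>.
\<close>

section \<open>Directional derivatives and smooth functions\<close>

text \<open>The Ricci curvature of F contains second derivatives of \<beta>; the plan is to look
  where they cannot interfere. At the direction b the metric stays finite but its spray blows up,
  because \<Delta> vanishes there to second order. With weight 6 all terms containing derivatives in
  x drop out of the limit, which leaves an algebraic identity in s_i alone. A direction orthogonal
  to both b and s exists because n \<ge> 3. In the Killing case second derivatives of \<beta> enter
  only through one linear form in y, the divergence of s^i_j: its values at w and -w cancel, and its
  value at b is a trace of products of s^i_j, found by differentiating s^i_j b^j = 0. Since this
  differentiates, c = 0 is needed on an open set, so s_i = 0 must first be known at every point.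
  Tensors are handled as functions of (x, y) and covariant derivatives as derivatives along
  horizontal lifts, for which \<alpha> is constant. Curvature equations are available in
  nondegenerate directions only; the curvature of \<alpha> being quadratic in y, the parallelogram
  law carries them across the line of b.\<close>

definition dd :: "'a::real_normed_vector \<Rightarrow> ('a \<Rightarrow> real) \<Rightarrow> 'a \<Rightarrow> real" where
  "dd v f z = frechet_derivative f (at z) v"

text \<open>Quantifying over all directions instead of the coordinate axes makes sense in any normed
  space, so one notion serves for functions on a chart and for functions of pairs (x, y).\<close>

primrec ck :: "nat \<Rightarrow> 'a::real_normed_vector set \<Rightarrow> ('a \<Rightarrow> real) \<Rightarrow> bool" where
  "ck 0 Z f = continuous_on Z f"
| "ck (Suc r) Z f = ((\<forall>z\<in>Z. f differentiable (at z)) \<and> (\<forall>v. ck r Z (dd v f)))"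

definition sm :: "'a::real_normed_vector set \<Rightarrow> ('a \<Rightarrow> real) \<Rightarrow> bool" where
  "sm Z f \<longleftrightarrow> (\<forall>r. ck r Z f)"

lemma dd_eqI: "(f has_derivative f') (at z) \<Longrightarrow> dd v f z = f' v"
  using frechet_derivative_at[of f f' z] by (simp add: dd_def)

lemma has_derivative_dd: "f differentiable (at z) \<Longrightarrow> (f has_derivative (\<lambda>v. dd v f z)) (at z)"
  unfolding dd_def by (simp add: frechet_derivative_works[symmetric])

text \<open>\<open>frechet_derivative\<close> chooses among the derivatives at z, and functions
  equal near z have the same ones, so the equation holds even where there are none.\<close>

lemma dd_cong:
  assumes "open Z" "z \<in> Z" "\<And>u. u \<in> Z \<Longrightarrow> f u = g u"
  shows "dd v f z = dd v g z"
proof -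
  have "\<And>h. (f has_derivative h) (at z) \<longleftrightarrow> (g has_derivative h) (at z)"
    using assms by (metis has_derivative_transform_within_open)
  then show ?thesis unfolding dd_def frechet_derivative_def by simp
qed

lemma differentiable_cong_open:
  assumes "open Z" "z \<in> Z" "\<And>u. u \<in> Z \<Longrightarrow> f u = g u" "f differentiable (at z)"
  shows "g differentiable (at z)"
  using assms unfolding differentiable_def by (metis has_derivative_transform_within_open)

lemma dd_const [simp]: "dd v (\<lambda>z. k) z = 0"
  by (rule dd_eqI[THEN trans]) (auto intro!: derivative_eq_intros)

lemma dd_add: "f differentiable (at z) \<Longrightarrow> g differentiable (at z) \<Longrightarrow>
   dd v (\<lambda>z. f z + g z) z = dd v f z + dd v g z"
  by (rule dd_eqI[THEN trans]) (auto intro!: derivative_eq_intros has_derivative_dd)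

lemma dd_diff: "f differentiable (at z) \<Longrightarrow> g differentiable (at z) \<Longrightarrow>
   dd v (\<lambda>z. f z - g z) z = dd v f z - dd v g z"
  by (rule dd_eqI[THEN trans]) (auto intro!: derivative_eq_intros has_derivative_dd)

lemma dd_mult: "f differentiable (at z) \<Longrightarrow> g differentiable (at z) \<Longrightarrow>
   dd v (\<lambda>z. f z * g z) z = f z * dd v g z + dd v f z * g z"
  by (rule dd_eqI[THEN trans]) (auto intro!: derivative_eq_intros has_derivative_dd)

lemma dd_power: "f differentiable (at z) \<Longrightarrow>
   dd v (\<lambda>z. f z ^ k) z = real k * f z ^ (k - 1) * dd v f z"
  by (rule dd_eqI[THEN trans]) (auto intro!: derivative_eq_intros has_derivative_dd simp: field_simps)

lemma dd_sqrt: "f differentiable (at z) \<Longrightarrow> f z > 0 \<Longrightarrow>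
   dd v (\<lambda>z. sqrt (f z)) z = dd v f z / (2 * sqrt (f z))"
  by (rule dd_eqI[THEN trans]) (auto intro!: derivative_eq_intros has_derivative_dd simp: field_simps)

lemma dd_sum: "(\<And>i. i \<in> I \<Longrightarrow> f i differentiable (at z)) \<Longrightarrow>
   dd v (\<lambda>z. \<Sum>i\<in>I. f i z) z = (\<Sum>i\<in>I. dd v (f i) z)"
  by (rule dd_eqI[THEN trans]) (auto intro!: derivative_eq_intros has_derivative_dd)

lemma dd_bounded_linear: "bounded_linear f \<Longrightarrow> dd v f z = f v"
  by (rule dd_eqI) (rule bounded_linear_imp_has_derivative)

lemma dd_compose_linear:
  assumes "bounded_linear L" "f differentiable (at (L z))"
  shows "dd v (\<lambda>z. f (L z)) z = dd (L v) f (L z)"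
  by (rule dd_eqI[THEN trans, OF has_derivative_compose[OF bounded_linear_imp_has_derivative[OF assms(1)] has_derivative_dd[OF assms(2)]]]) simp

lemma linear_dd: "f differentiable (at z) \<Longrightarrow> linear (\<lambda>v. dd v f z)"
  using has_derivative_dd has_derivative_linear by blast

lemma ck_cong: "open Z \<Longrightarrow> (\<And>z. z \<in> Z \<Longrightarrow> f z = g z) \<Longrightarrow> ck r Z f \<Longrightarrow> ck r Z g"
proof (induction r arbitrary: f g)
  case 0 then show ?case using continuous_on_cong by fastforce
next
  case (Suc r)
  have "ck r Z (dd v g)" for v
    using Suc.IH[of "dd v f" "dd v g"] Suc.prems dd_cong[OF Suc.prems(1), of _ f g] by auto
  moreover have "\<forall>z\<in>Z. g differentiable (at z)"
    using Suc.prems differentiable_cong_open[OF Suc.prems(1), of _ f g] by auto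
  ultimately show ?case by simp
qed

lemma ck_SucD: "ck (Suc r) Z f \<Longrightarrow> ck r Z f"
proof (induction r arbitrary: f)
  case 0 then show ?case
    by (auto intro!: continuous_at_imp_continuous_on differentiable_imp_continuous_within)
next
  case (Suc r) then show ?case by (metis ck.simps(2))
qed

lemma ck_differentiable: "ck (Suc r) Z f \<Longrightarrow> z \<in> Z \<Longrightarrow> f differentiable (at z)" by simp

lemma ck_const: "ck r Z (\<lambda>z. k)"
proof (induction r arbitrary: k)
  case (Suc r)
  have "dd v (\<lambda>z. k) = (\<lambda>z. 0)" for v :: 'a by (rule ext) simp
  then show ?case using Suc by simp
qed simp

lemma ck_add: "open Z \<Longrightarrow> ck r Z f \<Longrightarrow> ck r Z g \<Longrightarrow> ck r Z (\<lambda>z. f z + g z)"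
proof (induction r arbitrary: f g)
  case 0 then show ?case by (auto intro: continuous_intros)
next
  case (Suc r)
  have "ck r Z (dd v (\<lambda>z. f z + g z))" for v
    by (rule ck_cong[OF Suc.prems(1) _ Suc.IH[OF Suc.prems(1), of "dd v f" "dd v g"]])
       (use Suc.prems in \<open>auto simp: dd_add\<close>)
  then show ?case using Suc.prems by auto
qed

lemma ck_mult: "open Z \<Longrightarrow> ck r Z f \<Longrightarrow> ck r Z g \<Longrightarrow> ck r Z (\<lambda>z. f z * g z)"
proof (induction r arbitrary: f g)
  case 0 then show ?case by (auto intro: continuous_intros)
next
  case (Suc r)
  have 1: "ck r Z (\<lambda>z. f z * dd v g z)" "ck r Z (\<lambda>z. dd v f z * g z)" for v
    using Suc.IH[OF Suc.prems(1)] Suc.prems ck_SucD[OF Suc.prems(2)] ck_SucD[OF Suc.prems(3)] by auto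
  have "ck r Z (dd v (\<lambda>z. f z * g z))" for v
    by (rule ck_cong[OF Suc.prems(1) _ ck_add[OF Suc.prems(1) 1]])
       (use Suc.prems in \<open>auto simp: dd_mult\<close>)
  then show ?case using Suc.prems by auto
qed

text \<open>The derivative -f'/f^2 involves the inverse only up to the order of the induction
  hypothesis; \<open>ck_sqrt\<close> rests on the same observation.\<close>

lemma ck_inverse: "open Z \<Longrightarrow> ck r Z f \<Longrightarrow> (\<And>z. z \<in> Z \<Longrightarrow> f z \<noteq> 0) \<Longrightarrow> ck r Z (\<lambda>z. inverse (f z))"
proof (induction r)
  case 0 then show ?case by (auto intro: continuous_intros)
next
  case (Suc r)
  have i: "ck r Z (\<lambda>z. inverse (f z))"
    using Suc.IH[OF Suc.prems(1) ck_SucD[OF Suc.prems(2)]] Suc.prems(3) by blast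
  have e: "dd v (\<lambda>z. inverse (f z)) z = - 1 * (dd v f z * (inverse (f z) * inverse (f z)))" if "z \<in> Z" for v z
    by (rule dd_eqI[THEN trans]) (use that Suc.prems in \<open>auto intro!: derivative_eq_intros has_derivative_dd\<close>)
  have "ck r Z (dd v (\<lambda>z. inverse (f z)))" for v
    by (rule ck_cong[OF Suc.prems(1) e[symmetric] ck_mult[OF Suc.prems(1) ck_const ck_mult[OF Suc.prems(1) _ ck_mult[OF Suc.prems(1) i i]]]])
       (use Suc.prems in auto)
  moreover have "\<forall>z\<in>Z. (\<lambda>z. inverse (f z)) differentiable (at z)"
    using Suc.prems by (auto intro!: differentiable_inverse)
  ultimately show ?case by simp
qed

lemma ck_sqrt: "open Z \<Longrightarrow> ck r Z f \<Longrightarrow> (\<And>z. z \<in> Z \<Longrightarrow> f z > 0) \<Longrightarrow> ck r Z (\<lambda>z. sqrt (f z))"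
proof (induction r)
  case 0 then show ?case by (auto intro: continuous_intros)
next
  case (Suc r)
  have s: "ck r Z (\<lambda>z. sqrt (f z))"
    using Suc.IH[OF Suc.prems(1) ck_SucD[OF Suc.prems(2)]] Suc.prems(3) by blast
  have "2 * sqrt (f z) \<noteq> 0" if "z \<in> Z" for z using Suc.prems(3)[OF that] by simp
  then have i: "ck r Z (\<lambda>z. inverse (2 * sqrt (f z)))"
    by (intro ck_inverse ck_mult ck_const s Suc.prems(1))
  have e: "dd v (\<lambda>z. sqrt (f z)) z = dd v f z * inverse (2 * sqrt (f z))" if "z \<in> Z" for v z
    using dd_sqrt[OF ck_differentiable[OF Suc.prems(2) that] Suc.prems(3)[OF that]] by (simp only: divide_inverse)
  have "ck r Z (dd v (\<lambda>z. sqrt (f z)))" for v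
    by (rule ck_cong[OF Suc.prems(1) e[symmetric] ck_mult[OF Suc.prems(1) _ i]])
       (use Suc.prems(2) in simp_all)
  moreover have "(\<lambda>z. sqrt (f z)) differentiable (at z)" if "z \<in> Z" for z
    using has_derivative_real_sqrt[OF Suc.prems(3)[OF that] has_derivative_dd[OF ck_differentiable[OF Suc.prems(2) that]]]
    unfolding differentiable_def by blast
  ultimately show ?case by simp
qed

lemma sm_const [simp, intro]: "sm Z (\<lambda>z. k)" by (simp add: sm_def ck_const)
lemma sm_cong: "open Z \<Longrightarrow> (\<And>z. z \<in> Z \<Longrightarrow> f z = g z) \<Longrightarrow> sm Z f \<Longrightarrow> sm Z g"
  unfolding sm_def using ck_cong by blast
lemma sm_add: "open Z \<Longrightarrow> sm Z f \<Longrightarrow> sm Z g \<Longrightarrow> sm Z (\<lambda>z. f z + g z)" by (simp add: sm_def ck_add)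
lemma sm_mult: "open Z \<Longrightarrow> sm Z f \<Longrightarrow> sm Z g \<Longrightarrow> sm Z (\<lambda>z. f z * g z)" by (simp add: sm_def ck_mult)
lemma sm_inverse: "open Z \<Longrightarrow> sm Z f \<Longrightarrow> (\<And>z. z \<in> Z \<Longrightarrow> f z \<noteq> 0) \<Longrightarrow> sm Z (\<lambda>z. inverse (f z))"
  by (simp add: sm_def ck_inverse)
lemma sm_divide: "open Z \<Longrightarrow> sm Z f \<Longrightarrow> sm Z g \<Longrightarrow> (\<And>z. z \<in> Z \<Longrightarrow> g z \<noteq> 0) \<Longrightarrow> sm Z (\<lambda>z. f z / g z)"
  unfolding divide_inverse by (intro sm_mult sm_inverse)
lemma sm_sqrt: "open Z \<Longrightarrow> sm Z f \<Longrightarrow> (\<And>z. z \<in> Z \<Longrightarrow> f z > 0) \<Longrightarrow> sm Z (\<lambda>z. sqrt (f z))"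
  by (simp add: sm_def ck_sqrt)
lemma sm_minus: "open Z \<Longrightarrow> sm Z f \<Longrightarrow> sm Z (\<lambda>z. - f z)"
  using sm_mult[of Z "\<lambda>z. - 1" f] by simp
lemma sm_diff: "open Z \<Longrightarrow> sm Z f \<Longrightarrow> sm Z g \<Longrightarrow> sm Z (\<lambda>z. f z - g z)"
  using sm_add[of Z f "\<lambda>z. - g z"] sm_minus[of Z g] by simp
lemma sm_power: "open Z \<Longrightarrow> sm Z f \<Longrightarrow> sm Z (\<lambda>z. f z ^ k)"
  by (induction k) (auto intro: sm_mult)
lemma sm_sum: "open Z \<Longrightarrow> (\<And>i. i \<in> I \<Longrightarrow> sm Z (f i)) \<Longrightarrow> sm Z (\<lambda>z. \<Sum>i\<in>I. f i z)"
  by (induction I rule: infinite_finite_induct) (auto intro: sm_add)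
lemma sm_prod: "open Z \<Longrightarrow> (\<And>i. i \<in> I \<Longrightarrow> sm Z (f i)) \<Longrightarrow> sm Z (\<lambda>z. \<Prod>i\<in>I. f i z)"
  by (induction I rule: infinite_finite_induct) (auto intro: sm_mult)
lemma sm_dd: "sm Z f \<Longrightarrow> sm Z (dd v f)" unfolding sm_def by (metis ck.simps(2))
lemma sm_differentiable: "sm Z f \<Longrightarrow> z \<in> Z \<Longrightarrow> f differentiable (at z)"
  unfolding sm_def by (metis ck.simps(2))
lemma sm_has_derivative: "sm Z f \<Longrightarrow> z \<in> Z \<Longrightarrow> (f has_derivative (\<lambda>v. dd v f z)) (at z)"
  using sm_differentiable has_derivative_dd by blast
lemma sm_continuous_on: "sm Z f \<Longrightarrow> continuous_on Z f" unfolding sm_def by (metis ck.simps(1))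
lemma sm_isCont: "open Z \<Longrightarrow> sm Z f \<Longrightarrow> z \<in> Z \<Longrightarrow> isCont f z"
  using sm_continuous_on continuous_on_eq_continuous_at by blast

lemma ck_subset: "ck r Z f \<Longrightarrow> Y \<subseteq> Z \<Longrightarrow> ck r Y f"
  by (induction r arbitrary: f) (auto intro: continuous_on_subset)
lemma sm_subset: "sm Z f \<Longrightarrow> Y \<subseteq> Z \<Longrightarrow> sm Y f"
  unfolding sm_def using ck_subset by blast

lemma sm_bounded_linear: assumes "bounded_linear f" shows "sm Z f"
proof -
  have "dd v f = (\<lambda>z. f v)" for v using dd_bounded_linear[OF assms] by blast
  then have "ck (Suc r) Z f" for r
    using assms by (simp add: ck_const bounded_linear_imp_differentiable)
  then show ?thesis unfolding sm_def using ck_SucD by blast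
qed

lemma dd_linear_comb:
  assumes "f differentiable (at z)"
  shows "dd (u + v) f z = dd u f z + dd v f z" "dd (u - v) f z = dd u f z - dd v f z"
    "dd (k *\<^sub>R u) f z = k * dd u f z" "dd (- u) f z = - dd u f z" "dd 0 f z = 0"
  using linear_add[OF linear_dd[OF assms]] linear_diff[OF linear_dd[OF assms]]
    linear_cmul[OF linear_dd[OF assms]] linear_neg[OF linear_dd[OF assms]] linear_0[OF linear_dd[OF assms]]
  by auto

lemma dd_sum_dir: assumes "f differentiable (at z)"
  shows "dd (\<Sum>i\<in>I. u i) f z = (\<Sum>i\<in>I. dd (u i) f z)"
  using linear_sum[OF linear_dd[OF assms]] by (simp add: o_def)

text \<open>Two applications of the mean value theorem, first along v and then along w. The
  left-hand side is symmetric in v and w, which is what \<open>dd_commute\<close> exploits.\<close>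

lemma second_difference:
  assumes "sm Z f" "0 < h"
    and in_Z: "\<And>s t. 0 \<le> s \<Longrightarrow> s \<le> h \<Longrightarrow> 0 \<le> t \<Longrightarrow> t \<le> h \<Longrightarrow> z + s *\<^sub>R v + t *\<^sub>R w \<in> Z"
  obtains s t where "0 < s" "s < h" "0 < t" "t < h"
    "f (z + h *\<^sub>R v + h *\<^sub>R w) - f (z + h *\<^sub>R v) - f (z + h *\<^sub>R w) + f z
      = h * h * dd w (dd v f) (z + s *\<^sub>R v + t *\<^sub>R w)"
proof -
  have line: "((\<lambda>s. g (p + s *\<^sub>R u)) has_field_derivative dd u g (p + s *\<^sub>R u)) (at s)"
    if "sm Z g" "p + s *\<^sub>R u \<in> Z" for g p u s
  proof -
    note d = sm_differentiable[OF that]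
    have "((\<lambda>s. g (p + s *\<^sub>R u)) has_derivative (\<lambda>t. dd (t *\<^sub>R u) g (p + s *\<^sub>R u))) (at s)"
      by (rule has_derivative_compose[where f = "\<lambda>s. p + s *\<^sub>R u", OF _ has_derivative_dd[OF d]])
         (auto intro!: derivative_eq_intros)
    then show ?thesis by (simp add: has_field_derivative_def dd_linear_comb[OF d] mult.commute[of _ "dd u g (p + s *\<^sub>R u)"])
  qed
  have "\<exists>s>0. s < h \<and> (f ((z + h *\<^sub>R w) + h *\<^sub>R v) - f (z + h *\<^sub>R v)) - (f ((z + h *\<^sub>R w) + 0 *\<^sub>R v) - f (z + 0 *\<^sub>R v))
     = (h - 0) * (dd v f ((z + h *\<^sub>R w) + s *\<^sub>R v) - dd v f (z + s *\<^sub>R v))"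
  proof (rule MVT2)
    fix s assume "0 \<le> s" "s \<le> h"
    then have "z + s *\<^sub>R v \<in> Z" "(z + h *\<^sub>R w) + s *\<^sub>R v \<in> Z"
      using in_Z[of s 0] in_Z[of s h] assms(2) by (auto simp: algebra_simps)
    then show "((\<lambda>s. f ((z + h *\<^sub>R w) + s *\<^sub>R v) - f (z + s *\<^sub>R v)) has_field_derivative
        (dd v f ((z + h *\<^sub>R w) + s *\<^sub>R v) - dd v f (z + s *\<^sub>R v))) (at s)"
      by (intro DERIV_diff line assms(1))
  qed (use assms in auto)
  then obtain s where s: "0 < s" "s < h" and 1:
    "(f ((z + h *\<^sub>R w) + h *\<^sub>R v) - f (z + h *\<^sub>R v)) - (f ((z + h *\<^sub>R w) + 0 *\<^sub>R v) - f (z + 0 *\<^sub>R v))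
     = (h - 0) * (dd v f ((z + h *\<^sub>R w) + s *\<^sub>R v) - dd v f (z + s *\<^sub>R v))" by blast
  have "\<exists>t>0. t < h \<and> dd v f ((z + s *\<^sub>R v) + h *\<^sub>R w) - dd v f ((z + s *\<^sub>R v) + 0 *\<^sub>R w)
     = (h - 0) * dd w (dd v f) ((z + s *\<^sub>R v) + t *\<^sub>R w)"
  proof (rule MVT2)
    fix t assume "0 \<le> t" "t \<le> h"
    then show "((\<lambda>t. dd v f ((z + s *\<^sub>R v) + t *\<^sub>R w)) has_field_derivative
        dd w (dd v f) ((z + s *\<^sub>R v) + t *\<^sub>R w)) (at t)"
      using s by (intro line sm_dd assms(1) in_Z) auto
  qed (use assms in auto)
  then obtain t where t: "0 < t" "t < h" and 2: "dd v f ((z + s *\<^sub>R v) + h *\<^sub>R w) - dd v f ((z + s *\<^sub>R v) + 0 *\<^sub>R w)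
     = (h - 0) * dd w (dd v f) ((z + s *\<^sub>R v) + t *\<^sub>R w)" by blast
  show ?thesis
    apply (rule that[OF s t])
    using 1 2 by (simp add: algebra_simps)
qed

text \<open>Schwarz's theorem: the symmetric second difference is h^2 times either mixed derivative,
  each taken at some point near z. If the two differed at z, continuity would keep them apart
  nearby.\<close>

lemma dd_commute:
  fixes f :: "'a::real_normed_vector \<Rightarrow> real"
  assumes "open Z" "sm Z f" "z \<in> Z"
  shows "dd v (dd w f) z = dd w (dd v f) z"
proof (rule ccontr)
  define P where "P = dd w (dd v f)"
  define Q where "Q = dd v (dd w f)"
  assume "dd v (dd w f) z \<noteq> dd w (dd v f) z"
  then have e: "\<bar>P z - Q z\<bar> / 2 > 0" by (simp add: P_def Q_def)
  have "isCont P z" "isCont Q z"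
    unfolding P_def Q_def using assms by (auto intro!: sm_isCont[of Z] sm_dd)
  then obtain d1 d2 where d: "d1 > 0" "\<And>u. dist u z < d1 \<Longrightarrow> dist (P u) (P z) < \<bar>P z - Q z\<bar> / 2"
      "d2 > 0" "\<And>u. dist u z < d2 \<Longrightarrow> dist (Q u) (Q z) < \<bar>P z - Q z\<bar> / 2"
    using e unfolding continuous_at_eps_delta by metis
  obtain d3 where d3: "d3 > 0" "\<And>u. dist u z < d3 \<Longrightarrow> u \<in> Z"
    using assms by (meson open_dist)
  define d where "d = min d1 (min d2 d3)"
  \<comment> \<open>The summand 1 keeps m positive when v and w are both zero; with side h = d / m
    the parallelogram stays within distance d of z.\<close>
  define m where "m = norm v + norm w + 1"
  define h where "h = d / m"
  have m: "m > 0" "norm v + norm w < m" by (simp_all add: m_def add_nonneg_pos)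
  have dpos: "d > 0" using d d3 by (simp add: d_def)
  have hpos: "h > 0" using m dpos by (simp add: h_def)
  have near: "dist (z + s *\<^sub>R v + t *\<^sub>R w) z < d" if "0 \<le> s" "s \<le> h" "0 \<le> t" "t \<le> h" for s t
  proof -
    have "dist (z + s *\<^sub>R v + t *\<^sub>R w) z = norm (s *\<^sub>R v + t *\<^sub>R w)" by (simp add: dist_norm)
    also have "\<dots> \<le> s * norm v + t * norm w" using norm_triangle_ineq[of "s *\<^sub>R v" "t *\<^sub>R w"] that by simp
    also have "\<dots> \<le> h * norm v + h * norm w" using that by (intro add_mono mult_right_mono) auto
    also have "\<dots> < h * m" using m hpos by (simp flip: distrib_left)
    also have "\<dots> = d" using m by (simp add: h_def)
    finally show ?thesis .
  qed
  have inZ: "z + s *\<^sub>R v + t *\<^sub>R w \<in> Z" if "0 \<le> s" "s \<le> h" "0 \<le> t" "t \<le> h" for s t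
    using near[OF that] d3 by (simp add: d_def)
  obtain s t where st: "0 < s" "s < h" "0 < t" "t < h" and 1:
    "f (z + h *\<^sub>R v + h *\<^sub>R w) - f (z + h *\<^sub>R v) - f (z + h *\<^sub>R w) + f z
      = h * h * P (z + s *\<^sub>R v + t *\<^sub>R w)"
    unfolding P_def by (rule second_difference[OF assms(2) hpos inZ]) auto
  have inZ': "z + s *\<^sub>R w + t *\<^sub>R v \<in> Z" if "0 \<le> s" "s \<le> h" "0 \<le> t" "t \<le> h" for s t
    using inZ[of t s] that by (simp add: algebra_simps)
  obtain s' t' where st': "0 < s'" "s' < h" "0 < t'" "t' < h" and 2:
    "f (z + h *\<^sub>R w + h *\<^sub>R v) - f (z + h *\<^sub>R w) - f (z + h *\<^sub>R v) + f z
      = h * h * Q (z + s' *\<^sub>R w + t' *\<^sub>R v)"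
    unfolding Q_def by (rule second_difference[OF assms(2) hpos inZ']) auto
  have "h * h * P (z + s *\<^sub>R v + t *\<^sub>R w) = h * h * Q (z + s' *\<^sub>R w + t' *\<^sub>R v)"
    using 1 2 by (simp add: algebra_simps)
  then have "P (z + s *\<^sub>R v + t *\<^sub>R w) = Q (z + s' *\<^sub>R w + t' *\<^sub>R v)" using hpos by simp
  moreover have "dist (P (z + s *\<^sub>R v + t *\<^sub>R w)) (P z) < \<bar>P z - Q z\<bar> / 2"
    using near[of s t] st by (intro d) (auto simp: d_def)
  moreover have "dist (Q (z + s' *\<^sub>R w + t' *\<^sub>R v)) (Q z) < \<bar>P z - Q z\<bar> / 2"
    using near[of t' s'] st' by (intro d) (auto simp: d_def algebra_simps)
  ultimately show False by (auto simp: dist_real_def abs_if split: if_splits)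
qed

section \<open>Coordinate derivatives on the tangent bundle\<close>

type_synonym 'n tangent = "(real, 'n) vec \<times> (real, 'n) vec"

abbreviation dx :: "'n::finite \<Rightarrow> ('n tangent \<Rightarrow> real) \<Rightarrow> 'n tangent \<Rightarrow> real" where
  "dx k \<equiv> dd (axis k 1, 0)"
abbreviation dy :: "'n::finite \<Rightarrow> ('n tangent \<Rightarrow> real) \<Rightarrow> 'n tangent \<Rightarrow> real" where
  "dy k \<equiv> dd (0, axis k 1)"

lemma partial_eq_dd: "partial k f x = dd (axis k 1) f x" by (simp add: partial_def dd_def)

lemma partial_cong:
  assumes "open U" "x \<in> U" "\<And>u. u \<in> U \<Longrightarrow> f u = g u"
  shows "partial k f x = partial k g x"
  unfolding partial_eq_dd using assms by (rule dd_cong)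

lemma partial_fst:
  assumes "f differentiable (at (x, y))"
  shows "partial k (\<lambda>u. f (u, y)) x = dx k f (x, y)"
proof -
  have "((\<lambda>u. f (u, y)) has_derivative (\<lambda>v. dd (v, 0) f (x, y))) (at x)"
    by (rule has_derivative_compose[where f = "\<lambda>u. (u, y)", OF _ has_derivative_dd[OF assms]])
       (auto intro!: derivative_eq_intros)
  then show ?thesis unfolding partial_eq_dd by (rule dd_eqI)
qed

lemma partial_snd:
  assumes "f differentiable (at (x, y))"
  shows "partial k (\<lambda>v. f (x, v)) y = dy k f (x, y)"
proof -
  have "((\<lambda>u. f (x, u)) has_derivative (\<lambda>v. dd (0, v) f (x, y))) (at y)"
    by (rule has_derivative_compose[where f = "\<lambda>u. (x, u)", OF _ has_derivative_dd[OF assms]])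
       (auto intro!: derivative_eq_intros)
  then show ?thesis unfolding partial_eq_dd by (rule dd_eqI)
qed

lemma open_slices:
  assumes "open Z" "(x, y) \<in> Z"
  obtains U V where "open U" "open V" "x \<in> U" "y \<in> V" "U \<times> V \<subseteq> Z"
  using assms by (metis open_prod_elim SigmaE2)

text \<open>The two functions are compared on an open set of pairs only, so nested partial
  derivatives can be replaced from the inside, where the inner formula is known for nondegenerate
  directions only.\<close>

lemma partial_fst_cong:
  assumes "open Z" "(x, y) \<in> Z" "\<And>u v. (u, v) \<in> Z \<Longrightarrow> g u v = f (u, v)" "sm Z f"
  shows "partial k (\<lambda>u. g u y) x = dx k f (x, y)"
proof -
  obtain U V where UV: "open U" "open V" "x \<in> U" "y \<in> V" "U \<times> V \<subseteq> Z"
    using open_slices[OF assms(1,2)] .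
  have "partial k (\<lambda>u. g u y) x = partial k (\<lambda>u. f (u, y)) x"
    by (rule partial_cong[OF UV(1,3)]) (use UV assms in auto)
  then show ?thesis using partial_fst sm_differentiable[OF assms(4,2)] by metis
qed

lemma partial_snd_cong:
  assumes "open Z" "(x, y) \<in> Z" "\<And>v. (x, v) \<in> Z \<Longrightarrow> g v = f (x, v)" "sm Z f"
  shows "partial k g y = dy k f (x, y)"
proof -
  obtain U V where UV: "open U" "open V" "x \<in> U" "y \<in> V" "U \<times> V \<subseteq> Z"
    using open_slices[OF assms(1,2)] .
  have "partial k g y = partial k (\<lambda>v. f (x, v)) y"
    by (rule partial_cong[OF UV(2,4)]) (use UV assms in auto)
  then show ?thesis using partial_snd sm_differentiable[OF assms(4,2)] by metis
qed

lemma vec_axis_sum: "(v::real^'n::finite) = (\<Sum>k\<in>UNIV. v $ k *\<^sub>R axis k 1)"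
  using basis_expansion[of v] by (simp add: scalar_mult_eq_scaleR)

lemma dd_axis: assumes "f differentiable (at z)"
  shows "dd (v::real^'n::finite) f z = (\<Sum>k\<in>UNIV. v $ k * dd (axis k 1) f z)"
  by (subst vec_axis_sum) (simp add: dd_sum_dir[OF assms] dd_linear_comb[OF assms])

lemma dd_pair:
  fixes u v :: "real^'n::finite"
  assumes "f differentiable (at z)"
  shows "dd (u, v) f z = (\<Sum>k\<in>UNIV. u $ k * dx k f z) + (\<Sum>k\<in>UNIV. v $ k * dy k f z)"
proof -
  have 1: "(u, 0) = (\<Sum>k\<in>UNIV. u $ k *\<^sub>R (axis k 1 :: real^'n, 0 :: real^'n))"
    using vec_axis_sum[of u] by (simp add: prod_eq_iff fst_sum snd_sum)
  have 2: "(0, v) = (\<Sum>k\<in>UNIV. v $ k *\<^sub>R (0 :: real^'n, axis k 1 :: real^'n))"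
    using vec_axis_sum[of v] by (simp add: prod_eq_iff fst_sum snd_sum)
  have "dd (u, v) f z = dd ((u, 0) + (0, v)) f z" by simp
  also have "\<dots> = dd (u, 0) f z + dd (0, v) f z" by (rule dd_linear_comb[OF assms])
  also have "dd (u, 0) f z = (\<Sum>k\<in>UNIV. u $ k * dx k f z)"
    unfolding 1 by (simp add: dd_sum_dir[OF assms] dd_linear_comb[OF assms] del: scaleR_Pair)
  also have "dd (0, v) f z = (\<Sum>k\<in>UNIV. v $ k * dy k f z)"
    unfolding 2 by (simp add: dd_sum_dir[OF assms] dd_linear_comb[OF assms] del: scaleR_Pair)
  finally show ?thesis .
qed

section \<open>From coordinatewise smoothness to smoothness in all directions\<close>

lemma ck_sum: "open Z \<Longrightarrow> (\<And>i. i \<in> I \<Longrightarrow> ck r Z (f i)) \<Longrightarrow> ck r Z (\<lambda>z. \<Sum>i\<in>I. f i z)"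
  by (induction I rule: infinite_finite_induct) (auto intro: ck_add ck_const)

text \<open>\<open>Ck_on\<close> includes total differentiability, so each directional derivative is
  a linear combination of partial derivatives with constant coefficients, and the induction applies
  to it.\<close>

lemma ck_if_Ck_on: "open S \<Longrightarrow> Ck_on r S f \<Longrightarrow> ck r S f"
proof (induction r arbitrary: f)
  case (Suc r)
  have "ck r S (\<lambda>z. \<Sum>k\<in>UNIV. v $ k * partial k f z)" for v
    using Suc by (intro ck_sum ck_mult ck_const) auto
  moreover have "(\<Sum>k\<in>UNIV. v $ k * partial k f z) = dd v f z" if "z \<in> S" for v z
    using that Suc.prems dd_axis[of f z v] by (auto simp: partial_eq_dd)
  ultimately have "ck r S (dd v f)" for v
    by (rule ck_cong[OF Suc.prems(1), rotated])
  then show ?case using Suc.prems by auto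
qed simp

lemma sm_if_smooth_on: "open S \<Longrightarrow> smooth_on S f \<Longrightarrow> sm S f"
  unfolding smooth_on_def sm_def using ck_if_Ck_on by blast

text \<open>A linear map is its own derivative at every point, so each derivative of the composition
  is again such a composition.\<close>

lemma ck_compose_linear:
  "bounded_linear L \<Longrightarrow> open S \<Longrightarrow> ck r S h \<Longrightarrow> ck r (L -` S) (\<lambda>z. h (L z))"
proof (induction r arbitrary: h)
  case 0 then show ?case
    using continuous_on_compose2[of S h _ L, OF _ linear_continuous_on[of L]] by auto
next
  case (Suc r)
  have o: "open (L -` S)" using Suc.prems by (intro open_vimage) (auto intro: linear_continuous_on)
  have "dd (L v) h (L z) = dd v (\<lambda>z. h (L z)) z" if "z \<in> L -` S" for v z
    using that Suc.prems by (simp add: dd_compose_linear)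
  moreover have "ck r (L -` S) (\<lambda>z. dd (L v) h (L z))" for v using Suc by auto
  ultimately have "ck r (L -` S) (dd v (\<lambda>z. h (L z)))" for v
    using ck_cong[OF o, of "\<lambda>z. dd (L v) h (L z)" "dd v (\<lambda>z. h (L z))"] by blast
  moreover have "(\<lambda>z. h (L z)) differentiable at z" if "L z \<in> S" for z
    using Suc.prems that differentiable_chain_at[of L z h] bounded_linear_imp_differentiable[of L]
    by (auto simp: o_def)
  ultimately show ?case by simp
qed

lemma sm_fst: "open S \<Longrightarrow> sm S h \<Longrightarrow> Z \<subseteq> S \<times> UNIV \<Longrightarrow> sm Z (\<lambda>z. h (fst z))"
proof (rule sm_subset[of "fst -` S"])
  assume "open S" "sm S h" then show "sm (fst -` S) (\<lambda>z. h (fst z))"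
    unfolding sm_def using ck_compose_linear[OF bounded_linear_fst] by blast
qed auto

lemma sm_snd_nth: "sm Z (\<lambda>z. snd z $ i)"
  by (rule sm_bounded_linear) (auto intro: bounded_linear_compose[OF bounded_linear_vec_nth bounded_linear_snd])

lemma dd_snd_nth [simp]: "dd (u, v) (\<lambda>z. snd z $ i) z = v $ i"
  by (rule dd_bounded_linear[THEN trans]) (auto intro: bounded_linear_compose[OF bounded_linear_vec_nth bounded_linear_snd])

lemma dd_cmult: "f differentiable (at z) \<Longrightarrow> dd v (\<lambda>z. c * f z) z = c * dd v f z"
  by (subst dd_mult) auto

lemma dd_fst: "h differentiable (at (fst z)) \<Longrightarrow> dd (u, v) (\<lambda>z. h (fst z)) z = dd u h (fst z)"
  using dd_compose_linear[OF bounded_linear_fst, of h z "(u, v)"] by simp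

section \<open>The Riemann tensor of a spray\<close>

text \<open>Stated for arbitrary coefficient functions of (x, y), so that a sum such as the spray of
  \<alpha> plus a deviation can be inserted before any Finsler metric is involved.\<close>

definition Rm :: "('n::finite \<Rightarrow> 'n tangent \<Rightarrow> real) \<Rightarrow> 'n \<Rightarrow> 'n \<Rightarrow> 'n tangent \<Rightarrow> real" where
  "Rm H i k z = 2 * dx k (H i) z - (\<Sum>l\<in>UNIV. dy k (dx l (H i)) z * snd z $ l)
     + 2 * (\<Sum>l\<in>UNIV. H l z * dy l (dy k (H i)) z) - (\<Sum>l\<in>UNIV. dy l (H i) z * dy k (H l) z)"

lemma riemann_eq_Rm:
  assumes Z: "open Z" "(x, y) \<in> Z" and H: "\<And>i. sm Z (H i)"
    and e: "\<And>u v i. (u, v) \<in> Z \<Longrightarrow> spray F u v $ i = H i (u, v)"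
  shows "riemann F x y $ i $ k = Rm H i k (x, y)"
proof -
  have 1: "partial l (\<lambda>u. spray F u v $ i) u = dx l (H i) (u, v)" if "(u, v) \<in> Z" for u v l i
    using partial_fst_cong[OF Z(1) that, of "\<lambda>u v. spray F u v $ i" "H i"] e H by blast
  have 2: "partial l (\<lambda>v. spray F u v $ i) v = dy l (H i) (u, v)" if "(u, v) \<in> Z" for u v l i
    using partial_snd_cong[OF Z(1) that, of "\<lambda>v. spray F u v $ i" "H i"] e H by blast
  have 3: "partial k (\<lambda>v. partial l (\<lambda>u. spray F u v $ i) x) y = dy k (dx l (H i)) (x, y)" for l
    by (rule partial_snd_cong[OF Z]) (auto intro: 1 sm_dd H)
  have 4: "partial l (\<lambda>v. partial k (\<lambda>w. spray F x w $ i) v) y = dy l (dy k (H i)) (x, y)" for l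
    by (rule partial_snd_cong[OF Z]) (auto intro: 2 sm_dd H)
  show ?thesis
    unfolding riemann_def Rm_def by (simp add: 1[OF Z(2)] 2[OF Z(2)] 3 4 e[OF Z(2)])
qed

lemma fundamental_tensor_eq:
  assumes Z: "open Z" "(x, y) \<in> Z" "sm Z Q" "\<And>u v. (u, v) \<in> Z \<Longrightarrow> (F u v)\<^sup>2 = Q (u, v)"
  shows "fundamental_tensor F x y $ l $ m = 1/2 * dy l (dy m Q) (x, y)"
proof -
  have 2: "partial l (\<lambda>v. (F u v)\<^sup>2) v = dy l Q (u, v)" if "(u, v) \<in> Z" for u v l
    using partial_snd_cong[OF Z(1) that, of "\<lambda>v. (F u v)\<^sup>2" Q] Z by blast
  have 4: "partial l (\<lambda>v. partial k (\<lambda>w. (F x w)\<^sup>2) v) y = dy l (dy k Q) (x, y)" for k l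
    by (rule partial_snd_cong[OF Z(1,2)]) (auto intro: 2 sm_dd Z)
  show ?thesis
    unfolding fundamental_tensor_def by (simp add: 4 dd_commute[OF Z(1) Z(3) Z(2), of "(0, axis m 1)"])
qed

lemma Rm_cong:
  assumes "open Z" "z \<in> Z" "\<And>i u. u \<in> Z \<Longrightarrow> H i u = K i u"
  shows "Rm H i k z = Rm K i k z"
proof -
  have 1: "dd v (H i) u = dd v (K i) u" if "u \<in> Z" for i v u
    by (rule dd_cong[OF assms(1) that]) (rule assms(3))
  have 2: "dd w (dd v (H i)) z = dd w (dd v (K i)) z" for i v w
    by (rule dd_cong[OF assms(1,2)]) (rule 1)
  show ?thesis unfolding Rm_def by (simp add: 1[OF assms(2)] 2 assms(3)[OF assms(2)])
qed

section \<open>Riemannian metrics in a chart\<close>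

lemma sum_axis [simp]:
  fixes f :: "'n::finite \<Rightarrow> real"
  shows "(\<Sum>k\<in>UNIV. f k * axis i 1 $ k) = f i" "(\<Sum>k\<in>UNIV. axis i 1 $ k * f k) = f i"
  by (simp_all add: axis_def if_distrib[of "\<lambda>c. _ * c"] if_distrib[of "\<lambda>c. c * _"] cong: if_cong)

lemma matrix_inv_right: "invertible A \<Longrightarrow> A ** matrix_inv A = mat 1"
  and matrix_inv_left: "invertible A \<Longrightarrow> matrix_inv A ** A = mat 1"
  using someI_ex[of "\<lambda>A'. A ** A' = mat 1 \<and> A' ** A = mat 1"]
  by (auto simp: invertible_def matrix_inv_def)

lemmas sum_ac = sum_distrib_left sum_distrib_right mult_ac

lemma sum_reverse3: "(\<Sum>i\<in>I. \<Sum>j\<in>J. \<Sum>k\<in>K. f i j k) = (\<Sum>k\<in>K. \<Sum>j\<in>J. \<Sum>i\<in>I. f i j k)"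
proof -
  have "(\<Sum>i\<in>I. \<Sum>j\<in>J. \<Sum>k\<in>K. f i j k) = (\<Sum>j\<in>J. \<Sum>i\<in>I. \<Sum>k\<in>K. f i j k)" by (rule sum.swap)
  also have "\<dots> = (\<Sum>j\<in>J. \<Sum>k\<in>K. \<Sum>i\<in>I. f i j k)" by (intro sum.cong refl sum.swap)
  also have "\<dots> = (\<Sum>k\<in>K. \<Sum>j\<in>J. \<Sum>i\<in>I. f i j k)" by (rule sum.swap)
  finally show ?thesis .
qed

lemma sm_det:
  assumes "open S" "\<And>i j. sm S (\<lambda>x. A x $ i $ j)"
  shows "sm S (\<lambda>x. det (A x :: real^'n::finite^'n))"
  unfolding det_def by (intro sm_sum sm_mult sm_const sm_prod assms)

locale riem_chart =
  fixes S :: "(real^'n::finite) set" and a :: "real^'n \<Rightarrow> real^'n^'n"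
  assumes open_S: "open S"
    and smooth_a: "\<And>i j. smooth_on S (\<lambda>x. a x $ i $ j)"
    and sym_a: "\<And>x i j. x \<in> S \<Longrightarrow> a x $ i $ j = a x $ j $ i"
    and pos_a: "\<And>x y. x \<in> S \<Longrightarrow> y \<noteq> 0 \<Longrightarrow> 0 < y \<bullet> (a x *v y)"
begin

abbreviation ai :: "real^'n \<Rightarrow> 'n \<Rightarrow> 'n \<Rightarrow> real" where "ai x i j \<equiv> matrix_inv (a x) $ i $ j"
abbreviation Gam :: "'n \<Rightarrow> 'n \<Rightarrow> 'n \<Rightarrow> real^'n \<Rightarrow> real" where "Gam i j k x \<equiv> christoffel a x i j k"
abbreviation da :: "'n \<Rightarrow> 'n \<Rightarrow> 'n \<Rightarrow> real^'n \<Rightarrow> real" where "da l i j x \<equiv> partial l (\<lambda>u. a u $ i $ j) x"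

lemma sm_a: "sm S (\<lambda>x. a x $ i $ j)"
  using sm_if_smooth_on[OF open_S smooth_a] .

lemma a_ker: "x \<in> S \<Longrightarrow> a x *v v = 0 \<Longrightarrow> v = 0"
  using pos_a[of x v] by auto

lemma invertible_a: "x \<in> S \<Longrightarrow> invertible (a x)"
  using a_ker matrix_left_invertible_ker[of "a x"] invertible_left_inverse[of "a x"] by blast

lemma a_ai: "x \<in> S \<Longrightarrow> (\<Sum>k\<in>UNIV. a x $ i $ k * ai x k j) = (if i = j then 1 else 0)"
  using matrix_inv_right[OF invertible_a, of x] by (simp add: matrix_matrix_mult_def mat_def vec_eq_iff)

lemma ai_a: "x \<in> S \<Longrightarrow> (\<Sum>k\<in>UNIV. ai x i k * a x $ k $ j) = (if i = j then 1 else 0)"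
  using matrix_inv_left[OF invertible_a, of x] by (simp add: matrix_matrix_mult_def mat_def vec_eq_iff)

text \<open>Cramer's rule: an entry of the inverse is a quotient of determinants, hence of
  polynomials in the entries of the metric and constants.\<close>

lemma sm_ai: "sm S (\<lambda>x. ai x i j)"
proof -
  have "ai x i j = det (\<chi> k l. if l = i then axis j 1 $ k else a x $ k $ l) / det (a x)" if "x \<in> S" for x
  proof -
    have "a x *v column j (matrix_inv (a x)) = axis j 1"
      using a_ai[OF that] by (simp add: matrix_vector_mult_def column_def vec_eq_iff axis_def)
    then have "column j (matrix_inv (a x)) =
        (\<chi> k. det (\<chi> i l. if l = k then axis j 1 $ i else a x $ i $ l) / det (a x))"
      using cramer invertible_det_nz invertible_a[OF that] by blast
    then show ?thesis by (simp add: column_def vec_eq_iff)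
  qed
  moreover have "sm S (\<lambda>x. det (\<chi> k l. if l = i then axis j 1 $ k else a x $ k $ l) / det (a x))"
  proof (intro sm_divide sm_det open_S sm_a)
    show "sm S (\<lambda>x. (\<chi> k l. if l = i then axis j 1 $ k else a x $ k $ l) $ k $ l)" for k l
      by (cases "l = i") (auto intro: sm_a)
    show "det (a x) \<noteq> 0" if "x \<in> S" for x using invertible_a[OF that] invertible_det_nz by blast
  qed
  ultimately show ?thesis
    using sm_cong[OF open_S, of "\<lambda>x. det (\<chi> k l. if l = i then axis j 1 $ k else a x $ k $ l) / det (a x)" "\<lambda>x. ai x i j"]
    by simp
qed

lemma sm_da: "sm S (da l i j)"
  unfolding partial_eq_dd by (intro sm_dd sm_a)

lemma sm_Gam: "sm S (Gam i j k)"
  unfolding christoffel_def by (intro sm_mult sm_sum sm_add sm_diff sm_const sm_ai sm_da open_S)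

lemma Gam_sym: "x \<in> S \<Longrightarrow> Gam i j k x = Gam i k j x"
proof -
  assume x: "x \<in> S"
  have "da l j k x = da l k j x" for l
    by (rule partial_cong[OF open_S x]) (rule sym_a)
  then show ?thesis unfolding christoffel_def by (simp add: algebra_simps)
qed

lemma a_Gam: assumes x: "x \<in> S"
  shows "(\<Sum>i\<in>UNIV. a x $ m $ i * Gam i j k x) = 1/2 * (da j k m x + da k j m x - da m j k x)"
proof -
  let ?X = "\<lambda>l. da j k l x + da k j l x - da l j k x"
  have "(\<Sum>i\<in>UNIV. a x $ m $ i * Gam i j k x) = 1/2 * (\<Sum>i\<in>UNIV. \<Sum>l\<in>UNIV. a x $ m $ i * ai x i l * ?X l)"
    unfolding christoffel_def by (simp add: sum_distrib_left mult_ac)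
  also have "\<dots> = 1/2 * (\<Sum>l\<in>UNIV. (\<Sum>i\<in>UNIV. a x $ m $ i * ai x i l) * ?X l)"
    by (subst sum.swap) (simp add: sum_distrib_right)
  also have "\<dots> = 1/2 * ?X m" by (simp add: a_ai[OF x] if_distrib[of "\<lambda>c. c * _"] cong: if_cong)
  finally show ?thesis .
qed

lemma da_sym: "x \<in> S \<Longrightarrow> da l i j x = da l j i x"
  by (rule partial_cong[OF open_S]) (auto intro: sym_a)

text \<open>Metric compatibility of the Levi-Civita connection, \<nabla>a = 0. The horizontal
  constancy of \<alpha> rests on it.\<close>

lemma da_eq: assumes x: "x \<in> S"
  shows "da l i j x = (\<Sum>m\<in>UNIV. a x $ i $ m * Gam m l j x) + (\<Sum>m\<in>UNIV. a x $ j $ m * Gam m l i x)"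
proof -
  have *: "A = 1/2 * (D + C - B) + 1/2 * (A + B - C)" if "A = D" for A B C D :: real
    using that by (simp add: field_simps)
  show ?thesis unfolding a_Gam[OF x] by (rule *[OF da_sym[OF x]])
qed

text \<open>In index notation \<open>yl\<close>, \<open>Aq\<close>, \<open>G\<close> and
  \<open>N\<close> are y_i, \<alpha>^2, the spray coefficients of \<alpha> and their vertical
  derivatives, the connection coefficients.\<close>

definition yl :: "'n \<Rightarrow> 'n tangent \<Rightarrow> real" where
  "yl i z = (\<Sum>j\<in>UNIV. a (fst z) $ i $ j * snd z $ j)"
definition Aq :: "'n tangent \<Rightarrow> real" where
  "Aq z = (\<Sum>i\<in>UNIV. snd z $ i * yl i z)"
definition G :: "'n \<Rightarrow> 'n tangent \<Rightarrow> real" where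
  "G i z = 1/2 * (\<Sum>j\<in>UNIV. \<Sum>k\<in>UNIV. Gam i j k (fst z) * snd z $ j * snd z $ k)"
definition N :: "'n \<Rightarrow> 'n \<Rightarrow> 'n tangent \<Rightarrow> real" where
  "N i j z = (\<Sum>k\<in>UNIV. Gam i j k (fst z) * snd z $ k)"
text \<open>The horizontal lift of u: the velocity of a vector that is transported parallelly while
  its base point moves with velocity u. \<open>xi\<close>, which lifts y itself, is the geodesic
  spray of \<alpha>.\<close>

definition hlift :: "real^'n \<Rightarrow> 'n tangent \<Rightarrow> 'n tangent" where
  "hlift u z = (u, - (\<chi> m. \<Sum>j\<in>UNIV. N m j z * u $ j))"
abbreviation hor :: "'n \<Rightarrow> ('n tangent \<Rightarrow> real) \<Rightarrow> 'n tangent \<Rightarrow> real" where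
  "hor k f z \<equiv> dd (hlift (axis k 1) z) f z"
abbreviation xi :: "('n tangent \<Rightarrow> real) \<Rightarrow> 'n tangent \<Rightarrow> real" where
  "xi f z \<equiv> dd (hlift (snd z) z) f z"

abbreviation \<Omega> :: "'n tangent set" where "\<Omega> \<equiv> S \<times> UNIV"

lemma open_\<Omega>: "open \<Omega>" using open_S by (intro open_Times) auto

lemma sm_base: "sm S h \<Longrightarrow> sm \<Omega> (\<lambda>z. h (fst z))"
  by (rule sm_fst[OF open_S]) auto

lemma dd_base: "sm S h \<Longrightarrow> fst z \<in> S \<Longrightarrow> dd (u, v) (\<lambda>z. h (fst z)) z = dd u h (fst z)"
  by (rule dd_fst) (rule sm_differentiable)

lemma sm_yl: "sm \<Omega> (yl i)"
  unfolding yl_def by (intro sm_sum sm_mult open_\<Omega> sm_base[OF sm_a] sm_snd_nth)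
lemma sm_Aq: "sm \<Omega> Aq"
  unfolding Aq_def by (intro sm_sum sm_mult open_\<Omega> sm_yl sm_snd_nth)
lemma sm_G: "sm \<Omega> (G i)"
  unfolding G_def by (intro sm_sum sm_mult open_\<Omega> sm_base[OF sm_Gam] sm_snd_nth sm_const)
lemma sm_N: "sm \<Omega> (N i j)"
  unfolding N_def by (intro sm_sum sm_mult open_\<Omega> sm_base[OF sm_Gam] sm_snd_nth sm_const)

lemma dd_lin_comb_base:
  fixes u v :: "real^'n"
  assumes h: "\<And>j. sm S (h j)" and z: "fst z \<in> S"
  shows "dd (u, v) (\<lambda>z. \<Sum>j\<in>UNIV. h j (fst z) * snd z $ j) z
     = (\<Sum>j\<in>UNIV. dd u (h j) (fst z) * snd z $ j) + (\<Sum>j\<in>UNIV. h j (fst z) * v $ j)"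
proof -
  have z': "z \<in> \<Omega>" using z by (cases z) auto
  note d = sm_differentiable[OF sm_base[OF h] z'] sm_differentiable[OF sm_snd_nth z']
  have "dd (u, v) (\<lambda>z. \<Sum>j\<in>UNIV. h j (fst z) * snd z $ j) z
      = (\<Sum>j\<in>UNIV. h j (fst z) * v $ j + dd u (h j) (fst z) * snd z $ j)"
    by (subst dd_sum) (auto simp: dd_mult d dd_base[OF h z] intro!: differentiable_mult d)
  then show ?thesis by (simp add: sum.distrib)
qed

lemma dd_yl: assumes "fst z \<in> S"
  shows "dd (u, v) (yl i) z = (\<Sum>j\<in>UNIV. dd u (\<lambda>x. a x $ i $ j) (fst z) * snd z $ j) + (\<Sum>j\<in>UNIV. a (fst z) $ i $ j * v $ j)"
  unfolding yl_def by (rule dd_lin_comb_base[OF sm_a assms])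

lemma dd_N: assumes "fst z \<in> S"
  shows "dd (u, v) (N i k) z = (\<Sum>j\<in>UNIV. dd u (Gam i k j) (fst z) * snd z $ j) + (\<Sum>j\<in>UNIV. Gam i k j (fst z) * v $ j)"
  unfolding N_def by (rule dd_lin_comb_base[OF sm_Gam assms])

lemma G_eq_N: "G i z = 1/2 * (\<Sum>j\<in>UNIV. N i j z * snd z $ j)"
  unfolding G_def N_def by (simp add: sum_ac)

lemma dy_yl: "fst z \<in> S \<Longrightarrow> dy k (yl i) z = a (fst z) $ i $ k"
  by (simp add: dd_yl dd_linear_comb[OF sm_differentiable[OF sm_a]])

lemma dy_N: "fst z \<in> S \<Longrightarrow> dy k (N i j) z = Gam i j k (fst z)"
  by (simp add: dd_N dd_linear_comb[OF sm_differentiable[OF sm_Gam]])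

lemma dd_Aq:
  fixes u v :: "real^'n"
  assumes z: "fst z \<in> S"
  shows "dd (u, v) Aq z = (\<Sum>i\<in>UNIV. v $ i * yl i z) + (\<Sum>i\<in>UNIV. snd z $ i * dd (u, v) (yl i) z)"
proof -
  have z': "z \<in> \<Omega>" using z by (cases z) auto
  note d = sm_differentiable[OF sm_yl z'] sm_differentiable[OF sm_snd_nth z']
  have "dd (u, v) Aq z = (\<Sum>i\<in>UNIV. snd z $ i * dd (u, v) (yl i) z + v $ i * yl i z)"
    unfolding Aq_def by (subst dd_sum) (auto simp: dd_mult d intro!: differentiable_mult d)
  then show ?thesis by (simp add: sum.distrib)
qed

lemma yl_sym: "fst z \<in> S \<Longrightarrow> yl i z = (\<Sum>j\<in>UNIV. snd z $ j * a (fst z) $ j $ i)"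
  unfolding yl_def using sym_a by (intro sum.cong) (auto simp: mult.commute)

lemma dy_Aq: "fst z \<in> S \<Longrightarrow> dy k Aq z = 2 * yl k z"
  by (simp add: dd_Aq dy_yl yl_sym[symmetric])

lemma dy_G: assumes z: "fst z \<in> S" shows "dy k (G i) z = N i k z"
proof -
  have z': "z \<in> \<Omega>" using z by (cases z) auto
  note d = sm_differentiable[OF sm_N z'] sm_differentiable[OF sm_snd_nth z']
  have "dy k (G i) z = 1/2 * dy k (\<lambda>z. \<Sum>j\<in>UNIV. N i j z * snd z $ j) z"
    unfolding G_eq_N by (subst dd_mult) (auto intro!: differentiable_sum differentiable_mult d)
  also have "\<dots> = 1/2 * (\<Sum>j\<in>UNIV. N i j z * axis k 1 $ j + Gam i j k (fst z) * snd z $ j)"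
    by (subst dd_sum) (auto simp: dd_mult d dy_N[OF z] intro!: differentiable_mult d)
  also have "\<dots> = 1/2 * (N i k z + (\<Sum>j\<in>UNIV. Gam i k j (fst z) * snd z $ j))"
    using Gam_sym[OF z] by (simp add: sum.distrib)
  also have "\<dots> = N i k z" by (simp add: N_def)
  finally show ?thesis .
qed

lemma hlift_da:
  assumes z: "fst z \<in> S"
  shows "dd u (\<lambda>x. a x $ i $ j) (fst z) = (\<Sum>k\<in>UNIV. u $ k * ((\<Sum>m\<in>UNIV. a (fst z) $ i $ m * Gam m k j (fst z))
     + (\<Sum>m\<in>UNIV. a (fst z) $ j $ m * Gam m k i (fst z))))"
  by (subst dd_axis[OF sm_differentiable[OF sm_a z]]) (simp flip: partial_eq_dd da_eq[OF z])

text \<open>Since y is transported parallelly, only the connection term belonging to the free index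
  remains.\<close>

lemma hlift_yl:
  assumes z: "fst z \<in> S"
  shows "dd (hlift u z) (yl i) z = (\<Sum>k\<in>UNIV. \<Sum>m\<in>UNIV. u $ k * Gam m i k (fst z) * yl m z)"
proof -
  let ?a = "\<lambda>i j. a (fst z) $ i $ j" and ?g = "\<lambda>i j k. Gam i j k (fst z)" and ?y = "\<lambda>j. snd z $ j"
  have 1: "(\<Sum>j\<in>UNIV. dd u (\<lambda>x. a x $ i $ j) (fst z) * ?y j)
     = (\<Sum>j\<in>UNIV. \<Sum>k\<in>UNIV. \<Sum>m\<in>UNIV. u $ k * ?a i m * ?g m k j * ?y j)
       + (\<Sum>j\<in>UNIV. \<Sum>k\<in>UNIV. \<Sum>m\<in>UNIV. u $ k * ?a j m * ?g m k i * ?y j)"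
    unfolding hlift_da[OF z]
    by (simp add: sum_distrib_left sum_distrib_right sum.distrib distrib_left distrib_right mult_ac)
  have 2: "(\<Sum>j\<in>UNIV. \<Sum>k\<in>UNIV. \<Sum>m\<in>UNIV. u $ k * ?a i m * ?g m k j * ?y j)
     = (\<Sum>m\<in>UNIV. \<Sum>k\<in>UNIV. \<Sum>j\<in>UNIV. u $ k * ?a i m * ?g m k j * ?y j)"
    by (rule sum_reverse3)
  have 3: "(\<Sum>j\<in>UNIV. \<Sum>k\<in>UNIV. \<Sum>m\<in>UNIV. u $ k * ?a j m * ?g m k i * ?y j)
     = (\<Sum>k\<in>UNIV. \<Sum>m\<in>UNIV. \<Sum>j\<in>UNIV. u $ k * ?a j m * ?g m k i * ?y j)"
    by (subst sum.swap, subst (2) sum.swap) (rule refl)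
  have 4: "(\<Sum>j\<in>UNIV. ?a i j * (- (\<chi> m. \<Sum>j\<in>UNIV. N m j z * u $ j)) $ j)
     = - (\<Sum>m\<in>UNIV. \<Sum>k\<in>UNIV. \<Sum>j\<in>UNIV. u $ k * ?a i m * ?g m k j * ?y j)"
    unfolding N_def by (simp add: sum_ac sum_negf)
  have 5: "(\<Sum>k\<in>UNIV. \<Sum>m\<in>UNIV. \<Sum>j\<in>UNIV. u $ k * ?a j m * ?g m k i * ?y j)
     = (\<Sum>k\<in>UNIV. \<Sum>m\<in>UNIV. u $ k * ?g m i k * yl m z)"
    using Gam_sym[OF z] sym_a[OF z] by (simp add: yl_def sum_ac)
  show ?thesis
    unfolding hlift_def by (subst dd_yl[OF z]) (simp only: 1 2 3 4 5)
qed

text \<open>Parallel transport preserves length; in coordinates, the connection term of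
  \<open>hlift_yl\<close> cancels against the vertical part of the lift.\<close>

lemma hlift_Aq:
  assumes z: "fst z \<in> S" shows "dd (hlift u z) Aq z = 0"
proof -
  have "(\<Sum>i\<in>UNIV. snd z $ i * dd (hlift u z) (yl i) z)
     = (\<Sum>i\<in>UNIV. \<Sum>k\<in>UNIV. \<Sum>m\<in>UNIV. yl m z * Gam m k i (fst z) * snd z $ i * u $ k)"
    unfolding hlift_yl[OF z] using Gam_sym[OF z] by (simp add: sum_distrib_left mult_ac)
  also have "\<dots> = (\<Sum>m\<in>UNIV. \<Sum>k\<in>UNIV. \<Sum>i\<in>UNIV. yl m z * Gam m k i (fst z) * snd z $ i * u $ k)"
    by (rule sum_reverse3)
  also have "\<dots> = (\<Sum>m\<in>UNIV. (\<Sum>j\<in>UNIV. N m j z * u $ j) * yl m z)"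
    unfolding N_def by (simp add: sum_ac)
  finally show ?thesis
    unfolding hlift_def by (subst dd_Aq[OF z]) (simp add: sum_negf)
qed

text \<open>While y is transported parallelly, the function w_i y^i changes only through w, hence by
  its covariant derivative.\<close>

lemma hlift_form:
  assumes w: "\<And>i. sm S (\<lambda>x. w x $ i)" and z: "fst z \<in> S"
  shows "dd (hlift u z) (\<lambda>z. \<Sum>i\<in>UNIV. w (fst z) $ i * snd z $ i) z
     = (\<Sum>i\<in>UNIV. \<Sum>k\<in>UNIV. cov_deriv a w (fst z) i k * u $ k * snd z $ i)"
proof -
  have "(\<Sum>i\<in>UNIV. \<Sum>k\<in>UNIV. cov_deriv a w (fst z) i k * u $ k * snd z $ i)
     = (\<Sum>i\<in>UNIV. \<Sum>k\<in>UNIV. u $ k * partial k (\<lambda>u. w u $ i) (fst z) * snd z $ i)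
       - (\<Sum>i\<in>UNIV. \<Sum>k\<in>UNIV. \<Sum>m\<in>UNIV. w (fst z) $ m * Gam m k i (fst z) * snd z $ i * u $ k)"
    unfolding cov_deriv_def using Gam_sym[OF z]
    by (simp add: sum_distrib_left sum_distrib_right sum_subtractf algebra_simps)
  also have "(\<Sum>i\<in>UNIV. \<Sum>k\<in>UNIV. \<Sum>m\<in>UNIV. w (fst z) $ m * Gam m k i (fst z) * snd z $ i * u $ k)
     = (\<Sum>m\<in>UNIV. \<Sum>k\<in>UNIV. \<Sum>i\<in>UNIV. w (fst z) $ m * Gam m k i (fst z) * snd z $ i * u $ k)"
    by (rule sum_reverse3)
  also have "\<dots> = (\<Sum>m\<in>UNIV. w (fst z) $ m * (\<Sum>j\<in>UNIV. N m j z * u $ j))"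
    unfolding N_def by (simp add: sum_ac)
  also have "(\<Sum>i\<in>UNIV. \<Sum>k\<in>UNIV. u $ k * partial k (\<lambda>u. w u $ i) (fst z) * snd z $ i)
     = (\<Sum>i\<in>UNIV. dd u (\<lambda>x. w x $ i) (fst z) * snd z $ i)"
    by (simp add: dd_axis[OF sm_differentiable[OF w z], of u] partial_eq_dd sum_distrib_right)
  finally show ?thesis
    unfolding hlift_def by (subst dd_lin_comb_base[OF w z]) (simp add: sum_negf)
qed

lemma hor_eq: "f differentiable (at z) \<Longrightarrow> hor k f z = dx k f z - (\<Sum>m\<in>UNIV. N m k z * dy m f z)"
  unfolding hlift_def by (subst dd_pair) (simp_all add: sum_negf)

lemma xi_eq: "f differentiable (at z) \<Longrightarrow>
    xi f z = (\<Sum>l\<in>UNIV. snd z $ l * dx l f z) - 2 * (\<Sum>m\<in>UNIV. G m z * dy m f z)"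
  unfolding hlift_def by (subst dd_pair) (simp_all add: sum_negf G_eq_N sum_distrib_left mult_ac)

lemma xi_cong_fun:
  "sm Z f \<Longrightarrow> z \<in> Z \<Longrightarrow> (\<Sum>l\<in>UNIV. snd z $ l * dx l f z) - 2 * (\<Sum>m\<in>UNIV. G m z * dy m f z) = xi f z"
  by (rule xi_eq[OF sm_differentiable, symmetric])

text \<open>The direction of differentiation varies with the point, so \<open>sm_dd\<close> does not
  apply; the expansion in coordinate derivatives has smooth coefficients.\<close>

lemma sm_xi: assumes "open Z" "Z \<subseteq> \<Omega>" "sm Z f" shows "sm Z (\<lambda>z. xi f z)"
proof (rule sm_cong[OF assms(1) xi_cong_fun[OF assms(3)]])
  show "sm Z (\<lambda>z. (\<Sum>l\<in>UNIV. snd z $ l * dx l f z) - 2 * (\<Sum>m\<in>UNIV. G m z * dy m f z))"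
    by (intro sm_diff sm_sum sm_mult sm_const sm_snd_nth sm_dd assms sm_subset[OF sm_G])
qed

lemma dy_xi:
  assumes Z: "open Z" "Z \<subseteq> \<Omega>" "z \<in> Z" and f: "sm Z f"
  shows "dy k (\<lambda>z. xi f z) z = dx k f z + (\<Sum>l\<in>UNIV. snd z $ l * dy k (dx l f) z)
    - 2 * (\<Sum>m\<in>UNIV. N m k z * dy m f z) - 2 * (\<Sum>m\<in>UNIV. G m z * dy k (dy m f) z)"
proof -
  have S: "fst z \<in> S" using Z by auto
  note d = sm_differentiable[OF sm_dd[OF f] Z(3)] sm_differentiable[OF sm_snd_nth Z(3)]
    sm_differentiable[OF sm_subset[OF sm_G Z(2)] Z(3)]
  have "dy k (\<lambda>z. xi f z) z
      = dy k (\<lambda>z. (\<Sum>l\<in>UNIV. snd z $ l * dx l f z) - 2 * (\<Sum>m\<in>UNIV. G m z * dy m f z)) z"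
    by (rule dd_cong[OF Z(1,3)]) (simp add: xi_cong_fun[OF f])
  also have "\<dots> = dy k (\<lambda>z. \<Sum>l\<in>UNIV. snd z $ l * dx l f z) z - 2 * dy k (\<lambda>z. \<Sum>m\<in>UNIV. G m z * dy m f z) z"
    by (subst dd_diff) (auto intro!: dd_cmult differentiable_sum differentiable_mult d)
  also have "dy k (\<lambda>z. \<Sum>l\<in>UNIV. snd z $ l * dx l f z) z
      = (\<Sum>l\<in>UNIV. snd z $ l * dy k (dx l f) z + axis k 1 $ l * dx l f z)"
    by (subst dd_sum) (auto simp: dd_mult d intro!: differentiable_mult d)
  also have "dy k (\<lambda>z. \<Sum>m\<in>UNIV. G m z * dy m f z) z
      = (\<Sum>m\<in>UNIV. G m z * dy k (dy m f) z + N m k z * dy m f z)"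
    by (subst dd_sum) (auto simp: dd_mult d dy_G[OF S] intro!: differentiable_mult d)
  finally show ?thesis by (simp add: sum.distrib)
qed

text \<open>The covariant derivative of a vector field that depends on y as well as on x;
  \<open>nab0\<close> is its contraction with y.\<close>

definition nab :: "'n \<Rightarrow> ('n \<Rightarrow> 'n tangent \<Rightarrow> real) \<Rightarrow> 'n \<Rightarrow> 'n tangent \<Rightarrow> real" where
  "nab k D i z = hor k (D i) z + (\<Sum>m\<in>UNIV. Gam i k m (fst z) * D m z)"
definition nab0 :: "('n \<Rightarrow> 'n tangent \<Rightarrow> real) \<Rightarrow> 'n \<Rightarrow> 'n tangent \<Rightarrow> real" where
  "nab0 D i z = xi (D i) z + (\<Sum>m\<in>UNIV. N i m z * D m z)"

text \<open>
  Since covariant derivatives are taken before vertical ones, this form needs the covariant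
  derivative of \<open>D\<^sup>i\<close> only, not that of its vertical derivatives.
\<close>

lemma Rm_add:
  assumes Z: "open Z" "Z \<subseteq> \<Omega>" "z \<in> Z" and D: "\<And>i. sm Z (D i)"
  shows "Rm (\<lambda>i z. G i z + D i z) i k z = Rm G i k z + 3 * nab k D i z - dy k (nab0 D i) z
    + 2 * (\<Sum>l\<in>UNIV. D l z * dy l (dy k (D i)) z) - (\<Sum>l\<in>UNIV. dy l (D i) z * dy k (D l) z)"
proof -
  have S: "fst z \<in> S" using Z by auto
  have sG: "sm Z (G i)" for i using sm_subset[OF sm_G Z(2)] .
  have sN: "sm Z (N i j)" for i j using sm_subset[OF sm_N Z(2)] .
  note dG = sm_differentiable[OF sG Z(3)] and dD = sm_differentiable[OF D Z(3)]
  note ddG = sm_differentiable[OF sm_dd[OF sG] Z(3)] and ddD = sm_differentiable[OF sm_dd[OF D] Z(3)]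
  have 1: "dd v (\<lambda>z. G i z + D i z) u = dd v (G i) u + dd v (D i) u" if "u \<in> Z" for v i u
    using that by (intro dd_add sm_differentiable[OF sG] sm_differentiable[OF D])
  have 2: "dd w (dd v (\<lambda>z. G i z + D i z)) z = dd w (dd v (G i)) z + dd w (dd v (D i)) z" for v w i
    by (subst dd_cong[OF Z(1,3) 1]) (auto simp: dd_add ddG ddD)
  have 3: "dy l (dy k (G i)) z = Gam i k l (fst z)" for l k i
  proof -
    have "dy l (dy k (G i)) z = dy l (N i k) z"
      by (rule dd_cong[OF Z(1,3)]) (use dy_G Z(2) in auto)
    then show ?thesis using dy_N[OF S] by simp
  qed
  have 4: "dy k (nab0 D i) z = dy k (\<lambda>z. xi (D i) z) z
     + (\<Sum>m\<in>UNIV. N i m z * dy k (D m) z + Gam i k m (fst z) * D m z)"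
  proof -
    note dN = sm_differentiable[OF sN Z(3)]
    have dS: "(\<lambda>z. \<Sum>m\<in>UNIV. N i m z * D m z) differentiable (at z)"
      by (auto intro!: differentiable_sum differentiable_mult dN dD)
    have "dy k (nab0 D i) z = dy k (\<lambda>z. xi (D i) z) z + dy k (\<lambda>z. \<Sum>m\<in>UNIV. N i m z * D m z) z"
      unfolding nab0_def by (rule dd_add[OF sm_differentiable[OF sm_xi[OF Z(1,2) D] Z(3)] dS])
    also have "dy k (\<lambda>z. \<Sum>m\<in>UNIV. N i m z * D m z) z
       = (\<Sum>m\<in>UNIV. N i m z * dy k (D m) z + Gam i m k (fst z) * D m z)"
      by (subst dd_sum) (auto simp: dd_mult dN dD dy_N[OF S] intro!: differentiable_mult dN dD)
    finally show ?thesis using Gam_sym[OF S] by simp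
  qed
  have 5: "dy k (dy m (D i)) z = dy m (dy k (D i)) z" for m
    by (rule dd_commute[OF Z(1) D Z(3)])
  show ?thesis
    unfolding Rm_def 4 dy_xi[OF Z D] nab_def hor_eq[OF dD] 1[OF Z(3)] 2 3 5 dy_G[OF S]
    by (simp add: sum.distrib algebra_simps)
qed

text \<open>
  With \<open>P = F\<^sup>2\<close> the Euler-Lagrange expression splits into horizontal and vertical parts, so that the
  deviation of the spray from that of \<open>\<alpha>\<close> solves a linear system with matrix \<open>g\<^sub>i\<^sub>j\<close>.
\<close>

lemma spray_eq:
  assumes Z: "open Z" "Z \<subseteq> \<Omega>" "(x, y) \<in> Z" and P: "sm Z P"
    and F: "\<And>u v. (u, v) \<in> Z \<Longrightarrow> (F u v)\<^sup>2 = P (u, v)"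
    and inv: "invertible (fundamental_tensor F x y)"
    and D: "\<And>l. 2 * (\<Sum>m\<in>UNIV. dy l (dy m P) (x, y) * D m) = dy l (\<lambda>z. xi P z) (x, y) - 2 * hor l P (x, y)"
  shows "spray F x y $ i = G i (x, y) + D i"
proof -
  let ?z = "(x, y)"
  have 1: "partial l (\<lambda>u. (F u v)\<^sup>2) u = dx l P (u, v)" if "(u, v) \<in> Z" for u v l
    using partial_fst_cong[OF Z(1) that, of "\<lambda>u v. (F u v)\<^sup>2" P] F P by blast
  have 3: "partial l (\<lambda>v. partial k (\<lambda>u. (F u v)\<^sup>2) x) y = dy l (dx k P) ?z" for k l
    by (rule partial_snd_cong[OF Z(1,3)]) (auto intro: 1 sm_dd P)
  have g: "fundamental_tensor F x y $ l $ m = 1/2 * dy l (dy m P) ?z" for l m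
    by (rule fundamental_tensor_eq[OF Z(1,3) P F])
  let ?g = "fundamental_tensor F x y"
  let ?H = "\<lambda>m. G m ?z + D m"
  note dP = sm_differentiable[OF P Z(3)]
  have rhs: "(\<Sum>k\<in>UNIV. dy l (dx k P) ?z * y $ k) - dx l P ?z = 4 * (\<Sum>m\<in>UNIV. ?g $ l $ m * ?H m)" for l
  proof -
    have "(\<Sum>m\<in>UNIV. ?g $ l $ m * ?H m) = 1/2 * (\<Sum>m\<in>UNIV. G m ?z * dy l (dy m P) ?z)
        + 1/2 * (\<Sum>m\<in>UNIV. dy l (dy m P) ?z * D m)"
      unfolding g by (simp add: sum_distrib_left flip: sum.distrib) (simp add: field_simps)
    then show ?thesis
      using D[of l] unfolding dy_xi[OF Z P] hor_eq[OF dP] by (simp add: mult.commute)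
  qed
  have "spray F x y $ i = (\<Sum>l\<in>UNIV. \<Sum>m\<in>UNIV. matrix_inv ?g $ i $ l * ?g $ l $ m * ?H m)"
    unfolding spray_def vec_lambda_beta 3 1[OF Z(3)] rhs by (simp add: sum_distrib_left mult_ac)
  also have "\<dots> = (\<Sum>m\<in>UNIV. (matrix_inv ?g ** ?g) $ i $ m * ?H m)"
    by (subst sum.swap) (simp add: matrix_matrix_mult_def sum_distrib_right)
  also have "\<dots> = ?H i"
    unfolding matrix_inv_left[OF inv] by (simp add: mat_def if_distrib[of "\<lambda>c. c * _"] cong: if_cong)
  finally show ?thesis .
qed

end

section \<open>Conformal one-forms in a chart\<close>

locale sq_chart = riem_chart S a for S :: "(real^'n::finite) set" and a +
  fixes b :: "real^'n \<Rightarrow> real^'n" and c :: "real^'n \<Rightarrow> real"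
  assumes smooth_b: "\<And>i. smooth_on S (\<lambda>x. b x $ i)"
    and b_nz: "\<And>x. x \<in> S \<Longrightarrow> b x \<noteq> 0"
    and conf: "\<And>x i j. x \<in> S \<Longrightarrow> 1/2 * (cov_deriv a b x i j + cov_deriv a b x j i) = c x * a x $ i $ j"
    and card3: "CARD('n) \<ge> 3"
begin

text \<open>
  In tensor notation: \<open>bu\<close> is \<open>b\<^sup>i\<close>, \<open>B\<close> is \<open>b\<^sup>2\<close>, \<open>sl\<close> and \<open>su\<close> are \<open>s\<^sub>i\<close> and \<open>s\<^sup>i\<close>, \<open>T\<close> is \<open>s\<^sup>i\<^sub>j\<close>, \<open>t\<close> and \<open>sy\<close>
  are \<open>s\<^sup>i\<^sub>0\<close> and \<open>s\<^sub>i\<^sub>0\<close>, and \<open>al\<close>, \<open>be\<close>, \<open>bl\<close> are \<open>\<alpha>\<close>, \<open>\<beta>\<close>, \<open>b\<close> as functions on the tangent bundle.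
\<close>

definition bu :: "'n \<Rightarrow> real^'n \<Rightarrow> real" where "bu i x = (\<Sum>j\<in>UNIV. ai x i j * b x $ j)"
definition B :: "real^'n \<Rightarrow> real" where "B x = (\<Sum>i\<in>UNIV. bu i x * b x $ i)"
definition s :: "'n \<Rightarrow> 'n \<Rightarrow> real^'n \<Rightarrow> real" where
  "s i j x = 1/2 * (cov_deriv a b x i j - cov_deriv a b x j i)"
definition sl :: "'n \<Rightarrow> real^'n \<Rightarrow> real" where "sl k x = (\<Sum>i\<in>UNIV. bu i x * s i k x)"
definition su :: "'n \<Rightarrow> real^'n \<Rightarrow> real" where "su i x = (\<Sum>j\<in>UNIV. ai x i j * sl j x)"
definition T :: "'n \<Rightarrow> 'n \<Rightarrow> real^'n \<Rightarrow> real" where "T i j x = (\<Sum>l\<in>UNIV. ai x i l * s l j x)"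

definition al :: "'n tangent \<Rightarrow> real" where "al z = sqrt (Aq z)"
definition be :: "'n tangent \<Rightarrow> real" where "be z = (\<Sum>i\<in>UNIV. b (fst z) $ i * snd z $ i)"
definition bl :: "'n tangent \<Rightarrow> real" where "bl z = sqrt (B (fst z))"
definition s0 :: "'n tangent \<Rightarrow> real" where "s0 z = (\<Sum>k\<in>UNIV. sl k (fst z) * snd z $ k)"
definition t :: "'n \<Rightarrow> 'n tangent \<Rightarrow> real" where "t i z = (\<Sum>j\<in>UNIV. T i j (fst z) * snd z $ j)"
definition sy :: "'n \<Rightarrow> 'n tangent \<Rightarrow> real" where "sy i z = (\<Sum>j\<in>UNIV. s i j (fst z) * snd z $ j)"
definition r :: "'n tangent \<Rightarrow> real" where "r z = bl z * al z + be z"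
definition \<Delta> :: "'n tangent \<Rightarrow> real" where "\<Delta> z = bl z * al z - be z"

lemma cov_eq: "x \<in> S \<Longrightarrow> cov_deriv a b x i j = c x * a x $ i $ j + s i j x"
  using conf[of x i j] by (simp add: s_def field_simps)

lemma s_anti: "s i j x = - s j i x" by (simp add: s_def field_simps)

lemma sm_b: "sm S (\<lambda>x. b x $ i)" using sm_if_smooth_on[OF open_S smooth_b] .

lemma sm_cov: "sm S (\<lambda>x. cov_deriv a b x i j)"
  unfolding cov_deriv_def partial_eq_dd by (intro sm_diff sm_sum sm_mult open_S sm_dd sm_b sm_Gam)

lemma sm_s: "sm S (s i j)" unfolding s_def by (intro sm_mult sm_diff sm_const open_S sm_cov)
lemma sm_bu: "sm S (bu i)" unfolding bu_def by (intro sm_sum sm_mult open_S sm_ai sm_b)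
lemma sm_B: "sm S B" unfolding B_def by (intro sm_sum sm_mult open_S sm_bu sm_b)
lemma sm_sl: "sm S (sl k)" unfolding sl_def by (intro sm_sum sm_mult open_S sm_bu sm_s)
lemma sm_su: "sm S (su k)" unfolding su_def by (intro sm_sum sm_mult open_S sm_ai sm_sl)
lemma sm_T: "sm S (T i j)" unfolding T_def by (intro sm_sum sm_mult open_S sm_ai sm_s)

lemma ai_sym: assumes x: "x \<in> S" shows "ai x i j = ai x j i"
proof -
  have "(\<Sum>k\<in>UNIV. \<Sum>l\<in>UNIV. ai x i k * a x $ k $ l * ai x j l) = (\<Sum>k\<in>UNIV. ai x i k * (\<Sum>l\<in>UNIV. a x $ l $ k * ai x j l))"
    using sym_a[OF x] by (simp add: sum_distrib_left mult_ac)
  also have "(\<lambda>k. \<Sum>l\<in>UNIV. a x $ l $ k * ai x j l) = (\<lambda>k. if j = k then 1 else 0)"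
    using ai_a[OF x, of j] by (simp add: mult.commute)
  finally have 1: "(\<Sum>k\<in>UNIV. \<Sum>l\<in>UNIV. ai x i k * a x $ k $ l * ai x j l) = ai x i j"
    by (simp add: if_distrib[of "\<lambda>c. _ * c"] cong: if_cong)
  have "(\<Sum>k\<in>UNIV. \<Sum>l\<in>UNIV. ai x i k * a x $ k $ l * ai x j l) = (\<Sum>l\<in>UNIV. (\<Sum>k\<in>UNIV. ai x i k * a x $ k $ l) * ai x j l)"
    by (subst sum.swap) (simp add: sum_distrib_right)
  also have "\<dots> = ai x j i" by (simp add: ai_a[OF x] if_distrib[of "\<lambda>c. c * _"] cong: if_cong)
  finally show ?thesis using 1 by simp
qed

lemma raise_lower:
  assumes x: "x \<in> S"
  shows "(\<Sum>j\<in>UNIV. a x $ i $ j * (\<Sum>k\<in>UNIV. ai x j k * w k)) = w i"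
proof -
  have "(\<Sum>j\<in>UNIV. a x $ i $ j * (\<Sum>k\<in>UNIV. ai x j k * w k)) = (\<Sum>k\<in>UNIV. (\<Sum>j\<in>UNIV. a x $ i $ j * ai x j k) * w k)"
    by (simp add: sum_ac) (rule sum.swap)
  also have "\<dots> = w i" by (simp add: a_ai[OF x] if_distrib[of "\<lambda>c. c * _"] cong: if_cong)
  finally show ?thesis .
qed

lemma raise_move:
  assumes x: "x \<in> S"
  shows "(\<Sum>i\<in>UNIV. v i * (\<Sum>k\<in>UNIV. ai x i k * w k)) = (\<Sum>k\<in>UNIV. (\<Sum>i\<in>UNIV. ai x k i * v i) * w k)"
proof -
  have "(\<Sum>i\<in>UNIV. v i * (\<Sum>k\<in>UNIV. ai x i k * w k)) = (\<Sum>i\<in>UNIV. \<Sum>k\<in>UNIV. ai x k i * v i * w k)"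
    by (simp add: sum_distrib_left ai_sym[OF x] mult_ac)
  also have "\<dots> = (\<Sum>k\<in>UNIV. \<Sum>i\<in>UNIV. ai x k i * v i * w k)" by (rule sum.swap)
  finally show ?thesis by (simp add: sum_distrib_right)
qed

lemma lower_y:
  assumes z: "fst z \<in> S"
  shows "(\<Sum>i\<in>UNIV. ai (fst z) k i * yl i z) = snd z $ k"
proof -
  have "(\<Sum>i\<in>UNIV. ai (fst z) k i * yl i z) = (\<Sum>j\<in>UNIV. (\<Sum>i\<in>UNIV. ai (fst z) k i * a (fst z) $ i $ j) * snd z $ j)"
    unfolding yl_def by (simp add: sum_ac) (rule sum.swap)
  then show ?thesis by (simp add: ai_a[OF z] if_distrib[of "\<lambda>c. c * _"] cong: if_cong)
qed

lemma a_bu: "x \<in> S \<Longrightarrow> (\<Sum>j\<in>UNIV. a x $ i $ j * bu j x) = b x $ i"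
  unfolding bu_def by (rule raise_lower)
lemma a_su: "x \<in> S \<Longrightarrow> (\<Sum>j\<in>UNIV. a x $ i $ j * su j x) = sl i x"
  unfolding su_def by (rule raise_lower)
lemma T_bu_general: assumes x: "x \<in> S" shows "(\<Sum>j\<in>UNIV. T i j x * bu j x) = - su i x"
proof -
  have "(\<Sum>j\<in>UNIV. T i j x * bu j x) = (\<Sum>j\<in>UNIV. \<Sum>l\<in>UNIV. ai x i l * (s l j x * bu j x))"
    by (simp add: T_def sum_ac)
  also have "\<dots> = (\<Sum>l\<in>UNIV. \<Sum>j\<in>UNIV. ai x i l * (s l j x * bu j x))" by (rule sum.swap)
  also have "\<dots> = (\<Sum>l\<in>UNIV. - (ai x i l * sl l x))"
    unfolding sl_def sum_distrib_left sum_negf[symmetric] by (intro sum.cong refl) (subst s_anti, simp)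
  finally show ?thesis by (simp add: su_def sum_negf)
qed

lemma t_eq: "t i z = (\<Sum>l\<in>UNIV. ai (fst z) i l * sy l z)"
  unfolding t_def T_def sy_def by (simp add: sum_ac) (rule sum.swap)
lemma a_t: "fst z \<in> S \<Longrightarrow> (\<Sum>j\<in>UNIV. a (fst z) $ i $ j * t j z) = sy i z"
  unfolding t_eq by (rule raise_lower)

lemma anti_sum_0:
  assumes "\<And>i j. (m i j::real) = - m j i"
  shows "(\<Sum>i\<in>UNIV. \<Sum>j\<in>UNIV. v i * v j * m i j) = 0"
proof -
  have "(\<Sum>i\<in>UNIV. \<Sum>j\<in>UNIV. v i * v j * m i j) = (\<Sum>i\<in>UNIV. \<Sum>j\<in>UNIV. v j * v i * m j i)"
    by (rule sum.swap)
  also have "\<dots> = - (\<Sum>i\<in>UNIV. \<Sum>j\<in>UNIV. v i * v j * m i j)"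
    unfolding sum_negf[symmetric] by (intro sum.cong refl) (subst assms, simp)
  finally show ?thesis by simp
qed

lemma s_quad: "(\<Sum>i\<in>UNIV. \<Sum>j\<in>UNIV. v i * v j * s i j x) = 0"
  by (rule anti_sum_0) (rule s_anti)

lemma raise_yl: "fst z \<in> S \<Longrightarrow> (\<Sum>i\<in>UNIV. yl i z * (\<Sum>k\<in>UNIV. ai (fst z) i k * w k)) = (\<Sum>k\<in>UNIV. snd z $ k * w k)"
  unfolding raise_move lower_y by (rule refl)
lemma raise_b: "x \<in> S \<Longrightarrow> (\<Sum>i\<in>UNIV. b x $ i * (\<Sum>k\<in>UNIV. ai x i k * w k)) = (\<Sum>k\<in>UNIV. bu k x * w k)"
  unfolding raise_move bu_def by (rule refl)

lemma bu_sl: "(\<Sum>k\<in>UNIV. bu k x * sl k x) = 0"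
proof -
  have "(\<Sum>k\<in>UNIV. bu k x * sl k x) = (\<Sum>k\<in>UNIV. \<Sum>i\<in>UNIV. bu i x * bu k x * s i k x)"
    by (simp add: sl_def sum_distrib_left mult_ac)
  also have "\<dots> = (\<Sum>i\<in>UNIV. \<Sum>k\<in>UNIV. bu i x * bu k x * s i k x)" by (rule sum.swap)
  finally show ?thesis by (simp add: s_quad)
qed

lemma yl_bu: "fst z \<in> S \<Longrightarrow> (\<Sum>i\<in>UNIV. yl i z * bu i (fst z)) = be z"
  unfolding bu_def raise_yl be_def by (simp add: mult.commute)
lemma yl_su: "fst z \<in> S \<Longrightarrow> (\<Sum>i\<in>UNIV. yl i z * su i (fst z)) = s0 z"
  unfolding su_def raise_yl s0_def by (simp add: mult.commute)
lemma yl_t: "fst z \<in> S \<Longrightarrow> (\<Sum>i\<in>UNIV. yl i z * t i z) = 0"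
  unfolding t_eq raise_yl sy_def using s_quad[of "\<lambda>i. snd z $ i" "fst z"]
  by (simp add: sum_distrib_left mult_ac)
lemma b_bu: "(\<Sum>i\<in>UNIV. b x $ i * bu i x) = B x"
  unfolding B_def by (simp add: mult.commute)
lemma b_su: "x \<in> S \<Longrightarrow> (\<Sum>i\<in>UNIV. b x $ i * su i x) = 0"
  unfolding su_def raise_b by (rule bu_sl)
lemma b_t: "fst z \<in> S \<Longrightarrow> (\<Sum>i\<in>UNIV. b (fst z) $ i * t i z) = s0 z"
  unfolding t_eq raise_b s0_def sl_def sy_def
  by (simp add: sum_ac) (rule sum.swap)
lemma yl_y: "(\<Sum>i\<in>UNIV. yl i z * snd z $ i) = Aq z"
  unfolding Aq_def by (simp add: mult.commute)
lemma b_y: "(\<Sum>i\<in>UNIV. b (fst z) $ i * snd z $ i) = be z"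
  by (simp add: be_def)

lemma Aq_inner: "Aq (x, y) = y \<bullet> (a x *v y)"
  unfolding Aq_def yl_def inner_vec_def matrix_vector_mult_def by simp

lemma Aq_pos: "fst z \<in> S \<Longrightarrow> snd z \<noteq> 0 \<Longrightarrow> Aq z > 0"
  using pos_a[of "fst z" "snd z"] Aq_inner[of "fst z" "snd z"] by simp

lemma yl_bu_pair: "x \<in> S \<Longrightarrow> yl i (x, \<chi> k. bu k x) = b x $ i"
  unfolding yl_def by (simp add: a_bu)

lemma Aq_bu: "x \<in> S \<Longrightarrow> Aq (x, \<chi> k. bu k x) = B x"
  unfolding Aq_def B_def by (simp add: yl_bu_pair)

lemma bu_nz: "x \<in> S \<Longrightarrow> (\<chi> k. bu k x) \<noteq> 0"
proof
  assume x: "x \<in> S" and "(\<chi> k. bu k x) = 0"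
  then have "bu j x = 0" for j by (simp add: vec_eq_iff)
  then have "b x $ i = 0" for i using a_bu[OF x, of i] by simp
  then show False using b_nz[OF x] by (simp add: vec_eq_iff)
qed

lemma B_pos: "x \<in> S \<Longrightarrow> B x > 0"
  using Aq_pos[of "(x, \<chi> k. bu k x)"] bu_nz Aq_bu by simp

text \<open>Being a scalar, b^2 has differential 2 b^i b_i|l, and the conformal equation splits this
  into c b_l and s_l. Differentiating b_i = a_ij b^j avoids the derivative of the inverse
  matrix.\<close>

lemma partial_B:
  assumes x: "x \<in> S"
  shows "partial l B x = 2 * (c x * b x $ l + sl l x)"
proof -
  let ?db = "\<lambda>i. partial l (\<lambda>u. b u $ i) x" and ?dbu = "\<lambda>i. partial l (bu i) x"
  note d = sm_differentiable[OF sm_b x] sm_differentiable[OF sm_bu x] sm_differentiable[OF sm_a x]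
  have 1: "partial l B x = (\<Sum>i\<in>UNIV. bu i x * ?db i) + (\<Sum>i\<in>UNIV. ?dbu i * b x $ i)"
    unfolding B_def partial_eq_dd by (subst dd_sum) (auto simp: dd_mult d sum.distrib intro!: differentiable_mult d)
  have 2: "?db i = (\<Sum>j\<in>UNIV. a x $ i $ j * ?dbu j) + (\<Sum>j\<in>UNIV. da l i j x * bu j x)" for i
  proof -
    have "?db i = partial l (\<lambda>x. \<Sum>j\<in>UNIV. a x $ i $ j * bu j x) x"
      by (rule partial_cong[OF open_S x]) (simp add: a_bu)
    then show ?thesis
      unfolding partial_eq_dd by (subst (asm) dd_sum) (auto simp: dd_mult d sum.distrib intro!: differentiable_mult d)
  qed
  have 3: "(\<Sum>i\<in>UNIV. bu i x * (\<Sum>j\<in>UNIV. a x $ i $ j * ?dbu j)) = (\<Sum>i\<in>UNIV. ?dbu i * b x $ i)"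
  proof -
    have "(\<Sum>i\<in>UNIV. bu i x * (\<Sum>j\<in>UNIV. a x $ i $ j * ?dbu j)) = (\<Sum>i\<in>UNIV. \<Sum>j\<in>UNIV. ?dbu j * (a x $ j $ i * bu i x))"
      using sym_a[OF x] by (simp add: sum_distrib_left mult_ac)
    also have "\<dots> = (\<Sum>j\<in>UNIV. \<Sum>i\<in>UNIV. ?dbu j * (a x $ j $ i * bu i x))" by (rule sum.swap)
    finally show ?thesis by (simp add: a_bu[OF x] flip: sum_distrib_left)
  qed
  have "(\<Sum>i\<in>UNIV. bu i x * ?db i) = (\<Sum>i\<in>UNIV. ?dbu i * b x $ i) + (\<Sum>i\<in>UNIV. \<Sum>j\<in>UNIV. bu i x * bu j x * da l i j x)"
    unfolding 2 by (simp add: distrib_left sum.distrib 3) (simp add: sum_distrib_left mult_ac)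
  with 1 have 4: "partial l B x = 2 * (\<Sum>i\<in>UNIV. bu i x * ?db i) - (\<Sum>i\<in>UNIV. \<Sum>j\<in>UNIV. bu i x * bu j x * da l i j x)"
    by simp
  let ?W = "\<Sum>i\<in>UNIV. \<Sum>m\<in>UNIV. bu i x * Gam m i l x * b x $ m"
  have 5: "(\<Sum>i\<in>UNIV. \<Sum>j\<in>UNIV. bu i x * bu j x * da l i j x) = 2 * ?W"
  proof -
    have "(\<Sum>i\<in>UNIV. \<Sum>j\<in>UNIV. \<Sum>m\<in>UNIV. bu i x * bu j x * (a x $ i $ m * Gam m l j x)) = ?W"
    proof -
      have "(\<Sum>i\<in>UNIV. \<Sum>j\<in>UNIV. \<Sum>m\<in>UNIV. bu i x * bu j x * (a x $ i $ m * Gam m l j x))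
          = (\<Sum>j\<in>UNIV. \<Sum>m\<in>UNIV. \<Sum>i\<in>UNIV. bu i x * bu j x * (a x $ i $ m * Gam m l j x))"
        by (subst sum.swap) (intro sum.cong refl sum.swap)
      also have "\<dots> = (\<Sum>j\<in>UNIV. \<Sum>m\<in>UNIV. bu j x * Gam m j l x * (\<Sum>i\<in>UNIV. a x $ m $ i * bu i x))"
        using sym_a[OF x] Gam_sym[OF x] by (simp add: sum_distrib_left mult_ac)
      finally show ?thesis by (simp add: a_bu[OF x])
    qed
    moreover have "(\<Sum>i\<in>UNIV. \<Sum>j\<in>UNIV. \<Sum>m\<in>UNIV. bu i x * bu j x * (a x $ j $ m * Gam m l i x)) = ?W"
    proof -
      have "(\<Sum>i\<in>UNIV. \<Sum>j\<in>UNIV. \<Sum>m\<in>UNIV. bu i x * bu j x * (a x $ j $ m * Gam m l i x))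
          = (\<Sum>i\<in>UNIV. \<Sum>m\<in>UNIV. \<Sum>j\<in>UNIV. bu i x * bu j x * (a x $ j $ m * Gam m l i x))"
        by (intro sum.cong refl sum.swap)
      also have "\<dots> = (\<Sum>i\<in>UNIV. \<Sum>m\<in>UNIV. bu i x * Gam m i l x * (\<Sum>j\<in>UNIV. a x $ m $ j * bu j x))"
        using sym_a[OF x] Gam_sym[OF x] by (simp add: sum_distrib_left mult_ac)
      finally show ?thesis by (simp add: a_bu[OF x])
    qed
    ultimately show ?thesis
      by (simp add: da_eq[OF x] distrib_left sum.distrib sum_distrib_left)
  qed
  have "partial l B x = 2 * (\<Sum>i\<in>UNIV. bu i x * cov_deriv a b x i l)"
    unfolding 4 5 cov_deriv_def by (simp add: right_diff_distrib sum_subtractf sum_distrib_left mult_ac)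
  also have "(\<Sum>i\<in>UNIV. bu i x * cov_deriv a b x i l) = c x * (\<Sum>i\<in>UNIV. a x $ l $ i * bu i x) + sl l x"
    unfolding cov_eq[OF x] sl_def using sym_a[OF x] by (simp add: distrib_left sum.distrib sum_distrib_left mult_ac)
  finally show ?thesis by (simp add: a_bu[OF x])
qed

text \<open>The conformal factor enters as a mere function; tracing the conformal equation with the
  inverse metric expresses it through smooth data.\<close>

lemma sm_c: "sm S c"
proof (rule sm_cong[OF open_S])
  show "sm S (\<lambda>x. (\<Sum>i\<in>UNIV. \<Sum>j\<in>UNIV. ai x i j * (1/2 * (cov_deriv a b x i j + cov_deriv a b x j i))) / real CARD('n))"
    using card3 by (intro sm_divide sm_sum sm_mult sm_add sm_const sm_ai sm_cov open_S) auto
  show "(\<Sum>i\<in>UNIV. \<Sum>j\<in>UNIV. ai x i j * (1/2 * (cov_deriv a b x i j + cov_deriv a b x j i))) / real CARD('n) = c x"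
    if x: "x \<in> S" for x
  proof -
    have "(\<Sum>i\<in>UNIV. \<Sum>j\<in>UNIV. ai x i j * (c x * a x $ i $ j)) = c x * (\<Sum>i\<in>UNIV. \<Sum>j\<in>UNIV. ai x i j * a x $ j $ i)"
      using sym_a[OF x] by (simp add: sum_distrib_left mult_ac)
    then show ?thesis unfolding conf[OF x] using card3 by (simp add: ai_a[OF x])
  qed
qed

definition Z0 :: "'n tangent set" where "Z0 = {z. fst z \<in> S \<and> snd z \<noteq> 0}"

lemma Z0_\<Omega>: "Z0 \<subseteq> \<Omega>" by (auto simp: Z0_def)

lemma open_Z0: "open Z0"
proof -
  have "Z0 = S \<times> (- {0})" by (auto simp: Z0_def)
  then show ?thesis using open_S by (auto intro!: open_Times)
qed

lemma Z0_S: "z \<in> Z0 \<Longrightarrow> fst z \<in> S" by (simp add: Z0_def)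
lemma Z0_pos: "z \<in> Z0 \<Longrightarrow> Aq z > 0" using Aq_pos by (simp add: Z0_def)
lemma al_pos: "z \<in> Z0 \<Longrightarrow> al z > 0" using Z0_pos by (simp add: al_def)
lemma al_nz: "z \<in> Z0 \<Longrightarrow> al z \<noteq> 0" using al_pos[of z] by simp
lemma al_sq: "z \<in> Z0 \<Longrightarrow> (al z)\<^sup>2 = Aq z" using Z0_pos[of z] by (simp add: al_def)
lemma bl_pos: "fst z \<in> S \<Longrightarrow> bl z > 0" using B_pos by (simp add: bl_def)
lemma bl_sq: "fst z \<in> S \<Longrightarrow> (bl z)\<^sup>2 = B (fst z)" using B_pos[of "fst z"] by (simp add: bl_def)

lemma sm_al: "sm Z0 al"
  unfolding al_def by (intro sm_sqrt open_Z0 sm_subset[OF sm_Aq Z0_\<Omega>] Z0_pos)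
lemma sm_be: "sm \<Omega> be"
  unfolding be_def by (intro sm_sum sm_mult open_\<Omega> sm_base[OF sm_b] sm_snd_nth)
lemma sm_s0: "sm \<Omega> s0"
  unfolding s0_def by (intro sm_sum sm_mult open_\<Omega> sm_base[OF sm_sl] sm_snd_nth)
lemma sm_t: "sm \<Omega> (t i)"
  unfolding t_def by (intro sm_sum sm_mult open_\<Omega> sm_base[OF sm_T] sm_snd_nth)
lemma sm_bl: "sm \<Omega> bl"
  unfolding bl_def by (intro sm_sqrt open_\<Omega> sm_base[OF sm_B] B_pos) auto
lemma sm_r: "sm Z0 r"
  unfolding r_def by (intro sm_add sm_mult open_Z0 sm_al sm_subset[OF sm_bl Z0_\<Omega>] sm_subset[OF sm_be Z0_\<Omega>])
lemma sm_\<Delta>: "sm Z0 \<Delta>"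
  unfolding \<Delta>_def by (intro sm_diff sm_mult open_Z0 sm_al sm_subset[OF sm_bl Z0_\<Omega>] sm_subset[OF sm_be Z0_\<Omega>])

lemma dd_al: "z \<in> Z0 \<Longrightarrow> dd v al z = dd v Aq z / (2 * al z)"
  unfolding al_def by (rule dd_sqrt[OF sm_differentiable[OF sm_subset[OF sm_Aq Z0_\<Omega>]] Z0_pos])
lemma dy_al: "z \<in> Z0 \<Longrightarrow> dy k al z = yl k z / al z"
  using al_pos[of z] by (simp add: dd_al dy_Aq[OF Z0_S])
lemma hlift_al: "z \<in> Z0 \<Longrightarrow> dd (hlift u z) al z = 0"
  by (simp add: dd_al hlift_Aq[OF Z0_S])

lemma dy_be: "fst z \<in> S \<Longrightarrow> dy k be z = b (fst z) $ k"
  unfolding be_def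
  by (subst dd_lin_comb_base[OF sm_b]) (auto simp: dd_linear_comb[OF sm_differentiable[OF sm_b]])
lemma dy_s0: "fst z \<in> S \<Longrightarrow> dy k s0 z = sl k (fst z)"
  unfolding s0_def
  by (subst dd_lin_comb_base[OF sm_sl]) (auto simp: dd_linear_comb[OF sm_differentiable[OF sm_sl]])
lemma dy_t: "fst z \<in> S \<Longrightarrow> dy k (t i) z = T i k (fst z)"
  unfolding t_def
  by (subst dd_lin_comb_base[OF sm_T]) (auto simp: dd_linear_comb[OF sm_differentiable[OF sm_T]])
lemma dy_base: "sm S h \<Longrightarrow> fst z \<in> S \<Longrightarrow> dy k (\<lambda>z. h (fst z)) z = 0"
  by (simp add: dd_base dd_linear_comb[OF sm_differentiable])
lemma hlift_base: "sm S h \<Longrightarrow> fst z \<in> S \<Longrightarrow> dd (hlift u z) (\<lambda>z. h (fst z)) z = (\<Sum>k\<in>UNIV. u $ k * partial k h (fst z))"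
  unfolding hlift_def partial_eq_dd by (subst dd_base, assumption+, rule dd_axis[OF sm_differentiable])

lemma hor_be: assumes z: "fst z \<in> S" shows "hor l be z = c (fst z) * yl l z - sy l z"
proof -
  have "hor l be z = (\<Sum>i\<in>UNIV. cov_deriv a b (fst z) i l * snd z $ i)"
    unfolding be_def hlift_form[OF sm_b z] by (simp flip: sum_distrib_right)
  also have "\<dots> = c (fst z) * (\<Sum>i\<in>UNIV. snd z $ i * a (fst z) $ i $ l) - (\<Sum>i\<in>UNIV. s l i (fst z) * snd z $ i)"
    unfolding cov_eq[OF z] by (subst s_anti) (simp add: sum_subtractf sum_distrib_left algebra_simps)
  finally show ?thesis using yl_sym[OF z] by (simp add: sy_def)
qed

lemma xi_be: assumes z: "fst z \<in> S" shows "xi be z = c (fst z) * Aq z"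
proof -
  have "xi be z = (\<Sum>i\<in>UNIV. \<Sum>k\<in>UNIV. c (fst z) * (snd z $ i * (a (fst z) $ i $ k * snd z $ k)))
      + (\<Sum>i\<in>UNIV. \<Sum>k\<in>UNIV. snd z $ i * snd z $ k * s i k (fst z))"
    unfolding be_def hlift_form[OF sm_b z] cov_eq[OF z]
    by (simp add: algebra_simps sum.distrib)
  then show ?thesis by (simp add: s_quad Aq_def yl_def sum_distrib_left)
qed

lemma dd_bl: "fst z \<in> S \<Longrightarrow> dd v bl z = dd v (\<lambda>z. B (fst z)) z / (2 * bl z)"
  unfolding bl_def by (rule dd_sqrt[OF sm_differentiable[OF sm_base[OF sm_B]]]) (cases z, auto intro: B_pos)
lemma dy_bl: "fst z \<in> S \<Longrightarrow> dy k bl z = 0"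
  by (simp add: dd_bl dy_base[OF sm_B])
lemma hlift_bl: "fst z \<in> S \<Longrightarrow> dd (hlift u z) bl z = (\<Sum>k\<in>UNIV. u $ k * (c (fst z) * b (fst z) $ k + sl k (fst z))) / bl z"
proof -
  assume z: "fst z \<in> S"
  have "(\<Sum>k\<in>UNIV. u $ k * partial k B (fst z)) = 2 * (\<Sum>k\<in>UNIV. u $ k * (c (fst z) * b (fst z) $ k + sl k (fst z)))"
    unfolding sum_distrib_left by (intro sum.cong) (simp_all add: partial_B[OF z] algebra_simps)
  then show ?thesis by (simp add: dd_bl[OF z] hlift_base[OF sm_B z])
qed
lemma hor_bl: "fst z \<in> S \<Longrightarrow> hor l bl z = (c (fst z) * b (fst z) $ l + sl l (fst z)) / bl z"
  by (simp add: hlift_bl)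
lemma xi_bl: "fst z \<in> S \<Longrightarrow> xi bl z = (c (fst z) * be z + s0 z) / bl z"
  by (simp add: hlift_bl be_def s0_def distrib_left sum.distrib sum_distrib_left mult_ac)

section \<open>Derivatives of the square of F\<close>

definition P :: "'n tangent \<Rightarrow> real" where "P z = r z ^ 4 / (al z)\<^sup>2"

lemma sm_P: "sm Z0 P"
  unfolding P_def by (intro sm_divide sm_power open_Z0 sm_r sm_al) (use al_nz in auto)

lemma hd_al: "z \<in> Z0 \<Longrightarrow> (al has_derivative (\<lambda>v. dd v al z)) (at z)" by (rule sm_has_derivative[OF sm_al])
lemma hd_r: "z \<in> Z0 \<Longrightarrow> (r has_derivative (\<lambda>v. dd v r z)) (at z)" by (rule sm_has_derivative[OF sm_r])
lemma hd_\<Delta>: "z \<in> Z0 \<Longrightarrow> (\<Delta> has_derivative (\<lambda>v. dd v \<Delta> z)) (at z)" by (rule sm_has_derivative[OF sm_\<Delta>])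
lemma hd_\<Omega>: "sm \<Omega> f \<Longrightarrow> fst z \<in> S \<Longrightarrow> (f has_derivative (\<lambda>v. dd v f z)) (at z)"
  by (rule sm_has_derivative[of \<Omega>]) (auto simp: mem_Times_iff)

lemma dd_r: assumes z: "z \<in> Z0" shows "dd v r z = bl z * dd v al z + dd v bl z * al z + dd v be z"
  unfolding r_def
  by (rule dd_eqI[THEN trans]) (auto intro!: derivative_eq_intros hd_al[OF z] hd_\<Omega>[OF sm_bl Z0_S[OF z]] hd_\<Omega>[OF sm_be Z0_S[OF z]])
lemma dd_\<Delta>: assumes z: "z \<in> Z0" shows "dd v \<Delta> z = bl z * dd v al z + dd v bl z * al z - dd v be z"
  unfolding \<Delta>_def
  by (rule dd_eqI[THEN trans]) (auto intro!: derivative_eq_intros hd_al[OF z] hd_\<Omega>[OF sm_bl Z0_S[OF z]] hd_\<Omega>[OF sm_be Z0_S[OF z]])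

lemma dd_P: assumes z: "z \<in> Z0"
  shows "dd v P z = 4 * r z ^ 3 * dd v r z / (al z)\<^sup>2 - 2 * r z ^ 4 * dd v al z / al z ^ 3"
  unfolding P_def
  by (rule dd_eqI[THEN trans])
     (use al_pos[OF z] in \<open>auto intro!: derivative_eq_intros hd_al[OF z] hd_r[OF z] simp: field_simps eval_nat_numeral\<close>)

definition rho :: "'n \<Rightarrow> 'n tangent \<Rightarrow> real" where
  "rho l z = bl z * yl l z / al z + b (fst z) $ l"

lemma dy_r: "z \<in> Z0 \<Longrightarrow> dy l r z = rho l z"
  by (simp add: dd_r dy_al dy_bl dy_be Z0_S rho_def)

lemma dy_P: "z \<in> Z0 \<Longrightarrow> dy m P z = 4 * r z ^ 3 * rho m z / (al z)\<^sup>2 - 2 * r z ^ 4 * yl m z / al z ^ 4"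
  using al_pos[of z] by (simp add: dd_P dy_r dy_al field_simps eval_nat_numeral)

lemma sm_rho: "sm Z0 (rho l)"
  unfolding rho_def
  by (intro sm_add sm_divide sm_mult open_Z0 sm_al sm_subset[OF sm_bl Z0_\<Omega>] sm_subset[OF sm_yl Z0_\<Omega>] sm_subset[OF sm_base[OF sm_b] Z0_\<Omega>])
     (use al_nz in auto)

lemma dy_rho: assumes z: "z \<in> Z0"
  shows "dy l (rho m) z = bl z * (a (fst z) $ m $ l / al z - yl m z * yl l z / al z ^ 3)"
proof -
  have S: "fst z \<in> S" using z by (rule Z0_S)
  have "dy l (rho m) z = (bl z * dy l (yl m) z + dy l bl z * yl m z) / al z - bl z * yl m z * dy l al z / (al z)\<^sup>2
      + dy l (\<lambda>z. b (fst z) $ m) z"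
    unfolding rho_def
    by (rule dd_eqI[THEN trans])
       (use al_pos[OF z] in \<open>auto intro!: derivative_eq_intros hd_al[OF z] hd_\<Omega>[OF sm_bl S] hd_\<Omega>[OF sm_yl S] hd_\<Omega>[OF sm_base[OF sm_b] S]
         simp: field_simps eval_nat_numeral\<close>)
  then show ?thesis
    using al_pos[OF z] by (simp add: dy_bl[OF S] dy_yl[OF S] dy_base[OF sm_b S] dy_al[OF z] field_simps eval_nat_numeral)
qed

text \<open>Twice the fundamental tensor, arranged as a multiple of the metric plus a bilinear
  expression in \<open>rho\<close> and y_l. The factor r^3 \<Delta> of the metric shows where it
  degenerates.\<close>

lemma dy_dy_P: assumes z: "z \<in> Z0"
  shows "dy l (dy m P) z = 2 * r z ^ 3 * \<Delta> z / al z ^ 4 * a (fst z) $ l $ m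
     + 12 * (r z)\<^sup>2 / (al z)\<^sup>2 * rho l z * rho m z
     - 8 * r z ^ 3 / al z ^ 4 * (rho m z * yl l z + rho l z * yl m z)
     + (8 * r z ^ 4 / al z ^ 6 - 4 * r z ^ 3 * bl z / al z ^ 5) * yl l z * yl m z"
proof -
  have S: "fst z \<in> S" using z by (rule Z0_S)
  have hrho: "(rho m has_derivative (\<lambda>v. dd v (rho m) z)) (at z)" by (rule sm_has_derivative[OF sm_rho z])
  have "dy l (dy m P) z = dy l (\<lambda>z. 4 * r z ^ 3 * rho m z / (al z)\<^sup>2 - 2 * r z ^ 4 * yl m z / al z ^ 4) z"
    by (rule dd_cong[OF open_Z0 z]) (rule dy_P)
  also have "\<dots> = 12 * (r z)\<^sup>2 * dy l r z * rho m z / (al z)\<^sup>2 + 4 * r z ^ 3 * dy l (rho m) z / (al z)\<^sup>2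
      - 8 * r z ^ 3 * rho m z * dy l al z / al z ^ 3 - 8 * r z ^ 3 * dy l r z * yl m z / al z ^ 4
      - 2 * r z ^ 4 * dy l (yl m) z / al z ^ 4 + 8 * r z ^ 4 * yl m z * dy l al z / al z ^ 5"
    by (rule dd_eqI[THEN trans])
       (use al_pos[OF z] in \<open>auto intro!: derivative_eq_intros hd_al[OF z] hd_r[OF z] hrho hd_\<Omega>[OF sm_yl S]
         simp: field_simps eval_nat_numeral\<close>)
  also have "\<dots> = 2 * r z ^ 3 * \<Delta> z / al z ^ 4 * a (fst z) $ l $ m
     + 12 * (r z)\<^sup>2 / (al z)\<^sup>2 * rho l z * rho m z
     - 8 * r z ^ 3 / al z ^ 4 * (rho m z * yl l z + rho l z * yl m z)
     + (8 * r z ^ 4 / al z ^ 6 - 4 * r z ^ 3 * bl z / al z ^ 5) * yl l z * yl m z"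
  proof -
    \<comment> \<open>Eliminating \<open>be\<close> leaves quantities without a relation between
      them, so both sides reduce to the same polynomial.\<close>
    have be: "be z = r z - bl z * al z" by (simp add: r_def)
    show ?thesis
      unfolding dy_r[OF z] dy_rho[OF z] dy_al[OF z] dy_yl[OF S] \<Delta>_def be sym_a[OF S, of m l]
      using al_pos[OF z] by (simp add: field_simps eval_nat_numeral)
  qed
  finally show ?thesis .
qed

text \<open>As \<alpha> is constant along horizontal curves, only b and \<beta> vary in
  \<open>P\<close>.\<close>

lemma xi_P: assumes z: "z \<in> Z0"
  shows "xi P z = 4 * r z ^ 3 * ((c (fst z) * be z + s0 z) / (bl z * al z) + c (fst z))"
  using al_pos[OF z] bl_pos[OF Z0_S[OF z]]
  by (simp add: dd_P[OF z] dd_r[OF z] hlift_al[OF z] xi_bl[OF Z0_S[OF z]] xi_be[OF Z0_S[OF z]] flip: al_sq[OF z])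
     (simp add: field_simps eval_nat_numeral)

lemma hor_P: assumes z: "z \<in> Z0"
  shows "hor l P z = 4 * r z ^ 3 * (al z * (c (fst z) * b (fst z) $ l + sl l (fst z)) / bl z + c (fst z) * yl l z - sy l z) / (al z)\<^sup>2"
  using al_pos[OF z] bl_pos[OF Z0_S[OF z]]
  by (simp add: dd_P[OF z] dd_r[OF z] hlift_al[OF z] hor_bl[OF Z0_S[OF z]] hor_be[OF Z0_S[OF z]])

lemma dy_xi_P: assumes z: "z \<in> Z0"
  shows "dy l (\<lambda>z. xi P z) z = 12 * (r z)\<^sup>2 * rho l z * ((c (fst z) * be z + s0 z) / (bl z * al z) + c (fst z))
     + 4 * r z ^ 3 * ((c (fst z) * b (fst z) $ l + sl l (fst z)) / (bl z * al z)
        - (c (fst z) * be z + s0 z) * yl l z / (bl z * al z ^ 3))"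
proof -
  have S: "fst z \<in> S" using z by (rule Z0_S)
  note hc = hd_\<Omega>[OF sm_base[OF sm_c] S]
  have "dy l (\<lambda>z. xi P z) z = dy l (\<lambda>z. 4 * r z ^ 3 * ((c (fst z) * be z + s0 z) / (bl z * al z) + c (fst z))) z"
    by (rule dd_cong[OF open_Z0 z]) (rule xi_P)
  also have "\<dots> = 12 * (r z)\<^sup>2 * dy l r z * ((c (fst z) * be z + s0 z) / (bl z * al z) + c (fst z))
     + 4 * r z ^ 3 * ((c (fst z) * dy l be z + dy l (\<lambda>z. c (fst z)) z * be z + dy l s0 z) / (bl z * al z)
        - (c (fst z) * be z + s0 z) * (dy l bl z * al z + bl z * dy l al z) / (bl z * al z)\<^sup>2 + dy l (\<lambda>z. c (fst z)) z)"
    by (rule dd_eqI[THEN trans])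
       (use al_pos[OF z] bl_pos[OF S] in \<open>auto intro!: derivative_eq_intros hd_al[OF z] hd_r[OF z] hc
          hd_\<Omega>[OF sm_be S] hd_\<Omega>[OF sm_s0 S] hd_\<Omega>[OF sm_bl S] simp: field_simps eval_nat_numeral\<close>)
  finally show ?thesis
    using al_pos[OF z] bl_pos[OF S]
    by (simp add: dy_r[OF z] dy_be[OF S] dy_s0[OF S] dy_bl[OF S] dy_al[OF z] dy_base[OF sm_c S])
       (simp add: field_simps eval_nat_numeral)
qed

end

section \<open>The spray of the singular square metric\<close>

text \<open>One component of the linear system for the deviation of the spray, with every sum
  replaced by a real variable: Y and R stand for the contractions of the deviation with y_m and
  \<open>rho\<close>.\<close>

lemma spray_identity:
  fixes al bl be c s0 yl b sl sy r \<Delta> rho Y R p u v q :: real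
  assumes nz: "al \<noteq> 0" "bl \<noteq> 0" "\<Delta> \<noteq> 0" and be: "be = bl * al - \<Delta>" and r: "r = 2 * bl * al - \<Delta>"
    and rho: "rho = bl * yl / al + b"
    and Y: "Y = c * al ^ 3 / bl - al ^ 3 * s0 / (bl * \<Delta>)"
    and R: "R = c * al * r / bl - s0 * al * be / (bl * \<Delta>)"
    and q: "q = 2 * al\<^sup>2 / \<Delta>" and v: "v = - (al ^ 3 / (bl * \<Delta>))"
    and p: "p = c * al / bl + s0 * al * be / (bl * \<Delta>\<^sup>2)" and u: "u = - (s0 * al ^ 3 / (bl * \<Delta>\<^sup>2))"
  shows "2 * (2 * r ^ 3 * \<Delta> / al ^ 4 * (q * sy + v * sl + p * yl + u * b)
     + 12 * r\<^sup>2 / al\<^sup>2 * rho * R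
     - 8 * r ^ 3 / al ^ 4 * (R * yl + rho * Y)
     + (8 * r ^ 4 / al ^ 6 - 4 * r ^ 3 * bl / al ^ 5) * yl * Y)
    = (12 * r\<^sup>2 * rho * ((c * be + s0) / (bl * al) + c)
     + 4 * r ^ 3 * ((c * b + sl) / (bl * al) - (c * be + s0) * yl / (bl * al ^ 3)))
     - 2 * (4 * r ^ 3 * (al * (c * b + sl) / bl + c * yl - sy) / al\<^sup>2)"
proof -
  \<comment> \<open>The common factor r^2 may vanish, so the identity is proved without it and
    multiplied by it afterwards; this also lowers the degree.\<close>
  have "2 * (2 * r * \<Delta> / al ^ 4 * (q * sy + v * sl + p * yl + u * b)
     + 12 / al\<^sup>2 * rho * R
     - 8 * r / al ^ 4 * (R * yl + rho * Y)
     + (8 * r ^ 2 / al ^ 6 - 4 * r * bl / al ^ 5) * yl * Y)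
    = (12 * rho * ((c * be + s0) / (bl * al) + c)
     + 4 * r * ((c * b + sl) / (bl * al) - (c * be + s0) * yl / (bl * al ^ 3)))
     - 2 * (4 * r * (al * (c * b + sl) / bl + c * yl - sy) / al\<^sup>2)" (is "?L = ?R")
    unfolding q v p u Y R rho r be using nz by (simp add: divide_simps eval_nat_numeral) (simp add: algebra_simps)
  then have "r\<^sup>2 * ?L = r\<^sup>2 * ?R" by simp
  then show ?thesis using nz by (simp add: algebra_simps eval_nat_numeral add_divide_distrib diff_divide_distrib)
qed

context sq_chart
begin

definition Fa :: "real^'n \<Rightarrow> real^'n \<Rightarrow> real" where "Fa x y = al (x, y)"
definition Fs :: "real^'n \<Rightarrow> real^'n \<Rightarrow> real" where "Fs x y = (r (x, y))\<^sup>2 / al (x, y)"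

lemma Fs_sq: "(Fs u v)\<^sup>2 = P (u, v)"
  by (simp add: Fs_def P_def power_divide flip: power_mult)

lemma Fa_sq: "(u, v) \<in> Z0 \<Longrightarrow> (Fa u v)\<^sup>2 = Aq (u, v)"
  by (simp add: Fa_def al_sq)

lemma dy_dy_Aq: assumes z: "z \<in> Z0" shows "dy l (dy m Aq) z = 2 * a (fst z) $ l $ m"
proof -
  have S: "fst z \<in> S" using z by (rule Z0_S)
  have "z \<in> \<Omega>" using z Z0_\<Omega> by auto
  note d = sm_differentiable[OF sm_yl this]
  have "dy l (dy m Aq) z = dy l (\<lambda>z. 2 * yl m z) z"
    by (rule dd_cong[OF open_Z0 z]) (simp add: dy_Aq Z0_S)
  then show ?thesis by (simp add: dd_cmult d dy_yl[OF S] sym_a[OF S, of m l])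
qed

lemma fundamental_Fa: "(x, y) \<in> Z0 \<Longrightarrow> fundamental_tensor Fa x y = a x"
  using fundamental_tensor_eq[OF open_Z0 _ sm_subset[OF sm_Aq Z0_\<Omega>] Fa_sq]
  by (simp add: vec_eq_iff dy_dy_Aq)

lemma nondegenerate_Fa: "x \<in> S \<Longrightarrow> nondegenerate Fa x y \<longleftrightarrow> y \<noteq> 0"
  using fundamental_Fa[of x y] invertible_a[of x] by (auto simp: nondegenerate_def Z0_def)

lemma spray_Fa: assumes z: "(x, y) \<in> Z0" shows "spray Fa x y $ i = G i (x, y)"
proof -
  have "spray Fa x y $ i = G i (x, y) + 0"
  proof (rule spray_eq[OF open_Z0 Z0_\<Omega> z sm_subset[OF sm_Aq Z0_\<Omega>] Fa_sq])
    show "invertible (fundamental_tensor Fa x y)"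
      using fundamental_Fa[OF z] invertible_a Z0_S[OF z] by simp
    have "dy l (\<lambda>z. xi Aq z) (x, y) = dy l (\<lambda>z. 0) (x, y)" for l
      by (rule dd_cong[OF open_Z0 z]) (rule hlift_Aq, rule Z0_S)
    then show "2 * (\<Sum>m\<in>UNIV. dy l (dy m Aq) (x, y) * 0) = dy l (\<lambda>z. xi Aq z) (x, y) - 2 * hor l Aq (x, y)" for l
      using hlift_Aq[OF Z0_S[OF z]] by simp
  qed
  then show ?thesis by simp
qed

lemma riemann_Fa: "(x, y) \<in> Z0 \<Longrightarrow> riemann Fa x y $ i $ k = Rm G i k (x, y)"
  by (rule riemann_eq_Rm[OF open_Z0 _ sm_subset[OF sm_G Z0_\<Omega>] spray_Fa])

text \<open>On \<open>Zd\<close> the deviation \<open>D\<close> is smooth; \<open>Zs\<close> also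
  excludes the directions with r = 0, where F vanishes and its fundamental tensor
  degenerates.\<close>

definition Zd :: "'n tangent set" where "Zd = {z \<in> Z0. \<Delta> z \<noteq> 0}"
definition Zs :: "'n tangent set" where "Zs = {z \<in> Zd. r z \<noteq> 0}"

lemma Zd_Z0: "Zd \<subseteq> Z0" and Zs_Zd: "Zs \<subseteq> Zd" by (auto simp: Zd_def Zs_def)
lemma Zd_\<Omega>: "Zd \<subseteq> \<Omega>" using Zd_Z0 Z0_\<Omega> by blast

lemma open_Zd: "open Zd"
proof -
  have "open (Z0 \<inter> \<Delta> -` (- {0}))"
    by (rule continuous_open_preimage[OF sm_continuous_on[OF sm_\<Delta>] open_Z0]) auto
  moreover have "Zd = Z0 \<inter> \<Delta> -` (- {0})" by (auto simp: Zd_def)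
  ultimately show ?thesis by simp
qed

lemma open_Zs: "open Zs"
proof -
  have "open (Zd \<inter> r -` (- {0}))"
    by (rule continuous_open_preimage[OF sm_continuous_on[OF sm_subset[OF sm_r Zd_Z0]] open_Zd]) auto
  moreover have "Zs = Zd \<inter> r -` (- {0})" by (auto simp: Zs_def)
  ultimately show ?thesis by simp
qed

definition qf where "qf z = 2 * (al z)\<^sup>2 / \<Delta> z"
definition vf where "vf z = - (al z ^ 3 / (bl z * \<Delta> z))"
definition pf where "pf z = c (fst z) * al z / bl z + s0 z * al z * be z / (bl z * (\<Delta> z)\<^sup>2)"
definition uf where "uf z = - (s0 z * al z ^ 3 / (bl z * (\<Delta> z)\<^sup>2))"
definition D :: "'n \<Rightarrow> 'n tangent \<Rightarrow> real" where
  "D i z = qf z * t i z + vf z * su i (fst z) + pf z * snd z $ i + uf z * bu i (fst z)"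

lemma Zd_nz: "z \<in> Zd \<Longrightarrow> bl z \<noteq> 0" "z \<in> Zd \<Longrightarrow> \<Delta> z \<noteq> 0"
  using bl_pos[of z] Z0_S[of z] by (auto simp: Zd_def)

lemma sm_D: "sm Zd (D i)"
  unfolding D_def qf_def vf_def pf_def uf_def
  by (intro sm_add sm_mult sm_divide sm_minus sm_power sm_const sm_snd_nth open_Zd
      sm_subset[OF sm_al Zd_Z0] sm_subset[OF sm_\<Delta> Zd_Z0] sm_subset[OF sm_bl Zd_\<Omega>] sm_subset[OF sm_t Zd_\<Omega>]
      sm_subset[OF sm_s0 Zd_\<Omega>] sm_subset[OF sm_be Zd_\<Omega>] sm_subset[OF sm_base[OF sm_su] Zd_\<Omega>]
      sm_subset[OF sm_base[OF sm_bu] Zd_\<Omega>] sm_subset[OF sm_base[OF sm_c] Zd_\<Omega>])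
     (use Zd_nz in auto)

lemma sum_D: "(\<Sum>m\<in>UNIV. w m * D m z) = qf z * (\<Sum>m\<in>UNIV. w m * t m z) + vf z * (\<Sum>m\<in>UNIV. w m * su m (fst z))
   + pf z * (\<Sum>m\<in>UNIV. w m * snd z $ m) + uf z * (\<Sum>m\<in>UNIV. w m * bu m (fst z))"
  unfolding D_def by (simp add: algebra_simps sum.distrib sum_distrib_left)

lemma a_D: "fst z \<in> S \<Longrightarrow> (\<Sum>m\<in>UNIV. a (fst z) $ l $ m * D m z)
   = qf z * sy l z + vf z * sl l (fst z) + pf z * yl l z + uf z * b (fst z) $ l"
  unfolding sum_D by (simp add: a_t a_su a_bu yl_def)

text \<open>Outside its metric part the fundamental tensor sees a vector only through the
  contractions with y_m and b_m; this lemma and \<open>b_D\<close> supply them for the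
  deviation.\<close>

lemma yl_D: assumes z: "z \<in> Zd"
  shows "(\<Sum>m\<in>UNIV. yl m z * D m z) = c (fst z) * al z ^ 3 / bl z - al z ^ 3 * s0 z / (bl z * \<Delta> z)"
proof -
  have z0: "z \<in> Z0" and S: "fst z \<in> S" and d: "\<Delta> z \<noteq> 0" using z Z0_S by (auto simp: Zd_def)
  show ?thesis
    unfolding sum_D yl_t[OF S] yl_su[OF S] yl_y yl_bu[OF S] qf_def vf_def pf_def uf_def al_sq[OF z0, symmetric]
    using al_pos[OF z0] bl_pos[OF S] d by (simp add: field_simps power3_eq_cube power2_eq_square)
qed

lemma b_D: assumes z: "z \<in> Zd"
  shows "(\<Sum>m\<in>UNIV. b (fst z) $ m * D m z) = c (fst z) * al z * be z / bl z + s0 z * al z / bl z"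
proof -
  have z0: "z \<in> Z0" and S: "fst z \<in> S" and d: "\<Delta> z \<noteq> 0" using z Z0_S by (auto simp: Zd_def)
  have be: "be z = bl z * al z - \<Delta> z" by (simp add: \<Delta>_def)
  show ?thesis
    unfolding sum_D b_t[OF S] b_su[OF S] b_y b_bu qf_def vf_def pf_def uf_def bl_sq[OF S, symmetric] be
    using al_pos[OF z0] bl_pos[OF S] d by (simp add: field_simps power3_eq_cube power2_eq_square)
qed

lemma sum_g: "(\<Sum>m\<in>UNIV. (K1 * a x $ l $ m + K2 * rl * rho m z - K3 * (rho m z * y1 + rl * yl m z) + K4 * y1 * yl m z) * w m)
   = K1 * (\<Sum>m\<in>UNIV. a x $ l $ m * w m) + K2 * rl * (\<Sum>m\<in>UNIV. rho m z * w m)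
     - K3 * ((\<Sum>m\<in>UNIV. rho m z * w m) * y1 + rl * (\<Sum>m\<in>UNIV. yl m z * w m)) + K4 * y1 * (\<Sum>m\<in>UNIV. yl m z * w m)"
  by (simp add: algebra_simps sum.distrib sum_subtractf sum_distrib_left)

lemma rho_sum: "(\<Sum>m\<in>UNIV. rho m z * w m) = bl z / al z * (\<Sum>m\<in>UNIV. yl m z * w m) + (\<Sum>m\<in>UNIV. b (fst z) $ m * w m)"
  unfolding rho_def by (simp add: algebra_simps sum.distrib sum_distrib_left)

lemma spray_cond: assumes z: "z \<in> Zd"
  shows "2 * (\<Sum>m\<in>UNIV. dy l (dy m P) z * D m z) = dy l (\<lambda>z. xi P z) z - 2 * hor l P z"
proof -
  have z0: "z \<in> Z0" and S: "fst z \<in> S" and d: "\<Delta> z \<noteq> 0" using z Z0_S by (auto simp: Zd_def)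
  have be: "be z = bl z * al z - \<Delta> z" by (simp add: \<Delta>_def)
  have r: "r z = 2 * bl z * al z - \<Delta> z" by (simp add: \<Delta>_def r_def)
  have R: "(\<Sum>m\<in>UNIV. rho m z * D m z) = c (fst z) * al z * r z / bl z - s0 z * al z * be z / (bl z * \<Delta> z)"
    unfolding rho_sum yl_D[OF z] b_D[OF z] r be
    using al_pos[OF z0] bl_pos[OF S] d by (simp add: divide_simps power3_eq_cube) (simp add: algebra_simps)
  show ?thesis
    unfolding dy_dy_P[OF z0] sum_g a_D[OF S] dy_xi_P[OF z0] hor_P[OF z0]
    by (rule spray_identity[OF _ _ d be r rho_def yl_D[OF z] R qf_def vf_def pf_def uf_def])
       (use al_pos[OF z0] bl_pos[OF S] in auto)
qed

lemma fundamental_Fs: "(x, y) \<in> Z0 \<Longrightarrow> fundamental_tensor Fs x y $ l $ m = 1/2 * dy l (dy m P) (x, y)"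
  by (rule fundamental_tensor_eq[OF open_Z0 _ sm_P Fs_sq])

lemma g_mult:
  fixes w :: "real^'n"
  assumes z: "(x, y) \<in> Z0"
  defines "Yw \<equiv> \<Sum>m\<in>UNIV. yl m (x, y) * w $ m" and "Rw \<equiv> \<Sum>m\<in>UNIV. rho m (x, y) * w $ m"
  shows "(fundamental_tensor Fs x y *v w) $ l = 1/2 * (2 * r (x, y) ^ 3 * \<Delta> (x, y) / al (x, y) ^ 4 * (\<Sum>m\<in>UNIV. a x $ l $ m * w $ m)
     + 12 * (r (x, y))\<^sup>2 / (al (x, y))\<^sup>2 * rho l (x, y) * Rw
     - 8 * r (x, y) ^ 3 / al (x, y) ^ 4 * (Rw * yl l (x, y) + rho l (x, y) * Yw)
     + (8 * r (x, y) ^ 4 / al (x, y) ^ 6 - 4 * r (x, y) ^ 3 * bl (x, y) / al (x, y) ^ 5) * yl l (x, y) * Yw)"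
proof -
  have "(fundamental_tensor Fs x y *v w) $ l = 1/2 * (\<Sum>m\<in>UNIV. dy l (dy m P) (x, y) * w $ m)"
    by (simp add: matrix_vector_mult_def fundamental_Fs[OF z] sum_distrib_left)
  then show ?thesis unfolding dy_dy_P[OF z] sum_g Yw_def Rw_def by simp
qed

text \<open>Dimension at least three enters here: two vectors span at most a plane.\<close>

lemma exists_orthogonal_pair:
  obtains w :: "real^'n" where "w \<noteq> 0" "w \<bullet> u = 0" "w \<bullet> v = 0"
proof -
  have "dim {u, v} \<le> card {u, v}" by (rule dim_le_card') simp
  also have "\<dots> < DIM(real^'n)" using card3 card_insert_le_m1[of 2 "{v}" u] by (auto simp: card_insert_if)
  finally obtain w where "w \<noteq> 0" "\<forall>y\<in>span {u, v}. orthogonal w y"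
    using orthogonal_to_subspace_exists by metis
  then show ?thesis by (intro that[of w]) (auto simp: orthogonal_def span_base)
qed

text \<open>If r \<Delta> = 0, the multiple of the metric in \<open>g_mult\<close> disappears, and a
  vector annihilated by y_m and b_m lies in the kernel. Otherwise contracting the kernel equation
  with y and b gives a linear system for \<open>Yw\<close> and \<open>Rw\<close> that has only the
  zero solution, and the metric term remains alone.\<close>

lemma invertible_Fs_iff:
  assumes z: "(x, y) \<in> Z0"
  shows "invertible (fundamental_tensor Fs x y) \<longleftrightarrow> (x, y) \<in> Zs"
proof -
  let ?z = "(x, y)"
  have S: "fst ?z \<in> S" using z by (rule Z0_S)
  let ?g = "fundamental_tensor Fs x y"
  have inv: "invertible ?g \<longleftrightarrow> (\<forall>w. ?g *v w = 0 \<longrightarrow> w = 0)"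
    using matrix_left_invertible_ker[of ?g] invertible_left_inverse[of ?g] by blast
  show ?thesis
  proof
    assume i: "invertible ?g"
    show "?z \<in> Zs"
    proof (rule ccontr)
      assume "?z \<notin> Zs"
      then have rd: "r ?z * \<Delta> ?z = 0" using z by (auto simp: Zs_def Zd_def)
      obtain w where w: "w \<noteq> 0" "w \<bullet> (\<chi> m. yl m ?z) = 0" "w \<bullet> b x = 0"
        using exists_orthogonal_pair .
      have Y: "(\<Sum>m\<in>UNIV. yl m ?z * w $ m) = 0" using w(2) by (simp add: inner_vec_def mult.commute)
      have X: "(\<Sum>m\<in>UNIV. b x $ m * w $ m) = 0" using w(3) by (simp add: inner_vec_def mult.commute)
      have R: "(\<Sum>m\<in>UNIV. rho m ?z * w $ m) = 0" using rho_sum[of ?z] Y X by simp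
      have "?g *v w = 0"
        using rd by (auto simp: vec_eq_iff g_mult[OF z] Y R)
      then show False using i inv w(1) by blast
    qed
  next
    assume zs: "?z \<in> Zs"
    then have d: "\<Delta> ?z \<noteq> 0" and r0: "r ?z \<noteq> 0" by (auto simp: Zs_def Zd_def)
    have al: "al ?z > 0" using al_pos[OF z] .
    have bl: "bl ?z > 0" using bl_pos[OF S] .
    have "w = 0" if "?g *v w = 0" for w
    proof -
      define Yw where "Yw = (\<Sum>m\<in>UNIV. yl m ?z * w $ m)"
      define Xw where "Xw = (\<Sum>m\<in>UNIV. b x $ m * w $ m)"
      define Rw where "Rw = (\<Sum>m\<in>UNIV. rho m ?z * w $ m)"
      have R: "Rw = bl ?z / al ?z * Yw + Xw" using rho_sum[of ?z] by (simp add: Rw_def Xw_def Yw_def)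
      define K1 where "K1 = 2 * r ?z ^ 3 * \<Delta> ?z / al ?z ^ 4"
      define K2 where "K2 = 12 * (r ?z)\<^sup>2 / (al ?z)\<^sup>2"
      define K3 where "K3 = 8 * r ?z ^ 3 / al ?z ^ 4"
      define K4 where "K4 = 8 * r ?z ^ 4 / al ?z ^ 6 - 4 * r ?z ^ 3 * bl ?z / al ?z ^ 5"
      have e: "K1 * (\<Sum>m\<in>UNIV. a x $ l $ m * w $ m) + K2 * rho l ?z * Rw - K3 * (Rw * yl l ?z + rho l ?z * Yw) + K4 * yl l ?z * Yw = 0" for l
        using that g_mult[OF z, of w l] unfolding vec_eq_iff K1_def K2_def K3_def K4_def Yw_def Rw_def by simp
      \<comment> \<open>The kernel equation contracted with an arbitrary v, to be used for v = y and
        for v = b.\<close>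
      have con: "K1 * (\<Sum>l\<in>UNIV. v l * (\<Sum>m\<in>UNIV. a x $ l $ m * w $ m)) + K2 * (\<Sum>l\<in>UNIV. rho l ?z * v l) * Rw
          - K3 * (Rw * (\<Sum>l\<in>UNIV. yl l ?z * v l) + (\<Sum>l\<in>UNIV. rho l ?z * v l) * Yw) + K4 * (\<Sum>l\<in>UNIV. yl l ?z * v l) * Yw = 0" for v
      proof -
        have "(\<Sum>l\<in>UNIV. v l * (K1 * (\<Sum>m\<in>UNIV. a x $ l $ m * w $ m) + K2 * rho l ?z * Rw - K3 * (Rw * yl l ?z + rho l ?z * Yw) + K4 * yl l ?z * Yw)) = 0"
          by (simp add: e)
        then show ?thesis
          by (simp add: algebra_simps sum.distrib sum_subtractf flip: sum_distrib_left sum_distrib_right)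
      qed
      have av: "(\<Sum>l\<in>UNIV. v l * (\<Sum>m\<in>UNIV. a x $ l $ m * w $ m)) = (\<Sum>m\<in>UNIV. (\<Sum>l\<in>UNIV. a x $ m $ l * v l) * w $ m)" for v
      proof -
        have "(\<Sum>l\<in>UNIV. v l * (\<Sum>m\<in>UNIV. a x $ l $ m * w $ m)) = (\<Sum>l\<in>UNIV. \<Sum>m\<in>UNIV. a x $ m $ l * v l * w $ m)"
          using sym_a S by (simp add: sum_distrib_left mult_ac)
        also have "\<dots> = (\<Sum>m\<in>UNIV. \<Sum>l\<in>UNIV. a x $ m $ l * v l * w $ m)" by (rule sum.swap)
        finally show ?thesis by (simp add: sum_distrib_right)
      qed
      have ry: "(\<Sum>l\<in>UNIV. rho l ?z * y $ l) = r ?z"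
        using rho_sum[of ?z "\<lambda>l. y $ l"] yl_y[of ?z] b_y[of ?z] al_sq[OF z] al
        by (simp add: r_def power2_eq_square flip: al_sq[OF z])
      have rb: "(\<Sum>l\<in>UNIV. rho l ?z * bu l x) = bl ?z * r ?z / al ?z"
        using rho_sum[of ?z "\<lambda>l. bu l x"] yl_bu[OF S] b_bu[of x] bl_sq[OF S] al
        by (simp add: r_def power2_eq_square field_simps flip: bl_sq[OF S])
      have "K1 * Yw + K2 * r ?z * Rw - K3 * (Rw * (al ?z)\<^sup>2 + r ?z * Yw) + K4 * (al ?z)\<^sup>2 * Yw = 0"
        using con[of "\<lambda>l. y $ l"] unfolding av ry using yl_y[of ?z] al_sq[OF z] by (simp add: yl_def Yw_def)
      moreover have "K1 * Yw + K2 * r ?z * Rw - K3 * (Rw * (al ?z)\<^sup>2 + r ?z * Yw) + K4 * (al ?z)\<^sup>2 * Yw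
          = 2 * r ?z ^ 3 / al ?z ^ 4 * (2 * (al ?z)\<^sup>2 * Rw - r ?z * Yw)"
        unfolding K1_def K2_def K3_def K4_def \<Delta>_def r_def using al
        by (simp add: field_simps eval_nat_numeral)
      ultimately have 1: "2 * (al ?z)\<^sup>2 * Rw = r ?z * Yw" using r0 al by simp
      have "K1 * Xw + K2 * (bl ?z * r ?z / al ?z) * Rw - K3 * (Rw * be ?z + bl ?z * r ?z / al ?z * Yw) + K4 * be ?z * Yw = 0"
        using con[of "\<lambda>l. bu l x"] unfolding av rb using yl_bu[OF S] a_bu S by (simp add: Xw_def)
      moreover have "K1 * Xw + K2 * (bl ?z * r ?z / al ?z) * Rw - K3 * (Rw * be ?z + bl ?z * r ?z / al ?z * Yw) + K4 * be ?z * Yw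
          = r ?z ^ 3 / al ?z ^ 4 * (2 * \<Delta> ?z * (Rw - bl ?z / al ?z * Yw) + 12 * bl ?z * al ?z * Rw
              - 8 * (be ?z * Rw + bl ?z * r ?z / al ?z * Yw) + (8 * r ?z / (al ?z)\<^sup>2 - 4 * bl ?z / al ?z) * be ?z * Yw)"
        unfolding K1_def K2_def K3_def K4_def R using al by (simp add: field_simps eval_nat_numeral)
      ultimately have 2: "2 * \<Delta> ?z * (Rw - bl ?z / al ?z * Yw) + 12 * bl ?z * al ?z * Rw
              - 8 * (be ?z * Rw + bl ?z * r ?z / al ?z * Yw) + (8 * r ?z / (al ?z)\<^sup>2 - 4 * bl ?z / al ?z) * be ?z * Yw = 0"
        using r0 al by simp
      have Rw: "Rw = r ?z * Yw / (2 * (al ?z)\<^sup>2)" using 1 al by (simp add: field_simps)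
      \<comment> \<open>After elimination of \<open>Rw\<close> the coefficient of \<open>Yw\<close>
        is a nonzero multiple of b^2 \<alpha>^2 - \<beta>^2 = r \<Delta>.\<close>
      have "Yw = 0 \<or> be ?z * be ?z = al ?z * (al ?z * (bl ?z * bl ?z))"
        using 2 al unfolding Rw unfolding r_def \<Delta>_def by (simp add: divide_simps eval_nat_numeral) (simp add: algebra_simps)
      moreover have "r ?z * \<Delta> ?z = al ?z * (al ?z * (bl ?z * bl ?z)) - be ?z * be ?z"
        unfolding r_def \<Delta>_def by (simp add: algebra_simps)
      ultimately have Y0: "Yw = 0" using r0 d by auto
      then have R0: "Rw = 0" using Rw by simp
      have "K1 \<noteq> 0" using r0 d al by (simp add: K1_def)
      then have "(\<Sum>m\<in>UNIV. a x $ l $ m * w $ m) = 0" for l using e[of l] Y0 R0 by simp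
      then have "a x *v w = 0" by (simp add: matrix_vector_mult_def vec_eq_iff)
      then show ?thesis using a_ker S by simp
    qed
    then show "invertible ?g" using inv by blast
  qed
qed

lemma nondegenerate_Fs: "x \<in> S \<Longrightarrow> nondegenerate Fs x y \<longleftrightarrow> (x, y) \<in> Zs"
  using invertible_Fs_iff[of x y] by (auto simp: nondegenerate_def Z0_def Zs_def Zd_def)

definition H :: "'n \<Rightarrow> 'n tangent \<Rightarrow> real" where "H i z = G i z + D i z"

lemma sm_H: "sm Zd (H i)"
  unfolding H_def by (intro sm_add open_Zd sm_D sm_subset[OF sm_G Zd_\<Omega>])

lemma spray_Fs: assumes z: "(x, y) \<in> Zs" shows "spray Fs x y $ i = H i (x, y)"
proof -
  have zd: "(x, y) \<in> Zd" and z0: "(x, y) \<in> Z0" using z Zs_Zd Zd_Z0 by auto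
  show ?thesis
    unfolding H_def
    by (rule spray_eq[OF open_Z0 Z0_\<Omega> z0 sm_P Fs_sq _ spray_cond[OF zd]])
       (use invertible_Fs_iff[OF z0] z in simp)
qed

lemma riemann_Fs: "(x, y) \<in> Zs \<Longrightarrow> riemann Fs x y $ i $ k = Rm H i k (x, y)"
  by (rule riemann_eq_Rm[OF open_Zs _ sm_subset[OF sm_H Zs_Zd] spray_Fs])

end

lemma sum_axis' [simp]:
  fixes f :: "'n::finite \<Rightarrow> real"
  shows "(\<Sum>k\<in>UNIV. f k * axis k 1 $ i) = f i" "(\<Sum>k\<in>UNIV. axis k 1 $ i * f k) = f i"
  by (simp_all add: axis_def if_distrib[of "\<lambda>c. _ * c"] if_distrib[of "\<lambda>c. c * _"] cong: if_cong)

section \<open>Quadratic forms\<close>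

text \<open>The point of the notion is the parallelogram law, which transports an identity to
  directions in which no curvature equation is available.\<close>

definition quad :: "(real^'n::finite \<Rightarrow> real) \<Rightarrow> bool" where
  "quad f \<longleftrightarrow> (\<exists>Q. \<forall>y. f y = (\<Sum>i\<in>UNIV. \<Sum>j\<in>UNIV. Q i j * (y $ i * y $ j)))"

lemma quadI: "(\<And>y. f y = (\<Sum>i\<in>UNIV. \<Sum>j\<in>UNIV. Q i j * (y $ i * y $ j))) \<Longrightarrow> quad f"
  unfolding quad_def by blast

lemma quad_add: "quad f \<Longrightarrow> quad g \<Longrightarrow> quad (\<lambda>y. f y + g y)"
proof -
  assume "quad f" "quad g"
  then obtain P Q where "\<forall>y. f y = (\<Sum>i\<in>UNIV. \<Sum>j\<in>UNIV. P i j * (y $ i * y $ j))"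
    "\<forall>y. g y = (\<Sum>i\<in>UNIV. \<Sum>j\<in>UNIV. Q i j * (y $ i * y $ j))" unfolding quad_def by blast
  then show ?thesis by (intro quadI[of _ "\<lambda>i j. P i j + Q i j"]) (simp add: distrib_right sum.distrib)
qed

lemma quad_cmult: "quad f \<Longrightarrow> quad (\<lambda>y. k * f y)"
proof -
  assume "quad f"
  then obtain P where "\<forall>y. f y = (\<Sum>i\<in>UNIV. \<Sum>j\<in>UNIV. P i j * (y $ i * y $ j))" unfolding quad_def by blast
  then show ?thesis by (intro quadI[of _ "\<lambda>i j. k * P i j"]) (simp add: sum_distrib_left mult_ac)
qed

lemma quad_0: "quad (\<lambda>y. 0)" by (rule quadI[of _ "\<lambda>i j. 0"]) simp

lemma quad_diff: "quad f \<Longrightarrow> quad g \<Longrightarrow> quad (\<lambda>y. f y - g y)"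
  using quad_add[of f "\<lambda>y. - 1 * g y"] quad_cmult[of g "- 1"] by simp

lemma quad_sum: "(\<And>i. i \<in> I \<Longrightarrow> quad (f i)) \<Longrightarrow> quad (\<lambda>y. \<Sum>i\<in>I. f i y)"
  by (induction I rule: infinite_finite_induct) (auto intro: quad_0 quad_add)

lemma quad_prod: "quad (\<lambda>y. (\<Sum>i\<in>UNIV. u i * y $ i) * (\<Sum>j\<in>UNIV. v j * y $ j))"
  by (rule quadI[of _ "\<lambda>i j. v i * u j"]) (simp add: sum_ac)

lemma quad_nth_prod: "quad (\<lambda>y. y $ i * (\<Sum>j\<in>UNIV. v j * y $ j))"
  using quad_prod[of "\<lambda>k. axis i 1 $ k" v] by simp

lemma quad_nth_nth: "quad (\<lambda>y. y $ i * y $ j)"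
  using quad_nth_prod[of i "\<lambda>k. axis j 1 $ k"] by simp

lemma quad_parallelogram:
  assumes "quad f" shows "f (u + v) + f (u - v) = 2 * f u + 2 * f v"
proof -
  obtain P where "\<And>y. f y = (\<Sum>i\<in>UNIV. \<Sum>j\<in>UNIV. P i j * (y $ i * y $ j))"
    using assms unfolding quad_def by blast
  then show ?thesis by (simp add: sum_distrib_left algebra_simps flip: sum.distrib)
qed

lemma quad_scale: assumes "quad f" shows "f (k *\<^sub>R u) = k\<^sup>2 * f u"
proof -
  obtain P where "\<And>y. f y = (\<Sum>i\<in>UNIV. \<Sum>j\<in>UNIV. P i j * (y $ i * y $ j))"
    using assms unfolding quad_def by blast
  then show ?thesis by (simp add: sum_distrib_left power2_eq_square mult_ac)
qed

lemma quad_uminus: "quad f \<Longrightarrow> f (- u) = f u"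
  using quad_scale[of f "- 1" u] by simp

context riem_chart
begin

text \<open>The coefficients \<open>G\<close> are quadratic in y, so each of the four terms of the
  Riemann tensor is quadratic too.\<close>

lemma quad_Rm_G:
  assumes x: "x \<in> S" shows "quad (\<lambda>y. Rm G i k (x, y))"
proof -
  have z: "fst (x, y) \<in> S" "(x, y) \<in> \<Omega>" for y :: "real^'n" using x by auto
  have dxG: "dx k (G i) (x, y) = 1/2 * (\<Sum>j\<in>UNIV. \<Sum>l\<in>UNIV. partial k (Gam i j l) x * (y $ j * y $ l))" for y
  proof -
    note d = sm_differentiable[OF sm_N z(2)[of y]] sm_differentiable[OF sm_snd_nth z(2)[of y]]
    have "dx k (G i) (x, y) = 1/2 * dx k (\<lambda>z. \<Sum>j\<in>UNIV. N i j z * snd z $ j) (x, y)"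
      unfolding G_eq_N by (rule dd_cmult) (auto intro!: differentiable_sum differentiable_mult d)
    also have "dx k (\<lambda>z. \<Sum>j\<in>UNIV. N i j z * snd z $ j) (x, y) = (\<Sum>j\<in>UNIV. dx k (N i j) (x, y) * y $ j)"
      by (subst dd_sum) (auto simp: dd_mult d intro!: differentiable_mult d)
    finally show ?thesis by (simp add: dd_N[OF z(1)] partial_eq_dd sum_distrib_left mult_ac)
  qed
  have dydxG: "dy k (dx l (G i)) (x, y) = (\<Sum>j\<in>UNIV. partial l (Gam i k j) x * y $ j)" for l and y :: "real^'n"
  proof -
    have "dy k (dx l (G i)) (x, y) = dx l (dy k (G i)) (x, y)" by (rule dd_commute[OF open_\<Omega> sm_G z(2)])
    also have "\<dots> = dx l (N i k) (x, y)" by (rule dd_cong[OF open_\<Omega> z(2)]) (auto simp: dy_G)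
    finally show ?thesis by (simp add: dd_N[OF z(1)] partial_eq_dd)
  qed
  have dydyG: "dy l (dy k (G i)) (x, y) = Gam i k l x" for l and y :: "real^'n"
  proof -
    have "dy l (dy k (G i)) (x, y) = dy l (N i k) (x, y)"
      by (rule dd_cong[OF open_\<Omega> z(2)]) (auto simp: dy_G)
    then show ?thesis by (simp add: dy_N[OF z(1)])
  qed
  have "quad (\<lambda>y. 2 * (1/2 * (\<Sum>j\<in>UNIV. \<Sum>l\<in>UNIV. partial k (Gam i j l) x * (y $ j * y $ l)))
     - (\<Sum>l\<in>UNIV. y $ l * (\<Sum>j\<in>UNIV. partial l (Gam i k j) x * y $ j))
     + 2 * (\<Sum>l\<in>UNIV. Gam i k l x * (1/2 * (\<Sum>p\<in>UNIV. \<Sum>q\<in>UNIV. Gam l p q x * (y $ p * y $ q))))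
     - (\<Sum>l\<in>UNIV. (\<Sum>p\<in>UNIV. Gam i l p x * y $ p) * (\<Sum>q\<in>UNIV. Gam l k q x * y $ q)))"
    by (intro quad_diff quad_add quad_cmult quad_sum quad_nth_prod quad_prod quad_nth_nth)
  moreover have "Rm G i k (x, y) = 2 * (1/2 * (\<Sum>j\<in>UNIV. \<Sum>l\<in>UNIV. partial k (Gam i j l) x * (y $ j * y $ l)))
     - (\<Sum>l\<in>UNIV. y $ l * (\<Sum>j\<in>UNIV. partial l (Gam i k j) x * y $ j))
     + 2 * (\<Sum>l\<in>UNIV. Gam i k l x * (1/2 * (\<Sum>p\<in>UNIV. \<Sum>q\<in>UNIV. Gam l p q x * (y $ p * y $ q))))
     - (\<Sum>l\<in>UNIV. (\<Sum>p\<in>UNIV. Gam i l p x * y $ p) * (\<Sum>q\<in>UNIV. Gam l k q x * y $ q))" for y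
    unfolding Rm_def dxG dydxG dydyG dy_G[OF z(1)] G_def[of _ "(x, y)"] N_def[of _ _ "(x, y)"]
    by (simp add: mult_ac)
  ultimately show ?thesis by simp
qed

lemma quad_Aq: "quad (\<lambda>y. Aq (x, y))"
  unfolding Aq_def yl_def by (auto intro!: quad_sum quad_nth_prod)

lemma quad_nth_yl: "quad (\<lambda>y. y $ i * yl k (x, y))"
  unfolding yl_def by (auto intro!: quad_nth_prod)

end

context sq_chart
begin

abbreviation Bu :: "real^'n \<Rightarrow> real^'n" where "Bu x \<equiv> \<chi> k. bu k x"

lemma be_add: "be (x, u + v) = be (x, u) + be (x, v)"
  and be_diff: "be (x, u - v) = be (x, u) - be (x, v)"
  and be_scale: "be (x, k *\<^sub>R u) = k * be (x, u)"
  and be_uminus: "be (x, - u) = - be (x, u)"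
  by (simp_all add: be_def algebra_simps sum.distrib sum_subtractf sum_distrib_left sum_negf)

lemma be_Bu: "be (x, Bu x) = B x"
  by (simp add: be_def b_bu)

lemma yl_add: "yl i (x, u + v) = yl i (x, u) + yl i (x, v)"
  by (simp add: yl_def algebra_simps sum.distrib)

lemma yl_scale: "yl i (x, k *\<^sub>R u) = k * yl i (x, u)"
  by (simp add: yl_def algebra_simps sum_distrib_left)

lemma Aq_comb: assumes x: "x \<in> S"
  shows "Aq (x, p *\<^sub>R Bu x + w) = p\<^sup>2 * B x + 2 * p * be (x, w) + Aq (x, w)"
proof -
  have "Aq (x, p *\<^sub>R Bu x + w) = (\<Sum>i\<in>UNIV. (p * bu i x + w $ i) * (p * b x $ i + yl i (x, w)))"
    unfolding Aq_def by (simp add: yl_add yl_scale yl_bu_pair[OF x])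
  also have "\<dots> = p\<^sup>2 * (\<Sum>i\<in>UNIV. bu i x * b x $ i) + p * (\<Sum>i\<in>UNIV. yl i (x, w) * bu i x)
     + p * (\<Sum>i\<in>UNIV. b x $ i * w $ i) + (\<Sum>i\<in>UNIV. w $ i * yl i (x, w))"
    by (simp add: algebra_simps sum.distrib sum_distrib_left power2_eq_square)
  finally show ?thesis using yl_bu[of "(x, w)"] b_y[of "(x, w)"] x by (simp add: B_def Aq_def)
qed

lemma be_comb: "be (x, p *\<^sub>R Bu x + w) = p * B x + be (x, w)"
  by (simp add: be_add be_scale be_Bu)

lemma r_\<Delta>: "z \<in> Z0 \<Longrightarrow> r z * \<Delta> z = B (fst z) * Aq z - (be z)\<^sup>2"
  using al_sq[of z] bl_sq[OF Z0_S, of z] by (simp add: r_def \<Delta>_def algebra_simps power2_eq_square)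

lemma Zs_iff: "z \<in> Zs \<longleftrightarrow> z \<in> Z0 \<and> B (fst z) * Aq z \<noteq> (be z)\<^sup>2"
  using r_\<Delta>[of z] by (auto simp: Zs_def Zd_def)

text \<open>b^2 \<alpha>^2 - \<beta>^2 is the Gram determinant of b and y, so adding a multiple of b
  to w does not change it.\<close>

lemma comb_in_Zs:
  assumes x: "x \<in> S" and w: "w \<noteq> 0" "be (x, w) = 0"
  shows "(x, p *\<^sub>R Bu x + w) \<in> Zs"
proof -
  have A: "Aq (x, w) > 0" using Aq_pos[of "(x, w)"] x w by simp
  have "p *\<^sub>R Bu x + w \<noteq> 0"
  proof
    assume 0: "p *\<^sub>R Bu x + w = 0"
    then have "p * B x = 0" using be_comb[of x p w] w by (simp add: be_def)
    then have "p = 0" using B_pos[OF x] by simp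
    with 0 w show False by simp
  qed
  then have "(x, p *\<^sub>R Bu x + w) \<in> Z0" using x by (simp add: Z0_def)
  moreover have "B x * Aq (x, p *\<^sub>R Bu x + w) - (be (x, p *\<^sub>R Bu x + w))\<^sup>2 = B x * Aq (x, w)"
    unfolding Aq_comb[OF x] be_comb w(2) by (simp add: algebra_simps power2_eq_square)
  moreover have "B x * Aq (x, w) > 0" using A B_pos[OF x] by simp
  ultimately show ?thesis unfolding Zs_iff by simp
qed

lemma decompose:
  assumes x: "x \<in> S"
  obtains p w where "v = p *\<^sub>R Bu x + w" "be (x, w) = 0"
proof (rule that)
  show "v = (be (x, v) / B x) *\<^sub>R Bu x + (v - (be (x, v) / B x) *\<^sub>R Bu x)" by simp
  show "be (x, v - (be (x, v) / B x) *\<^sub>R Bu x) = 0"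
    unfolding be_diff be_scale be_Bu using B_pos[OF x] by simp
qed

lemma exists_orth: obtains w where "w \<noteq> 0" "be (x, w) = 0"
proof -
  obtain w where "w \<noteq> 0" "w \<bullet> b x = 0" using exists_orthogonal_pair[of "b x" "b x"] by metis
  then show ?thesis by (intro that[of w]) (simp_all add: be_def inner_vec_def mult.commute)
qed

text \<open>Only multiples v of b need an argument. For such v and a nonzero w orthogonal to b, the
  directions v + w, v - w and w are admissible, and the parallelogram law yields the value at
  v.\<close>

lemma quad_extend:
  assumes x: "x \<in> S" and f: "quad f" and 0: "\<And>y. (x, y) \<in> Zs \<Longrightarrow> f y = 0"
  shows "f v = 0"
proof -
  obtain w where w: "w \<noteq> 0" "be (x, w) = 0" using exists_orth .
  obtain p u where v: "v = p *\<^sub>R Bu x + u" "be (x, u) = 0" using decompose[OF x] .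
  show ?thesis
  proof (cases "u = 0")
    case False then show ?thesis using 0 comb_in_Zs[OF x False v(2)] v by simp
  next
    case True
    have "f (v + w) = 0" "f (v - w) = 0" "f w = 0"
      using 0[OF comb_in_Zs[OF x w, of p]] 0[OF comb_in_Zs[OF x, of "- w" p]] 0[OF comb_in_Zs[OF x w, of 0]] w True v
      by (simp_all add: be_uminus)
    then show ?thesis using quad_parallelogram[OF f, of v w] by simp
  qed
qed

section \<open>Closed forms\<close>

definition fc :: "real^'n \<Rightarrow> real" where "fc x = c x / sqrt (B x)"

lemma sm_fc: "sm S fc"
  unfolding fc_def by (intro sm_divide sm_sqrt open_S sm_c sm_B B_pos) (use B_pos in fastforce)+

definition f0 :: "'n tangent \<Rightarrow> real" where "f0 z = (\<Sum>k\<in>UNIV. partial k fc (fst z) * snd z $ k)"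

lemma sm_dfc: "sm S (partial k fc)" unfolding partial_eq_dd by (intro sm_dd sm_fc)

lemma sm_f0: "sm \<Omega> f0"
  unfolding f0_def by (intro sm_sum sm_mult open_\<Omega> sm_base[OF sm_dfc] sm_snd_nth)

lemma dy_f0: "fst z \<in> S \<Longrightarrow> dy k f0 z = partial k fc (fst z)"
  unfolding f0_def
  by (subst dd_lin_comb_base[OF sm_dfc]) (auto simp: dd_linear_comb[OF sm_differentiable[OF sm_dfc]])

definition Dp :: "'n \<Rightarrow> 'n tangent \<Rightarrow> real" where "Dp i z = fc (fst z) * al z * snd z $ i"

lemma sm_Dp: "sm Z0 (Dp i)"
  unfolding Dp_def by (intro sm_mult open_Z0 sm_al sm_snd_nth sm_subset[OF sm_base[OF sm_fc] Z0_\<Omega>])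

lemma hd_snd: "((\<lambda>z. snd z $ i) has_derivative (\<lambda>v. dd v (\<lambda>z. snd z $ i) z)) (at z)"
  by (rule sm_has_derivative[OF sm_snd_nth[of UNIV]]) simp

lemma dd_Dp: assumes z: "z \<in> Z0"
  shows "dd v (Dp i) z = (dd v (\<lambda>z. fc (fst z)) z * al z + fc (fst z) * dd v al z) * snd z $ i
     + fc (fst z) * al z * dd v (\<lambda>z. snd z $ i) z"
  unfolding Dp_def
  by (rule dd_eqI[THEN trans])
     (auto intro!: derivative_eq_intros hd_al[OF z] hd_\<Omega>[OF sm_base[OF sm_fc] Z0_S[OF z]] hd_snd simp: algebra_simps)

lemma hlift_snd: "dd (hlift u z) (\<lambda>z. snd z $ i) z = - (\<Sum>j\<in>UNIV. N i j z * u $ j)"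
  by (simp add: hlift_def)

lemma nab_Dp: assumes z: "z \<in> Z0" shows "nab k Dp i z = partial k fc (fst z) * al z * snd z $ i"
proof -
  have "(\<Sum>m\<in>UNIV. Gam i k m (fst z) * Dp m z) = fc (fst z) * al z * N i k z"
    unfolding Dp_def N_def by (simp add: sum_distrib_left mult_ac)
  then show ?thesis
    unfolding nab_def dd_Dp[OF z] hlift_al[OF z] hlift_base[OF sm_fc Z0_S[OF z]] hlift_snd
    by (simp add: algebra_simps)
qed

lemma nab0_Dp: assumes z: "z \<in> Z0" shows "nab0 Dp i z = f0 z * al z * snd z $ i"
proof -
  have "(\<Sum>m\<in>UNIV. N i m z * Dp m z) = fc (fst z) * al z * (\<Sum>m\<in>UNIV. N i m z * snd z $ m)"
    unfolding Dp_def by (simp add: sum_distrib_left mult_ac)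
  then show ?thesis
    unfolding nab0_def dd_Dp[OF z] hlift_al[OF z] hlift_base[OF sm_fc Z0_S[OF z]] hlift_snd f0_def
    by (simp add: mult.commute)
qed

lemma dy_Dp: assumes z: "z \<in> Z0"
  shows "dy k (Dp i) z = fc (fst z) * (yl k z / al z * snd z $ i + al z * axis k 1 $ i)"
  unfolding dd_Dp[OF z] by (simp add: dy_base[OF sm_fc Z0_S[OF z]] dy_al[OF z] algebra_simps)

lemma dy_dy_Dp: assumes z: "z \<in> Z0"
  shows "dy l (dy k (Dp i)) z = fc (fst z) * ((a (fst z) $ k $ l / al z - yl k z * yl l z / al z ^ 3) * snd z $ i
     + yl k z / al z * axis l 1 $ i + yl l z / al z * axis k 1 $ i)"
proof -
  have S: "fst z \<in> S" using z by (rule Z0_S)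
  have "dy l (dy k (Dp i)) z = dy l (\<lambda>z. fc (fst z) * (yl k z / al z * snd z $ i + al z * axis k 1 $ i)) z"
    by (rule dd_cong[OF open_Z0 z]) (rule dy_Dp)
  also have "\<dots> = dy l (\<lambda>z. fc (fst z)) z * (yl k z / al z * snd z $ i + al z * axis k 1 $ i)
     + fc (fst z) * ((dy l (yl k) z / al z - yl k z * dy l al z / (al z)\<^sup>2) * snd z $ i
        + yl k z / al z * dy l (\<lambda>z. snd z $ i) z + dy l al z * axis k 1 $ i)"
    by (rule dd_eqI[THEN trans])
       (use al_pos[OF z] in \<open>auto intro!: derivative_eq_intros hd_al[OF z] hd_\<Omega>[OF sm_base[OF sm_fc] S] hd_snd hd_\<Omega>[OF sm_yl S]
          simp: field_simps eval_nat_numeral\<close>)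
  finally show ?thesis
    using al_pos[OF z] by (simp add: dy_base[OF sm_fc S] dy_yl[OF S] dy_al[OF z] field_simps eval_nat_numeral)
qed

text \<open>The effect on the Riemann tensor of a projective change of the spray with factor p = f
  \<alpha>: the identity is multiplied by p^2 - p_|0. Since \<alpha> is horizontally constant, only
  f contributes to the covariant derivative of p.\<close>

lemma Rm_G_Dp: assumes z: "z \<in> Z0"
  shows "Rm (\<lambda>i z. G i z + Dp i z) i k z = Rm G i k z
    + ((fc (fst z))\<^sup>2 * Aq z - f0 z * al z) * axis k 1 $ i
    + snd z $ i * (2 * partial k fc (fst z) * al z - f0 z * yl k z / al z - (fc (fst z))\<^sup>2 * yl k z)"
proof -
  have S: "fst z \<in> S" using z by (rule Z0_S)
  have al: "al z > 0" using al_pos[OF z] .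
  have 1: "dy k (nab0 Dp i) z = (partial k fc (fst z) * al z + f0 z * yl k z / al z) * snd z $ i + f0 z * al z * axis k 1 $ i"
  proof -
    have "dy k (nab0 Dp i) z = dy k (\<lambda>z. f0 z * al z * snd z $ i) z"
      by (rule dd_cong[OF open_Z0 z]) (rule nab0_Dp)
    moreover have "dd v (\<lambda>z. f0 z * al z * snd z $ i) z
        = (dd v f0 z * al z + f0 z * dd v al z) * snd z $ i + f0 z * al z * dd v (\<lambda>z. snd z $ i) z" for v
      by (rule dd_eqI[THEN trans])
         (auto intro!: derivative_eq_intros hd_al[OF z] hd_\<Omega>[OF sm_f0 S] hd_snd simp: algebra_simps)
    ultimately show ?thesis by (simp add: dy_f0[OF S] dy_al[OF z])
  qed
  have Ayy: "(\<Sum>l\<in>UNIV. snd z $ l * a (fst z) $ k $ l) = yl k z" by (simp add: yl_def mult.commute)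
  have yy: "(\<Sum>l\<in>UNIV. snd z $ l * yl l z) = (al z)\<^sup>2" by (simp add: al_sq[OF z] Aq_def)
  have 2: "(\<Sum>l\<in>UNIV. Dp l z * dy l (dy k (Dp i)) z) = (fc (fst z))\<^sup>2 * (yl k z * snd z $ i + Aq z * axis k 1 $ i)"
  proof -
    have "(\<Sum>l\<in>UNIV. Dp l z * dy l (dy k (Dp i)) z) = (fc (fst z))\<^sup>2 * al z *
       (((\<Sum>l\<in>UNIV. snd z $ l * a (fst z) $ k $ l) / al z - yl k z * (\<Sum>l\<in>UNIV. snd z $ l * yl l z) / al z ^ 3) * snd z $ i
         + yl k z / al z * (\<Sum>l\<in>UNIV. snd z $ l * axis l 1 $ i) + (\<Sum>l\<in>UNIV. snd z $ l * yl l z) / al z * axis k 1 $ i)"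
      unfolding dy_dy_Dp[OF z] unfolding Dp_def using al
      by (simp only: sum_distrib_left sum_distrib_right sum_divide_distrib sum.distrib[symmetric] sum_subtractf[symmetric])
         (intro sum.cong refl, simp add: field_simps eval_nat_numeral)
    also have "\<dots> = (fc (fst z))\<^sup>2 * (yl k z * snd z $ i + Aq z * axis k 1 $ i)"
      unfolding Ayy yy al_sq[OF z, symmetric] using al by (simp add: field_simps eval_nat_numeral)
    finally show ?thesis .
  qed
  have 3: "(\<Sum>l\<in>UNIV. dy l (Dp i) z * dy k (Dp l) z) = (fc (fst z))\<^sup>2 * (3 * yl k z * snd z $ i + Aq z * axis k 1 $ i)"
  proof -
    have "(\<Sum>l\<in>UNIV. dy l (Dp i) z * dy k (Dp l) z) = (fc (fst z))\<^sup>2 *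
       ((\<Sum>l\<in>UNIV. snd z $ l * yl l z) * snd z $ i * yl k z / (al z)\<^sup>2 + snd z $ i * (\<Sum>l\<in>UNIV. yl l z * axis k 1 $ l)
         + yl k z * (\<Sum>l\<in>UNIV. snd z $ l * axis l 1 $ i) + (al z)\<^sup>2 * (\<Sum>l\<in>UNIV. axis l 1 $ i * axis k 1 $ l))"
      unfolding dy_Dp[OF z] using al
      by (simp only: sum_distrib_left sum_distrib_right sum_divide_distrib sum.distrib[symmetric])
         (simp add: field_simps eval_nat_numeral)
    then show ?thesis unfolding yy using al by (simp add: al_sq[OF z, symmetric] algebra_simps)
  qed
  show ?thesis
    unfolding Rm_add[OF open_Z0 Z0_\<Omega> z sm_Dp] nab_Dp[OF z] 1 2 3 by (simp add: algebra_simps)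
qed

definition RicG :: "real^'n \<Rightarrow> real^'n \<Rightarrow> real" where "RicG x y = (\<Sum>m\<in>UNIV. Rm G m m (x, y))"

lemma quad_RicG: "x \<in> S \<Longrightarrow> quad (RicG x)"
  unfolding RicG_def by (intro quad_sum quad_Rm_G)

lemma ricci_Fa: "(x, y) \<in> Z0 \<Longrightarrow> ricci Fa x y = RicG x y"
  by (simp add: ricci_def RicG_def riemann_Fa)

lemma Fs_sq_eq: "(Fs x y)\<^sup>2 = r (x, y) ^ 4 / (al (x, y))\<^sup>2"
  using Fs_sq[of x y] by (simp add: P_def)

lemma Zs_Z0: "z \<in> Zs \<Longrightarrow> z \<in> Z0" using Zs_Zd Zd_Z0 by auto

context
  assumes s_0: "\<And>x i j. x \<in> S \<Longrightarrow> s i j x = 0"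
begin

lemma H_closed: assumes z: "z \<in> Zd" shows "H i z = G i z + Dp i z"
proof -
  have S: "fst z \<in> S" using z Zd_Z0 Z0_S by blast
  have 0: "sl k (fst z) = 0" "T i k (fst z) = 0" for k i
    by (simp_all add: sl_def T_def s_0[OF S])
  show ?thesis
    by (simp add: H_def D_def Dp_def t_def su_def s0_def pf_def uf_def 0 fc_def bl_def)
qed

lemma Rm_closed: assumes z: "z \<in> Zs"
  shows "Rm H i k z = Rm G i k z
    + ((fc (fst z))\<^sup>2 * Aq z - f0 z * al z) * axis k 1 $ i
    + snd z $ i * (2 * partial k fc (fst z) * al z - f0 z * yl k z / al z - (fc (fst z))\<^sup>2 * yl k z)"
proof -
  have zd: "z \<in> Zd" using z Zs_Zd by blast
  have "Rm H i k z = Rm (\<lambda>i z. G i z + Dp i z) i k z"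
    by (rule Rm_cong[OF open_Zd zd]) (rule H_closed)
  then show ?thesis using Rm_G_Dp[OF Zs_Z0[OF z]] by simp
qed

lemma Rm_closed_const:
  assumes z: "z \<in> Zs" and f: "\<And>k. partial k fc (fst z) = 0"
  shows "Rm H i k z = Rm G i k z + (fc (fst z))\<^sup>2 * (Aq z * (if i = k then 1 else 0) - snd z $ i * yl k z)"
  unfolding Rm_closed[OF z] by (simp add: f f0_def axis_def algebra_simps)

text \<open>In the trace the term along y contributes minus the factor of the identity, which turns
  n into n - 1.\<close>

lemma ricci_closed: assumes z: "(x, y) \<in> Zs"
  shows "ricci Fs x y = RicG x y + (real CARD('n) - 1) * ((fc x)\<^sup>2 * Aq (x, y) - f0 (x, y) * al (x, y))"
proof -
  have al: "al (x, y) > 0" using al_pos[OF Zs_Z0[OF z]] .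
  have 1: "(\<Sum>m\<in>UNIV. y $ m * yl m (x, y)) = al (x, y) * al (x, y)"
    using al_sq[OF Zs_Z0[OF z]] by (simp add: Aq_def power2_eq_square)
  have 2: "(\<Sum>m\<in>UNIV. partial m fc x * y $ m) = f0 (x, y)" by (simp add: f0_def)
  have "ricci Fs x y = RicG x y + (\<Sum>m::'n\<in>UNIV. (fc x)\<^sup>2 * Aq (x, y) - f0 (x, y) * al (x, y))
     + (2 * al (x, y) * (\<Sum>m\<in>UNIV. partial m fc x * y $ m)
        - f0 (x, y) / al (x, y) * (\<Sum>m\<in>UNIV. y $ m * yl m (x, y)) - (fc x)\<^sup>2 * (\<Sum>m\<in>UNIV. y $ m * yl m (x, y)))"
    unfolding ricci_def riemann_Fs[OF z] Rm_closed[OF z] RicG_def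
    by (simp add: axis_def sum.distrib right_diff_distrib distrib_left sum_subtractf sum_distrib_left sum_divide_distrib mult_ac)
  also have "\<dots> = RicG x y + (real CARD('n) - 1) * ((fc x)\<^sup>2 * Aq (x, y) - f0 (x, y) * al (x, y))"
    unfolding 1 2 al_sq[OF Zs_Z0[OF z], symmetric] using al by (simp add: power2_eq_square algebra_simps)
  finally show ?thesis .
qed

text \<open>The odd part says that the polynomial \<alpha>^2 divides K \<beta> (b^2 \<alpha>^2 +
  \<beta>^2), hence K \<beta>^3, which a positive definite form cannot do unless K = 0. The proof
  tests this divisibility on lines p b + w.\<close>

lemma ricci_const_closed:
  assumes x: "x \<in> S" and K: "\<And>y. (x, y) \<in> Zs \<Longrightarrow> ricci Fs x y = (real CARD('n) - 1) * K * (Fs x y)\<^sup>2"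
  shows "K = 0" "partial k fc x = 0" "RicG x y = - (real CARD('n) - 1) * (fc x)\<^sup>2 * Aq (x, y)"
proof -
  let ?b = "bl (x, 0)"
  have b: "bl (x, y) = ?b" for y by (simp add: bl_def)
  have bpos: "?b > 0" using bl_pos[of "(x, 0)"] x by simp
  have b2: "?b\<^sup>2 = B x" using bl_sq[of "(x, 0)"] x by simp
  have n: "real CARD('n) - 1 > 0" using card3 by simp
  have neg: "(x, - y) \<in> Zs" if "(x, y) \<in> Zs" for y
  proof -
    have "Aq (x, - y) = Aq (x, y)" using quad_uminus[OF quad_Aq] .
    then show ?thesis using that unfolding Zs_iff by (simp add: be_uminus Z0_def)
  qed
  have half: "X = m * Q / A" if "2 * X = m * ((2 * Q) / A)" for X m Q A :: real
  proof -
    have "m * ((2 * Q) / A) = 2 * (m * Q / A)" by (simp add: field_simps)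
    with that show ?thesis by linarith
  qed
  \<comment> \<open>Passing from y to -y keeps \<alpha> and reverses \<beta> and f_0, so r turns
    into \<Delta>; the difference and the sum of the two equations give the two parts.\<close>
  have odd: "f0 (x, y) * Aq (x, y) = - 4 * K * ?b * be (x, y) * (B x * Aq (x, y) + (be (x, y))\<^sup>2)"
    and even: "RicG x y + (real CARD('n) - 1) * (fc x)\<^sup>2 * Aq (x, y)
       = (real CARD('n) - 1) * K * ((B x)\<^sup>2 * (Aq (x, y))\<^sup>2 + 6 * B x * Aq (x, y) * (be (x, y))\<^sup>2 + be (x, y) ^ 4) / Aq (x, y)"
    if y: "(x, y) \<in> Zs" for y
  proof -
    have al: "al (x, y) > 0" using al_pos[OF Zs_Z0[OF y]] .
    have A2: "Aq (x, y) = (al (x, y))\<^sup>2" using al_sq[OF Zs_Z0[OF y]] by simp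
    have A: "Aq (x, - y) = Aq (x, y)" using quad_uminus[OF quad_Aq] .
    have aln: "al (x, - y) = al (x, y)" by (simp add: al_def A)
    have f0n: "f0 (x, - y) = - f0 (x, y)" by (simp add: f0_def sum_negf)
    let ?n = "real CARD('n) - 1" and ?al = "al (x, y)" and ?be = "be (x, y)"
    have 1: "RicG x y + ?n * ((fc x)\<^sup>2 * Aq (x, y) - f0 (x, y) * ?al) = ?n * K * ((?b * ?al + ?be) ^ 4 / ?al\<^sup>2)"
      using K[OF y] unfolding ricci_closed[OF y] Fs_sq_eq r_def b[of y] .
    have 2: "RicG x y + ?n * ((fc x)\<^sup>2 * Aq (x, y) + f0 (x, y) * ?al) = ?n * K * ((?b * ?al - ?be) ^ 4 / ?al\<^sup>2)"
      using K[OF neg[OF y]] unfolding ricci_closed[OF neg[OF y]] Fs_sq_eq r_def b[of "- y"] A aln f0n be_uminus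
      by (simp add: quad_uminus[OF quad_RicG[OF x]])
    have "?n * (f0 (x, y) * ?al * 2) = ?n * (K * ((?b * ?al - ?be) ^ 4 / ?al\<^sup>2) - K * ((?b * ?al + ?be) ^ 4 / ?al\<^sup>2))"
      using 1 2 by (simp add: algebra_simps)
    then have "f0 (x, y) * ?al * 2 = K * ((?b * ?al - ?be) ^ 4 / ?al\<^sup>2) - K * ((?b * ?al + ?be) ^ 4 / ?al\<^sup>2)"
      using n by simp
    then have "2 * ?al * (f0 (x, y) * ?al\<^sup>2) = K * ((?b * ?al - ?be) ^ 4 - (?b * ?al + ?be) ^ 4)"
      using al by (simp add: field_simps)
    also have "\<dots> = 2 * ?al * (- 4 * K * ?b * ?be * (?b\<^sup>2 * ?al\<^sup>2 + ?be\<^sup>2))"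
      by (simp add: algebra_simps eval_nat_numeral)
    finally have "f0 (x, y) * ?al\<^sup>2 = - 4 * K * ?b * ?be * (?b\<^sup>2 * ?al\<^sup>2 + ?be\<^sup>2)"
      by (subst (asm) mult_cancel_left) (use al in simp)
    then show "f0 (x, y) * Aq (x, y) = - 4 * K * ?b * be (x, y) * (B x * Aq (x, y) + (be (x, y))\<^sup>2)"
      unfolding b2 A2 .
    have "2 * (RicG x y + ?n * (fc x)\<^sup>2 * Aq (x, y)) = ?n * K * (((?b * ?al + ?be) ^ 4 + (?b * ?al - ?be) ^ 4) / ?al\<^sup>2)"
      using 1 2 by (simp add: algebra_simps add_divide_distrib)
    also have "(?b * ?al + ?be) ^ 4 + (?b * ?al - ?be) ^ 4 = 2 * ((?b\<^sup>2)\<^sup>2 * (?al\<^sup>2)\<^sup>2 + 6 * ?b\<^sup>2 * ?al\<^sup>2 * ?be\<^sup>2 + ?be ^ 4)"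
      by (simp add: algebra_simps eval_nat_numeral)
    finally show "RicG x y + ?n * (fc x)\<^sup>2 * Aq (x, y)
       = ?n * K * ((B x)\<^sup>2 * (Aq (x, y))\<^sup>2 + 6 * B x * Aq (x, y) * (be (x, y))\<^sup>2 + be (x, y) ^ 4) / Aq (x, y)"
      unfolding b2 A2 by (rule half)
  qed
  have f0_lin: "f0 (x, p *\<^sub>R u + v) = p * f0 (x, u) + f0 (x, v)" for p u v
    by (simp add: f0_def algebra_simps sum.distrib sum_distrib_left)
  have main: "f0 (x, w) = 0 \<and> f0 (x, Bu x) = 0 \<and> K = 0" if w: "w \<noteq> 0" "be (x, w) = 0" for w
  proof -
    have W: "Aq (x, w) > 0" using Aq_pos[of "(x, w)"] x w by simp
    have e: "(p * f0 (x, Bu x) + f0 (x, w)) * (p\<^sup>2 * B x + Aq (x, w))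
       = - 4 * K * ?b * (p * B x) * (B x * (p\<^sup>2 * B x + Aq (x, w)) + (p * B x)\<^sup>2)" for p
      using odd[OF comb_in_Zs[OF x w, of p]] by (simp add: f0_lin be_comb Aq_comb[OF x] w)
    have fw: "f0 (x, w) = 0" using e[of 0] W by simp
    let ?\<phi> = "f0 (x, Bu x)" and ?k = "4 * K * ?b * B x"
    \<comment> \<open>\<open>e\<close> is polynomial in p, and two values suffice: the cases p = 1
      and p = 2 together determine \<open>?\<phi>\<close>, and \<open>e1\<close> then forces K =
      0.\<close>
    have e1: "?\<phi> * (B x + Aq (x, w)) = - ?k * (B x * (2 * B x + Aq (x, w)))"
      using e[of 1] by (simp add: fw algebra_simps power2_eq_square)
    have e2: "?\<phi> * (4 * B x + Aq (x, w)) = - ?k * (B x * (8 * B x + Aq (x, w)))"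
      using e[of 2] by (simp add: fw algebra_simps power2_eq_square)
    have "3 * B x * ?\<phi> = 3 * B x * (- 2 * ?k * B x)" using e1 e2 by (simp add: algebra_simps)
    then have ph: "?\<phi> = - 2 * ?k * B x" by (subst (asm) mult_cancel_left) (use B_pos[OF x] in simp)
    have "?k * (B x * Aq (x, w)) = 0" using e1 unfolding ph by (simp add: algebra_simps)
    then have "K = 0" using B_pos[OF x] W bpos by simp
    with ph fw show ?thesis by simp
  qed
  obtain w where w: "w \<noteq> 0" "be (x, w) = 0" using exists_orth .
  show K0: "K = 0" using main[OF w] by simp
  have "f0 (x, v) = 0" for v
  proof -
    obtain p u where v: "v = p *\<^sub>R Bu x + u" "be (x, u) = 0" using decompose[OF x] .
    show ?thesis
    proof (cases "u = 0")
      case True then show ?thesis using v main[OF w] f0_lin[of p "Bu x" 0] by (simp add: f0_def)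
    next
      case False then show ?thesis using v main[OF False v(2)] f0_lin[of p "Bu x" u] by simp
    qed
  qed
  from this[of "axis k 1"] show "partial k fc x = 0" by (simp add: f0_def)
  have "RicG x y + (real CARD('n) - 1) * (fc x)\<^sup>2 * Aq (x, y) = 0"
    by (rule quad_extend[OF x, of "\<lambda>y. RicG x y + (real CARD('n) - 1) * (fc x)\<^sup>2 * Aq (x, y)"])
       (use even K0 in \<open>auto intro!: quad_add quad_cmult quad_RicG x quad_Aq\<close>)
  then show "RicG x y = - (real CARD('n) - 1) * (fc x)\<^sup>2 * Aq (x, y)" by (simp add: algebra_simps)
qed

text \<open>For fixed x both sides are quadratic in y, so \<open>quad_extend\<close> reaches the
  directions in which F degenerates.\<close>

lemma flag_closed:
  assumes x: "x \<in> S" and f: "\<And>k. partial k fc x = 0"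
    and 0: "\<And>y. (x, y) \<in> Zs \<Longrightarrow> riemann Fs x y $ i $ k = 0"
  shows "Rm G i k (x, y) = - (fc x)\<^sup>2 * (Aq (x, y) * (if i = k then 1 else 0) - y $ i * yl k (x, y))"
proof -
  have "Rm G i k (x, y) + (fc x)\<^sup>2 * ((if i = k then 1 else 0) * Aq (x, y) - y $ i * yl k (x, y)) = 0"
  proof (rule quad_extend[OF x, of "\<lambda>y. Rm G i k (x, y) + (fc x)\<^sup>2 * ((if i = k then 1 else 0) * Aq (x, y) - y $ i * yl k (x, y))"])
    show "quad (\<lambda>y. Rm G i k (x, y) + (fc x)\<^sup>2 * ((if i = k then 1 else 0) * Aq (x, y) - y $ i * yl k (x, y)))"
      by (intro quad_add quad_cmult quad_diff quad_Rm_G x quad_Aq quad_nth_yl)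
    fix y assume y: "(x, y) \<in> Zs"
    show "Rm G i k (x, y) + (fc x)\<^sup>2 * ((if i = k then 1 else 0) * Aq (x, y) - y $ i * yl k (x, y)) = 0"
      using 0[OF y] unfolding riemann_Fs[OF y] using Rm_closed_const[OF y, of i k] f by (simp add: mult.commute)
  qed
  then show ?thesis by (simp add: mult.commute)
qed

end

end

context sq_chart
begin

context
  assumes c_0: "\<And>x. x \<in> S \<Longrightarrow> c x = 0" and sl_0: "\<And>x k. x \<in> S \<Longrightarrow> sl k x = 0"
begin

section \<open>Killing forms of constant length\<close>

lemma cov_s: "x \<in> S \<Longrightarrow> cov_deriv a b x i j = s i j x" by (simp add: cov_eq c_0)

lemma trace_T: assumes x: "x \<in> S" shows "(\<Sum>i\<in>UNIV. T i i x) = 0"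
proof -
  have "(\<Sum>i\<in>UNIV. T i i x) = (\<Sum>i\<in>UNIV. \<Sum>l\<in>UNIV. ai x i l * s l i x)" by (simp add: T_def)
  also have "\<dots> = (\<Sum>l\<in>UNIV. \<Sum>i\<in>UNIV. ai x i l * s l i x)" by (rule sum.swap)
  also have "\<dots> = - (\<Sum>l\<in>UNIV. \<Sum>i\<in>UNIV. ai x l i * s i l x)"
    unfolding sum_negf[symmetric] by (intro sum.cong refl) (subst s_anti, simp add: ai_sym[OF x])
  also have "\<dots> = - (\<Sum>i\<in>UNIV. T i i x)" by (simp add: T_def)
  finally show ?thesis by simp
qed

lemma T_bu: "x \<in> S \<Longrightarrow> (\<Sum>j\<in>UNIV. T i j x * bu j x) = 0"
  by (simp add: T_bu_general su_def sl_0)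

lemma b_T: assumes x: "x \<in> S" shows "(\<Sum>l\<in>UNIV. b x $ l * T l i x) = 0"
proof -
  have "(\<Sum>l\<in>UNIV. b x $ l * T l i x) = (\<Sum>k\<in>UNIV. bu k x * s k i x)" unfolding T_def by (rule raise_b[OF x])
  then show ?thesis using sl_0[OF x, of i] by (simp add: sl_def)
qed

lemma yl_T: assumes z: "fst z \<in> S" shows "(\<Sum>l\<in>UNIV. yl l z * T l i (fst z)) = - sy i z"
proof -
  have "(\<Sum>l\<in>UNIV. yl l z * T l i (fst z)) = (\<Sum>k\<in>UNIV. snd z $ k * s k i (fst z))" unfolding T_def by (rule raise_yl[OF z])
  also have "\<dots> = - sy i z" unfolding sy_def sum_negf[symmetric] by (intro sum.cong refl) (subst s_anti, simp)
  finally show ?thesis .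
qed

lemma s0_0: "fst z \<in> S \<Longrightarrow> s0 z = 0" by (simp add: s0_def sl_0)

text \<open>By metric compatibility, lowering an index commutes with covariant differentiation. The
  claim is therefore checked with its index lowered, where it is \<open>cov_s\<close>, and the index
  is raised again.\<close>

lemma nabla_bu:
  assumes x: "x \<in> S"
  shows "partial i (bu m) x + (\<Sum>j\<in>UNIV. Gam m i j x * bu j x) = T m i x"
proof -
  let ?V = "\<lambda>m. partial i (bu m) x + (\<Sum>j\<in>UNIV. Gam m i j x * bu j x)"
  note d = sm_differentiable[OF sm_bu x] sm_differentiable[OF sm_a x]
  have lower: "(\<Sum>m\<in>UNIV. a x $ l $ m * ?V m) = s l i x" for l
  proof -
    have 1: "partial i (\<lambda>u. b u $ l) x = (\<Sum>j\<in>UNIV. a x $ l $ j * partial i (bu j) x) + (\<Sum>j\<in>UNIV. da i l j x * bu j x)"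
    proof -
      have "partial i (\<lambda>u. b u $ l) x = partial i (\<lambda>x. \<Sum>j\<in>UNIV. a x $ l $ j * bu j x) x"
        by (rule partial_cong[OF open_S x]) (simp add: a_bu)
      then show ?thesis
        unfolding partial_eq_dd by (subst (asm) dd_sum) (auto simp: dd_mult d sum.distrib intro!: differentiable_mult d)
    qed
    have 2: "(\<Sum>j\<in>UNIV. da i l j x * bu j x)
       = (\<Sum>j\<in>UNIV. \<Sum>m\<in>UNIV. a x $ l $ m * (Gam m i j x * bu j x)) + (\<Sum>j\<in>UNIV. \<Sum>m\<in>UNIV. Gam m i l x * (a x $ m $ j * bu j x))"
      unfolding da_eq[OF x] using sym_a[OF x] by (simp add: distrib_left sum.distrib sum_distrib_left mult_ac)
    have 3: "(\<Sum>j\<in>UNIV. \<Sum>m\<in>UNIV. a x $ l $ m * (Gam m i j x * bu j x)) = (\<Sum>m\<in>UNIV. a x $ l $ m * (\<Sum>j\<in>UNIV. Gam m i j x * bu j x))"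
      by (subst sum.swap) (simp add: sum_distrib_left)
    have 4: "(\<Sum>j\<in>UNIV. \<Sum>m\<in>UNIV. Gam m i l x * (a x $ m $ j * bu j x)) = (\<Sum>m\<in>UNIV. Gam m l i x * b x $ m)"
      by (subst sum.swap) (simp add: a_bu[OF x] Gam_sym[OF x, of _ l i] flip: sum_distrib_left)
    show ?thesis
      using 1 unfolding 2 3 4 cov_s[OF x, symmetric] cov_deriv_def by (simp add: distrib_left sum.distrib)
  qed
  have "T m i x = (\<Sum>l\<in>UNIV. \<Sum>k\<in>UNIV. ai x m l * (a x $ l $ k * ?V k))"
    unfolding T_def lower[symmetric] by (simp add: sum_distrib_left)
  also have "\<dots> = (\<Sum>k\<in>UNIV. (\<Sum>l\<in>UNIV. ai x m l * a x $ l $ k) * ?V k)"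
    by (subst sum.swap) (simp only: sum_distrib_right mult.assoc)
  also have "\<dots> = ?V m" by (simp only: ai_a[OF x] if_distrib[of "\<lambda>c. c * _"] mult_1 mult_zero_left) simp
  finally show ?thesis ..
qed

text \<open>\<open>Tc i j k\<close> is \<open>\<nabla>\<^sub>k T\<^sup>i\<^sub>j\<close>.\<close>

definition Tc :: "'n \<Rightarrow> 'n \<Rightarrow> 'n \<Rightarrow> real^'n \<Rightarrow> real" where
  "Tc i j k x = partial k (T i j) x + (\<Sum>m\<in>UNIV. Gam i k m x * T m j x) - (\<Sum>m\<in>UNIV. Gam m k j x * T i m x)"
text \<open>\<open>kap\<close> is the divergence of s^i_j contracted with y, \<open>trT2\<close> the
  trace of the square of s^i_j, and \<open>t2\<close> the squared length of s^i_0.\<close>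

definition kap :: "'n tangent \<Rightarrow> real" where
  "kap z = (\<Sum>j\<in>UNIV. (\<Sum>i\<in>UNIV. Tc i j i (fst z)) * snd z $ j)"
definition trT2 :: "real^'n \<Rightarrow> real" where "trT2 x = (\<Sum>i\<in>UNIV. \<Sum>l\<in>UNIV. T i l x * T l i x)"
definition t2 :: "'n tangent \<Rightarrow> real" where "t2 z = (\<Sum>i\<in>UNIV. sy i z * t i z)"

lemma sm_Tc: "sm S (Tc i j k)"
  unfolding Tc_def partial_eq_dd by (intro sm_diff sm_add sm_sum sm_mult open_S sm_dd sm_T sm_Gam)

lemma nab_t: assumes z: "fst z \<in> S" shows "nab k t i z = (\<Sum>j\<in>UNIV. Tc i j k (fst z) * snd z $ j)"
proof -
  have 1: "hor k (t i) z = (\<Sum>j\<in>UNIV. partial k (T i j) (fst z) * snd z $ j) - (\<Sum>m\<in>UNIV. T i m (fst z) * N m k z)"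
    unfolding hlift_def t_def by (subst dd_lin_comb_base[OF sm_T z]) (simp add: partial_eq_dd sum_negf)
  have 2: "(\<Sum>m\<in>UNIV. T i m (fst z) * N m k z) = (\<Sum>j\<in>UNIV. (\<Sum>m\<in>UNIV. Gam m k j (fst z) * T i m (fst z)) * snd z $ j)"
    unfolding N_def by (simp add: sum_ac) (rule sum.swap)
  have 3: "(\<Sum>m\<in>UNIV. Gam i k m (fst z) * t m z) = (\<Sum>j\<in>UNIV. (\<Sum>m\<in>UNIV. Gam i k m (fst z) * T m j (fst z)) * snd z $ j)"
    unfolding t_def by (simp add: sum_ac) (rule sum.swap)
  show ?thesis unfolding nab_def 1 2 3 Tc_def by (simp add: algebra_simps sum.distrib sum_subtractf)
qed

lemma nab0_t: assumes z: "fst z \<in> S" shows "nab0 t i z = (\<Sum>k\<in>UNIV. \<Sum>j\<in>UNIV. Tc i j k (fst z) * snd z $ j * snd z $ k)"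
proof -
  have z': "z \<in> \<Omega>" using z by (cases z) auto
  note d = sm_differentiable[OF sm_t z']
  have "nab0 t i z = (\<Sum>k\<in>UNIV. nab k t i z * snd z $ k)"
  proof -
    have 1: "(\<Sum>k\<in>UNIV. (\<Sum>m\<in>UNIV. N m k z * dy m (t i) z) * snd z $ k) = 2 * (\<Sum>m\<in>UNIV. G m z * dy m (t i) z)"
      unfolding G_eq_N by (simp add: sum_ac) (rule sum.swap)
    have 2: "(\<Sum>k\<in>UNIV. (\<Sum>m\<in>UNIV. Gam i k m (fst z) * t m z) * snd z $ k) = (\<Sum>m\<in>UNIV. N i m z * t m z)"
    proof -
      have "(\<Sum>k\<in>UNIV. (\<Sum>m\<in>UNIV. Gam i k m (fst z) * t m z) * snd z $ k)
          = (\<Sum>k\<in>UNIV. \<Sum>m\<in>UNIV. Gam i m k (fst z) * snd z $ k * t m z)"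
        unfolding sum_distrib_right by (intro sum.cong refl) (use Gam_sym[OF z] in simp)
      also have "\<dots> = (\<Sum>m\<in>UNIV. N i m z * t m z)"
        unfolding N_def sum_distrib_right by (rule sum.swap)
      finally show ?thesis .
    qed
    show ?thesis
      unfolding nab0_def nab_def xi_eq[OF d] hor_eq[OF d]
      by (simp only: distrib_right left_diff_distrib sum.distrib sum_subtractf 1 2) (simp add: mult.commute)
  qed
  then show ?thesis unfolding nab_t[OF z] by (simp add: sum_distrib_right)
qed

lemma sm_nab0_t: "sm \<Omega> (nab0 t i)"
proof (rule sm_cong[OF open_\<Omega>])
  show "sm \<Omega> (\<lambda>z. \<Sum>k\<in>UNIV. \<Sum>j\<in>UNIV. Tc i j k (fst z) * snd z $ j * snd z $ k)"
    by (intro sm_sum sm_mult open_\<Omega> sm_base[OF sm_Tc] sm_snd_nth)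
qed (simp add: nab0_t mem_Times_iff)

text \<open>The Christoffel terms cancel in the trace, and the trace of T is identically
  zero.\<close>

lemma trace_Tc: assumes x: "x \<in> S" shows "(\<Sum>i\<in>UNIV. Tc i i k x) = 0"
proof -
  have "(\<Sum>i\<in>UNIV. partial k (T i i) x) = partial k (\<lambda>x. \<Sum>i\<in>UNIV. T i i x) x"
    unfolding partial_eq_dd by (rule dd_sum[symmetric]) (rule sm_differentiable[OF sm_T x])
  also have "\<dots> = partial k (\<lambda>x. 0) x" by (rule partial_cong[OF open_S x]) (rule trace_T)
  finally have 1: "(\<Sum>i\<in>UNIV. partial k (T i i) x) = 0" by (simp add: partial_eq_dd)
  have 2: "(\<Sum>i\<in>UNIV. \<Sum>m\<in>UNIV. Gam i k m x * T m i x) = (\<Sum>i\<in>UNIV. \<Sum>m\<in>UNIV. Gam m k i x * T i m x)"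
    by (rule sum.swap)
  show ?thesis unfolding Tc_def by (simp add: sum.distrib sum_subtractf 1 2)
qed

lemma div_nab_t: "fst z \<in> S \<Longrightarrow> (\<Sum>i\<in>UNIV. nab i t i z) = kap z"
  unfolding kap_def by (simp add: nab_t sum_distrib_right) (rule sum.swap)

text \<open>Differentiating y^j y^k gives two terms; one contains the covariant derivative of the
  trace of T and vanishes by \<open>trace_Tc\<close>, the other is the divergence.\<close>

lemma div_nab0_t: assumes z: "fst z \<in> S" shows "(\<Sum>i\<in>UNIV. dy i (nab0 t i) z) = kap z"
proof -
  have z': "z \<in> \<Omega>" using z by (cases z) auto
  have 1: "dy l (nab0 t i) z = (\<Sum>k\<in>UNIV. Tc i l k (fst z) * snd z $ k) + (\<Sum>j\<in>UNIV. Tc i j l (fst z) * snd z $ j)" for l i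
  proof -
    have d: "(\<lambda>z. Tc i j k (fst z)) differentiable at z" "(\<lambda>z. snd z $ j) differentiable at z" for j k
      using sm_differentiable[OF sm_base[OF sm_Tc] z'] sm_differentiable[OF sm_snd_nth z'] by blast+
    have "dy l (nab0 t i) z = dy l (\<lambda>z. \<Sum>k\<in>UNIV. \<Sum>j\<in>UNIV. Tc i j k (fst z) * snd z $ j * snd z $ k) z"
      by (rule dd_cong[OF open_\<Omega> z']) (simp add: nab0_t mem_Times_iff)
    also have "\<dots> = (\<Sum>k\<in>UNIV. \<Sum>j\<in>UNIV. dy l (\<lambda>z. Tc i j k (fst z) * snd z $ j * snd z $ k) z)"
      by (subst dd_sum, auto intro!: differentiable_sum differentiable_mult d, rule sum.cong, simp, subst dd_sum)
         (auto intro!: differentiable_mult d)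
    also have "\<dots> = (\<Sum>k\<in>UNIV. \<Sum>j\<in>UNIV. Tc i j k (fst z) * snd z $ j * axis l 1 $ k + Tc i j k (fst z) * axis l 1 $ j * snd z $ k)"
      by (simp add: dd_mult d differentiable_mult dy_base[OF sm_Tc z] algebra_simps)
    also have "\<dots> = (\<Sum>k\<in>UNIV. (\<Sum>j\<in>UNIV. Tc i j k (fst z) * snd z $ j) * axis l 1 $ k) + (\<Sum>k\<in>UNIV. (\<Sum>j\<in>UNIV. Tc i j k (fst z) * axis l 1 $ j) * snd z $ k)"
      by (simp only: sum.distrib sum_distrib_right)
    finally show ?thesis by simp
  qed
  have 2: "(\<Sum>i\<in>UNIV. \<Sum>k\<in>UNIV. Tc i i k (fst z) * snd z $ k) = 0"
    by (subst sum.swap) (simp add: trace_Tc[OF z] flip: sum_distrib_right)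
  have 3: "(\<Sum>i\<in>UNIV. \<Sum>j\<in>UNIV. Tc i j i (fst z) * snd z $ j) = kap z"
    unfolding kap_def sum_distrib_right by (rule sum.swap)
  show ?thesis unfolding 1 by (simp add: sum.distrib 2 3)
qed

text \<open>Differentiating T^i_j b^j = 0 gives (\<nabla>_k T^i_j) b^j = - T^i_j \<nabla>_k b^j = -
  T^i_j T^j_k. At the direction b this trades the second derivatives of \<beta> for first
  ones.\<close>

lemma kap_Bu: assumes x: "x \<in> S" shows "kap (x, Bu x) = - trT2 x"
proof -
  have 1: "(\<Sum>j\<in>UNIV. partial k (T i j) x * bu j x) = - (\<Sum>j\<in>UNIV. T i j x * partial k (bu j) x)" for i k
  proof -
    note d = sm_differentiable[OF sm_T x] sm_differentiable[OF sm_bu x]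
    have "(\<Sum>j\<in>UNIV. T i j x * partial k (bu j) x + partial k (T i j) x * bu j x) = partial k (\<lambda>x. \<Sum>j\<in>UNIV. T i j x * bu j x) x"
      unfolding partial_eq_dd by (subst dd_sum) (auto simp: dd_mult d intro!: differentiable_mult d)
    also have "\<dots> = partial k (\<lambda>x. 0) x" by (rule partial_cong[OF open_S x]) (rule T_bu)
    finally show ?thesis by (simp add: partial_eq_dd sum.distrib)
  qed
  have 2: "(\<Sum>j\<in>UNIV. (\<Sum>m\<in>UNIV. Gam i k m x * T m j x) * bu j x) = 0" for i k
  proof -
    have "(\<Sum>j\<in>UNIV. (\<Sum>m\<in>UNIV. Gam i k m x * T m j x) * bu j x) = (\<Sum>m\<in>UNIV. Gam i k m x * (\<Sum>j\<in>UNIV. T m j x * bu j x))"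
      by (simp add: sum_ac) (rule sum.swap)
    then show ?thesis by (simp add: T_bu[OF x])
  qed
  have 3: "(\<Sum>j\<in>UNIV. (\<Sum>m\<in>UNIV. Gam m k j x * T i m x) * bu j x) = (\<Sum>m\<in>UNIV. T i m x * (\<Sum>j\<in>UNIV. Gam m k j x * bu j x))" for i k
    by (simp add: sum_ac) (rule sum.swap)
  have 4: "(\<Sum>m\<in>UNIV. T i m x * T m k x)
      = (\<Sum>m\<in>UNIV. T i m x * partial k (bu m) x) + (\<Sum>m\<in>UNIV. T i m x * (\<Sum>j\<in>UNIV. Gam m k j x * bu j x))" for i k
    by (simp only: sum.distrib[symmetric] distrib_left[symmetric] nabla_bu[OF x])
  have "(\<Sum>j\<in>UNIV. Tc i j k x * bu j x) = - (\<Sum>m\<in>UNIV. T i m x * T m k x)" for i k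
    unfolding 4 Tc_def by (simp add: distrib_right left_diff_distrib sum.distrib sum_subtractf 1 2 3)
  then have "(\<Sum>i\<in>UNIV. \<Sum>j\<in>UNIV. Tc i j i x * bu j x) = - trT2 x"
    by (simp add: trT2_def sum_negf)
  moreover have "kap (x, Bu x) = (\<Sum>i\<in>UNIV. \<Sum>j\<in>UNIV. Tc i j i x * bu j x)"
    unfolding kap_def by (simp add: sum_distrib_right) (rule sum.swap)
  ultimately show ?thesis by simp
qed

text \<open>Differentiate y_i t^i = 0 along the geodesic spray, for which y_i is parallel.\<close>

lemma yl_nab0_t: assumes z: "fst z \<in> S" shows "(\<Sum>i\<in>UNIV. yl i z * nab0 t i z) = 0"
proof -
  have z': "z \<in> \<Omega>" using z by (cases z) auto
  note d = sm_differentiable[OF sm_t z'] sm_differentiable[OF sm_yl z']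
  have "(\<Sum>i\<in>UNIV. yl i z * xi (t i) z + xi (yl i) z * t i z) = xi (\<lambda>z. \<Sum>i\<in>UNIV. yl i z * t i z) z"
    by (subst dd_sum) (auto simp: dd_mult d intro!: differentiable_mult d)
  also have "\<dots> = dd (hlift (snd z) z) (\<lambda>z. 0) z"
    by (rule dd_cong[OF open_\<Omega> z']) (simp add: yl_t mem_Times_iff)
  finally have 1: "(\<Sum>i\<in>UNIV. yl i z * xi (t i) z) = - (\<Sum>i\<in>UNIV. xi (yl i) z * t i z)" by (simp add: sum.distrib)
  have "xi (yl i) z = (\<Sum>m\<in>UNIV. N m i z * yl m z)" for i
    unfolding hlift_yl[OF z] N_def by (subst sum.swap) (simp add: sum_ac)
  then have 2: "(\<Sum>i\<in>UNIV. xi (yl i) z * t i z) = (\<Sum>i\<in>UNIV. yl i z * (\<Sum>m\<in>UNIV. N i m z * t m z))"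
    by (simp add: sum_ac) (rule sum.swap)
  show ?thesis unfolding nab0_def by (simp add: distrib_left sum.distrib 1 2)
qed

text \<open>Differentiating b_i t^i = 0 along the geodesic spray leaves - (\<nabla>_0 b_i) t^i, and
  \<nabla>_0 b_i = s_i0.\<close>

lemma b_nab0_t: assumes z: "fst z \<in> S" shows "(\<Sum>i\<in>UNIV. b (fst z) $ i * nab0 t i z) = - t2 z"
proof -
  have z': "z \<in> \<Omega>" using z by (cases z) auto
  let ?b = "\<lambda>i z. b (fst z) $ i"
  note d = sm_differentiable[OF sm_t z'] sm_differentiable[OF sm_base[OF sm_b] z']
  have "(\<Sum>i\<in>UNIV. ?b i z * xi (t i) z + xi (?b i) z * t i z) = xi (\<lambda>z. \<Sum>i\<in>UNIV. ?b i z * t i z) z"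
    by (subst dd_sum) (auto simp: dd_mult d intro!: differentiable_mult d)
  also have "\<dots> = dd (hlift (snd z) z) (\<lambda>z. 0) z"
    by (rule dd_cong[OF open_\<Omega> z']) (simp add: b_t s0_0 mem_Times_iff)
  finally have 1: "(\<Sum>i\<in>UNIV. ?b i z * xi (t i) z) = - (\<Sum>i\<in>UNIV. xi (?b i) z * t i z)" by (simp add: sum.distrib)
  have 3: "xi (?b m) z - (\<Sum>i\<in>UNIV. N i m z * ?b i z) = sy m z" for m
  proof -
    have "(\<Sum>i\<in>UNIV. N i m z * ?b i z) = (\<Sum>k\<in>UNIV. snd z $ k * (\<Sum>i\<in>UNIV. Gam i m k (fst z) * ?b i z))"
      unfolding N_def by (simp add: sum_ac) (rule sum.swap)
    then have "xi (?b m) z - (\<Sum>i\<in>UNIV. N i m z * ?b i z) = (\<Sum>k\<in>UNIV. cov_deriv a b (fst z) m k * snd z $ k)"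
      unfolding hlift_base[OF sm_b z] cov_deriv_def by (simp add: algebra_simps sum_subtractf)
    then show ?thesis unfolding cov_s[OF z] by (simp add: sy_def)
  qed
  have 2: "(\<Sum>i\<in>UNIV. ?b i z * (\<Sum>m\<in>UNIV. N i m z * t m z)) = (\<Sum>m\<in>UNIV. (\<Sum>i\<in>UNIV. N i m z * ?b i z) * t m z)"
    by (simp add: sum_ac) (rule sum.swap)
  have "(\<Sum>i\<in>UNIV. ?b i z * nab0 t i z) = - (\<Sum>m\<in>UNIV. (xi (?b m) z - (\<Sum>i\<in>UNIV. N i m z * ?b i z)) * t m z)"
    unfolding nab0_def by (simp add: distrib_left sum.distrib 1 2 left_diff_distrib sum_subtractf)
  then show ?thesis unfolding 3 t2_def .
qed

text \<open>\<open>q1\<close> and \<open>q2\<close> are the components of the vertical gradient of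
  \<open>qf\<close> along y_k and b_k.\<close>

definition q1 where "q1 z = (4 * \<Delta> z - 2 * al z * bl z) / (\<Delta> z)\<^sup>2"
definition q2 where "q2 z = 2 * (al z)\<^sup>2 / (\<Delta> z)\<^sup>2"

lemma D_Killing: assumes z: "z \<in> Zd" shows "D i z = qf z * t i z"
proof -
  have S: "fst z \<in> S" using z Zd_\<Omega> by auto
  show ?thesis by (simp add: D_def su_def sl_0[OF S] pf_def uf_def s0_0[OF S] c_0[OF S])
qed

lemma sm_qf: "sm Zd qf"
  unfolding qf_def
  by (intro sm_divide sm_mult sm_power sm_const open_Zd sm_subset[OF sm_al Zd_Z0] sm_subset[OF sm_\<Delta> Zd_Z0])
     (use Zd_nz in auto)

lemma dd_qf: assumes z: "z \<in> Zd"
  shows "dd v qf z = 4 * al z * dd v al z / \<Delta> z - 2 * (al z)\<^sup>2 * dd v \<Delta> z / (\<Delta> z)\<^sup>2"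
proof -
  have z0: "z \<in> Z0" using z Zd_Z0 by blast
  show ?thesis
    unfolding qf_def
    by (rule dd_eqI[THEN trans])
       (use Zd_nz[OF z] in \<open>auto intro!: derivative_eq_intros hd_al[OF z0] hd_\<Delta>[OF z0] simp: field_simps eval_nat_numeral\<close>)
qed

lemma dy_qf: assumes z: "z \<in> Zd" shows "dy k qf z = q1 z * yl k z + q2 z * b (fst z) $ k"
proof -
  have z0: "z \<in> Z0" using z Zd_Z0 by blast
  have S: "fst z \<in> S" using Z0_S[OF z0] .
  show ?thesis
    unfolding dd_qf[OF z] dd_\<Delta>[OF z0] dy_al[OF z0] dy_bl[OF S] dy_be[OF S] q1_def q2_def
    using al_pos[OF z0] Zd_nz[OF z] by (simp add: field_simps eval_nat_numeral)
qed

lemma hor_qf: assumes z: "z \<in> Zd" shows "hor k qf z = - q2 z * sy k z"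
proof -
  have z0: "z \<in> Z0" using z Zd_Z0 by blast
  have S: "fst z \<in> S" using Z0_S[OF z0] .
  show ?thesis
    unfolding dd_qf[OF z] dd_\<Delta>[OF z0] hlift_al[OF z0] hor_bl[OF S] hor_be[OF S] q2_def
    by (simp add: c_0[OF S] sl_0[OF S])
qed

lemma xi_qf: assumes z: "z \<in> Zd" shows "xi qf z = 0"
proof -
  have z0: "z \<in> Z0" using z Zd_Z0 by blast
  have S: "fst z \<in> S" using Z0_S[OF z0] .
  show ?thesis
    unfolding dd_qf[OF z] dd_\<Delta>[OF z0] hlift_al[OF z0] xi_bl[OF S] xi_be[OF S]
    by (simp add: c_0[OF S] s0_0[OF S])
qed

definition Dq :: "'n \<Rightarrow> 'n tangent \<Rightarrow> real" where "Dq i z = qf z * t i z"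

lemma sm_Dq: "sm Zd (Dq i)"
  unfolding Dq_def by (intro sm_mult open_Zd sm_qf sm_subset[OF sm_t Zd_\<Omega>])

lemma dd_Dq: assumes z: "z \<in> Zd" shows "dd v (Dq i) z = qf z * dd v (t i) z + dd v qf z * t i z"
  unfolding Dq_def
  by (rule dd_mult) (use sm_differentiable[OF sm_qf z] sm_differentiable[OF sm_subset[OF sm_t Zd_\<Omega>] z] in auto)

lemma sum_q1_q2: "(\<Sum>i\<in>UNIV. (q1 z * u i + q2 z * v i) * w i) = q1 z * (\<Sum>i\<in>UNIV. u i * w i) + q2 z * (\<Sum>i\<in>UNIV. v i * w i)"
  by (simp add: distrib_right sum.distrib sum_distrib_left mult.assoc)

text \<open>T is trace free, and t is annihilated by y_i and b_i, hence by the gradient of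
  \<open>qf\<close>. Because of this the term with second vertical derivatives disappears from the
  Ricci curvature.\<close>

lemma div_Dq: assumes z: "z \<in> Zd" shows "(\<Sum>i\<in>UNIV. dy i (Dq i) z) = 0"
proof -
  have S: "fst z \<in> S" using z Zd_\<Omega> by auto
  have "(\<Sum>i\<in>UNIV. dy i (Dq i) z) = qf z * (\<Sum>i\<in>UNIV. T i i (fst z))
     + q1 z * (\<Sum>i\<in>UNIV. yl i z * t i z) + q2 z * (\<Sum>i\<in>UNIV. b (fst z) $ i * t i z)"
    unfolding dd_Dq[OF z] dy_qf[OF z] dy_t[OF S] sum.distrib sum_q1_q2 by (simp add: sum_distrib_left)
  then show ?thesis by (simp add: trace_T[OF S] yl_t[OF S] b_t[OF S] s0_0[OF S])
qed

lemma div_nab_Dq: assumes z: "z \<in> Zd" shows "(\<Sum>i\<in>UNIV. nab i Dq i z) = qf z * kap z - q2 z * t2 z"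
proof -
  have S: "fst z \<in> S" using z Zd_\<Omega> by auto
  have "nab i Dq i z = qf z * nab i t i z - q2 z * (sy i z * t i z)" for i
    unfolding nab_def dd_Dq[OF z] hor_qf[OF z] by (simp add: Dq_def algebra_simps sum_distrib_left)
  then show ?thesis
    by (simp add: sum_subtractf sum_distrib_left[symmetric] div_nab_t[OF S] t2_def)
qed

lemma nab0_Dq: assumes z: "z \<in> Zd" shows "nab0 Dq i z = qf z * nab0 t i z"
  unfolding nab0_def dd_Dq[OF z] xi_qf[OF z] by (simp add: Dq_def algebra_simps sum_distrib_left)

lemma div_nab0_Dq: assumes z: "z \<in> Zd" shows "(\<Sum>i\<in>UNIV. dy i (nab0 Dq i) z) = qf z * kap z - q2 z * t2 z"
proof -
  have S: "fst z \<in> S" using z Zd_\<Omega> by auto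
  have "dy i (nab0 Dq i) z = qf z * dy i (nab0 t i) z + dy i qf z * nab0 t i z" for i
  proof -
    have "dy i (nab0 Dq i) z = dy i (\<lambda>z. qf z * nab0 t i z) z"
      by (rule dd_cong[OF open_Zd z]) (rule nab0_Dq)
    also have "\<dots> = qf z * dy i (nab0 t i) z + dy i qf z * nab0 t i z"
      by (rule dd_mult) (use sm_differentiable[OF sm_qf z] sm_differentiable[OF sm_subset[OF sm_nab0_t Zd_\<Omega>] z] in auto)
    finally show ?thesis .
  qed
  then have "(\<Sum>i\<in>UNIV. dy i (nab0 Dq i) z) = qf z * (\<Sum>i\<in>UNIV. dy i (nab0 t i) z)
     + q1 z * (\<Sum>i\<in>UNIV. yl i z * nab0 t i z) + q2 z * (\<Sum>i\<in>UNIV. b (fst z) $ i * nab0 t i z)"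
    unfolding dy_qf[OF z] by (simp add: sum.distrib sum_q1_q2 sum_distrib_left)
  then show ?thesis by (simp add: div_nab0_t[OF S] yl_nab0_t[OF S] b_nab0_t[OF S])
qed

lemma trace_sq_Dq: assumes z: "z \<in> Zd"
  shows "(\<Sum>i\<in>UNIV. \<Sum>l\<in>UNIV. dy l (Dq i) z * dy i (Dq l) z) = (qf z)\<^sup>2 * trT2 (fst z) - 2 * qf z * q1 z * t2 z"
proof -
  have S: "fst z \<in> S" using z Zd_\<Omega> by auto
  let ?d = "\<lambda>i. dy i qf z" and ?T = "\<lambda>i j. T i j (fst z)"
  have dt: "(\<Sum>i\<in>UNIV. ?d i * t i z) = 0"
  proof -
    have "(\<Sum>i\<in>UNIV. ?d i * t i z) = q1 z * (\<Sum>i\<in>UNIV. yl i z * t i z) + q2 z * (\<Sum>i\<in>UNIV. b (fst z) $ i * t i z)"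
      unfolding dy_qf[OF z] by (rule sum_q1_q2)
    then show ?thesis by (simp add: yl_t[OF S] b_t[OF S] s0_0[OF S])
  qed
  have dT: "(\<Sum>l\<in>UNIV. ?d l * ?T l i) = - q1 z * sy i z" for i
  proof -
    have "(\<Sum>l\<in>UNIV. ?d l * ?T l i) = q1 z * (\<Sum>l\<in>UNIV. yl l z * ?T l i) + q2 z * (\<Sum>l\<in>UNIV. b (fst z) $ l * ?T l i)"
      unfolding dy_qf[OF z] by (rule sum_q1_q2)
    then show ?thesis by (simp add: yl_T[OF S] b_T[OF S])
  qed
  have X: "(\<Sum>i\<in>UNIV. \<Sum>l\<in>UNIV. (?d l * ?T l i) * t i z) = - q1 z * t2 z"
    unfolding sum_distrib_right[symmetric] dT t2_def sum_distrib_left by (simp add: mult_ac)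
  have X': "(\<Sum>i\<in>UNIV. \<Sum>l\<in>UNIV. (?d i * ?T i l) * t l z) = - q1 z * t2 z"
    using X by (subst sum.swap)
  have Y: "(\<Sum>i\<in>UNIV. \<Sum>l\<in>UNIV. (?d i * t i z) * (?d l * t l z)) = 0"
    unfolding sum_distrib_left[symmetric] dt by simp
  have "(\<Sum>i\<in>UNIV. \<Sum>l\<in>UNIV. dy l (Dq i) z * dy i (Dq l) z)
     = (\<Sum>i\<in>UNIV. \<Sum>l\<in>UNIV. (qf z)\<^sup>2 * (?T i l * ?T l i) + qf z * ((?d i * ?T i l) * t l z) + qf z * ((?d l * ?T l i) * t i z)
        + (?d i * t i z) * (?d l * t l z))"
    unfolding dd_Dq[OF z] dy_t[OF S] by (simp add: algebra_simps power2_eq_square)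
  also have "\<dots> = (qf z)\<^sup>2 * (\<Sum>i\<in>UNIV. \<Sum>l\<in>UNIV. ?T i l * ?T l i) + qf z * (\<Sum>i\<in>UNIV. \<Sum>l\<in>UNIV. (?d i * ?T i l) * t l z)
     + qf z * (\<Sum>i\<in>UNIV. \<Sum>l\<in>UNIV. (?d l * ?T l i) * t i z) + (\<Sum>i\<in>UNIV. \<Sum>l\<in>UNIV. (?d i * t i z) * (?d l * t l z))"
    by (simp only: sum.distrib sum_distrib_left)
  finally show ?thesis unfolding X X' Y trT2_def by simp
qed

text \<open>The trace of \<open>Rm_add\<close>: the two divergences of the deviation coincide, which
  leaves 3 - 1 = 2 copies, and the second-derivative term vanishes by \<open>div_Dq\<close>.\<close>

lemma ricci_Killing:
  assumes z: "(x, y) \<in> Zs"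
  defines "z \<equiv> (x, y)"
  shows "ricci Fs x y = RicG x y - 2 * q2 z * t2 z + 2 * qf z * kap z + 2 * qf z * q1 z * t2 z - (qf z)\<^sup>2 * trT2 x"
proof -
  have zd: "z \<in> Zd" using assms Zs_Zd by auto
  have HG: "H i u = G i u + Dq i u" if "u \<in> Zd" for i u
    unfolding H_def D_Killing[OF that] Dq_def by (rule refl)
  have 1: "riemann Fs x y $ i $ i = Rm G i i z + 3 * nab i Dq i z - dy i (nab0 Dq i) z
    + 2 * (\<Sum>l\<in>UNIV. Dq l z * dy l (dy i (Dq i)) z) - (\<Sum>l\<in>UNIV. dy l (Dq i) z * dy i (Dq l) z)" for i
  proof -
    have "Rm H i i z = Rm (\<lambda>i z. G i z + Dq i z) i i z" by (rule Rm_cong[OF open_Zd zd HG])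
    then show ?thesis
      unfolding riemann_Fs[OF z] z_def[symmetric] Rm_add[OF open_Zd Zd_\<Omega> zd sm_Dq] .
  qed
  have 2: "(\<Sum>i\<in>UNIV. \<Sum>l\<in>UNIV. Dq l z * dy l (dy i (Dq i)) z) = 0"
  proof -
    have "(\<Sum>i\<in>UNIV. dy l (dy i (Dq i)) z) = 0" for l
    proof -
      have "(\<Sum>i\<in>UNIV. dy l (dy i (Dq i)) z) = dy l (\<lambda>z. \<Sum>i\<in>UNIV. dy i (Dq i) z) z"
        by (rule dd_sum[symmetric]) (rule sm_differentiable[OF sm_dd[OF sm_Dq] zd])
      also have "\<dots> = dy l (\<lambda>z. 0) z" by (rule dd_cong[OF open_Zd zd]) (rule div_Dq)
      finally show ?thesis by simp
    qed
    then show ?thesis by (subst sum.swap) (simp flip: sum_distrib_left)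
  qed
  have "ricci Fs x y = RicG x y + 3 * (\<Sum>i\<in>UNIV. nab i Dq i z) - (\<Sum>i\<in>UNIV. dy i (nab0 Dq i) z)
    + 2 * (\<Sum>i\<in>UNIV. \<Sum>l\<in>UNIV. Dq l z * dy l (dy i (Dq i)) z) - (\<Sum>i\<in>UNIV. \<Sum>l\<in>UNIV. dy l (Dq i) z * dy i (Dq l) z)"
    unfolding ricci_def 1 RicG_def z_def by (simp add: sum.distrib sum_subtractf sum_distrib_left)
  then show ?thesis
    unfolding 2 div_nab_Dq[OF zd] div_nab0_Dq[OF zd] trace_sq_Dq[OF zd] by (simp add: z_def)
qed

lemma sy_Bu: assumes x: "x \<in> S" shows "sy i (x, p *\<^sub>R Bu x + w) = sy i (x, w)"
proof -
  have "(\<Sum>j\<in>UNIV. s i j x * bu j x) = - sl i x"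
    unfolding sl_def sum_negf[symmetric] by (intro sum.cong refl) (subst s_anti, simp)
  then have "(\<Sum>j\<in>UNIV. s i j x * bu j x) = 0" by (simp add: sl_0[OF x])
  then show ?thesis by (simp add: sy_def distrib_left sum.distrib mult.left_commute flip: sum_distrib_left)
qed

lemma t2_Bu: assumes x: "x \<in> S" shows "t2 (x, p *\<^sub>R Bu x + w) = t2 (x, w)"
  unfolding t2_def t_eq by (simp add: sy_Bu[OF x])

lemma t2_uminus: "t2 (x, - w) = t2 (x, w)"
  by (simp add: t2_def sy_def t_def sum_negf)

lemma kap_lin: "kap (x, p *\<^sub>R u + w) = p * kap (x, u) + kap (x, w)"
  by (simp add: kap_def distrib_left sum.distrib sum_distrib_left mult_ac)

text \<open>\<open>t2\<close> is the squared length of the vector t^i, and \<open>sy\<close> is that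
  vector with its index lowered.\<close>

lemma t2_zero_imp_sy_zero: assumes x: "x \<in> S" "t2 (x, w) = 0" shows "sy i (x, w) = 0"
proof -
  let ?v = "\<chi> i. t i (x, w)"
  have yl: "yl i (x, ?v) = sy i (x, w)" for i
    using a_t[of "(x, w)" i] x by (simp add: yl_def)
  have "Aq (x, ?v) = 0" using x(2) unfolding Aq_def t2_def yl by (simp add: mult.commute)
  then have v: "?v = 0" using Aq_pos[of "(x, ?v)"] x by auto
  show ?thesis unfolding yl[symmetric] v by (simp add: yl_def)
qed

text \<open>
  For \<open>w\<close> as long as \<open>b\<close> and \<open>\<sigma>\<^sup>2 = 1 + p\<^sup>2\<close>, every coefficient of the Einstein equation in direction
  \<open>p b + w\<close> is rational in \<open>p\<close> and \<open>\<sigma>\<close>; adding the equation for \<open>-w\<close> removes the odd terms.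
\<close>

lemma Killing_equation:
  assumes x: "x \<in> S" and w: "w \<noteq> 0" "be (x, w) = 0" "Aq (x, w) = B x"
    and K: "\<And>y. (x, y) \<in> Zs \<Longrightarrow> ricci Fs x y = k * (Fs x y)\<^sup>2"
    and \<sigma>: "\<sigma> > 0" "\<sigma>\<^sup>2 = 1 + p\<^sup>2" and \<rho>: "\<rho> = \<sigma> + p"
  shows "p\<^sup>2 * RicG x (Bu x) + RicG x w - 4 * \<sigma>\<^sup>2 * \<rho>\<^sup>2 * (t2 (x, w) / B x)
    + 8 * \<sigma>\<^sup>2 * (\<sigma> - 2 * p) * \<rho> ^ 3 * (t2 (x, w) / B x)
    - 4 * p * \<sigma>\<^sup>2 * \<rho> * trT2 x - 4 * \<sigma> ^ 4 * \<rho>\<^sup>2 * trT2 x = k * B x ^ 3 * (\<rho> ^ 4 / \<sigma>\<^sup>2)"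
proof -
  have Bp: "B x > 0" using B_pos[OF x] .
  \<comment> \<open>\<rho> is also 1 / (\<sigma> - p), because \<sigma>^2 - p^2 = 1; with it the
    powers of \<Delta> in denominators become powers of \<rho> in numerators.\<close>
  have \<rho>1: "(\<sigma> - p) * \<rho> = 1" using \<sigma> unfolding \<rho> by (simp add: algebra_simps power2_eq_square)
  then have sp: "\<sigma> - p \<noteq> 0" and \<rho>i: "inverse (\<sigma> - p) = \<rho>"
    by (auto simp: inverse_unique)
  have E: "RicG x (p *\<^sub>R Bu x + v) - 4 * \<sigma>\<^sup>2 * \<rho>\<^sup>2 * (t2 (x, w) / B x)
    + 4 * \<sigma>\<^sup>2 * \<rho> * (p * kap (x, Bu x) + kap (x, v))
    + 8 * \<sigma>\<^sup>2 * (\<sigma> - 2 * p) * \<rho> ^ 3 * (t2 (x, w) / B x) - 4 * \<sigma> ^ 4 * \<rho>\<^sup>2 * trT2 x = k * B x ^ 3 * (\<rho> ^ 4 / \<sigma>\<^sup>2)"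
    if v: "v \<noteq> 0" "be (x, v) = 0" "Aq (x, v) = B x" "t2 (x, v) = t2 (x, w)" for v
  proof -
    let ?z = "(x, p *\<^sub>R Bu x + v)"
    have z: "?z \<in> Zs" by (rule comb_in_Zs[OF x v(1,2)])
    have bl: "bl ?z = sqrt (B x)" by (simp add: bl_def)
    have "Aq ?z = B x * \<sigma>\<^sup>2" unfolding Aq_comb[OF x] v(2,3) \<sigma>(2) by (simp add: algebra_simps)
    then have al: "al ?z = sqrt (B x) * \<sigma>" using \<sigma>(1) by (simp add: al_def real_sqrt_mult)
    have be: "be ?z = p * B x" unfolding be_comb v(2) by simp
    have bb: "sqrt (B x) * (sqrt (B x) * \<sigma>) = B x * \<sigma>" using Bp by (simp flip: mult.assoc)
    have \<Delta>: "\<Delta> ?z = B x * (\<sigma> - p)" unfolding \<Delta>_def bl al be bb by (simp add: algebra_simps)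
    have r: "r ?z = B x * \<rho>" unfolding r_def bl al be bb \<rho> by (simp add: algebra_simps)
    have al2: "(al ?z)\<^sup>2 = B x * \<sigma>\<^sup>2" unfolding al using Bp by (simp add: power_mult_distrib)
    have qf: "qf ?z = 2 * \<sigma>\<^sup>2 * \<rho>"
      unfolding qf_def al2 \<Delta> \<rho>i[symmetric] using Bp sp by (simp add: field_simps)
    have q2: "q2 ?z = 2 * \<sigma>\<^sup>2 * \<rho>\<^sup>2 / B x"
    proof -
      have "2 * (B x * \<sigma>\<^sup>2) / (B x * h)\<^sup>2 = 2 * \<sigma>\<^sup>2 * (inverse h)\<^sup>2 / B x" if "h \<noteq> 0" for h
        using Bp that by (simp add: field_simps power2_eq_square)
      then show ?thesis unfolding q2_def al2 \<Delta> \<rho>i[symmetric] using sp by blast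
    qed
    have q1: "q1 ?z = (2 * \<sigma> - 4 * p) * \<rho>\<^sup>2 / B x"
    proof -
      have ab: "2 * al ?z * bl ?z = 2 * (B x * \<sigma>)" unfolding al bl using Bp by (simp add: mult_ac)
      have "(4 * (B x * h) - 2 * (B x * \<sigma>)) / (B x * h)\<^sup>2 = (4 * h - 2 * \<sigma>) * (inverse h)\<^sup>2 / B x" if "h \<noteq> 0" for h
        using Bp that by (simp add: field_simps power2_eq_square)
      from this[OF sp] show ?thesis unfolding q1_def ab \<Delta> \<rho>i by (simp add: algebra_simps)
    qed
    have F: "(Fs x (p *\<^sub>R Bu x + v))\<^sup>2 = B x ^ 3 * (\<rho> ^ 4 / \<sigma>\<^sup>2)"
      unfolding Fs_sq_eq r al2 using Bp \<sigma>(1) by (simp add: field_simps eval_nat_numeral)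
    have t2: "t2 ?z = t2 (x, w)" unfolding t2_Bu[OF x] v(4) ..
    show ?thesis
      using K[OF z] unfolding F ricci_Killing[OF z] qf q1 q2 t2 kap_lin
      by (simp add: field_simps eval_nat_numeral)
  qed
  have "Aq (x, - w) = Aq (x, w)" using quad_uminus[OF quad_Aq] .
  then have m: "- w \<noteq> 0" "be (x, - w) = 0" "Aq (x, - w) = B x" "t2 (x, - w) = t2 (x, w)"
    using w by (auto simp: be_uminus t2_uminus)
  have kn: "kap (x, - w) = - kap (x, w)" by (simp add: kap_def sum_negf)
  have "RicG x (p *\<^sub>R Bu x + w) + RicG x (p *\<^sub>R Bu x - w) = 2 * (p\<^sup>2 * RicG x (Bu x)) + 2 * RicG x w"
    using quad_parallelogram[OF quad_RicG[OF x], of "p *\<^sub>R Bu x" w] quad_scale[OF quad_RicG[OF x], of p "Bu x"] by simp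
  moreover note E[OF w(1-3) refl] E[OF m]
  ultimately show ?thesis unfolding kn kap_Bu[OF x] by (simp add: algebra_simps)
qed

text \<open>Vectors w orthogonal to b and as long as b suffice: s_i0 is linear in y, so scaling
  gives all w orthogonal to b, and s_i0 does not see the component along b.\<close>

lemma Killing_parallel:
  assumes x: "x \<in> S" and K: "\<And>y. (x, y) \<in> Zs \<Longrightarrow> ricci Fs x y = k * (Fs x y)\<^sup>2"
  shows "s i j x = 0"
proof -
  have Bp: "B x > 0" using B_pos[OF x] .
  have t0: "t2 (x, w) = 0" if w: "w \<noteq> 0" "be (x, w) = 0" "Aq (x, w) = B x" for w
  proof -
    note E = Killing_equation[OF x w K]
    define k' where "k' = k * B x ^ 3"
    define \<tau> where "\<tau> = t2 (x, w) / B x"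
    define R1 where "R1 = RicG x (Bu x)"
    define R2 where "R2 = RicG x w"
    \<comment> \<open>The directions are rational points of \<sigma>^2 = 1 + p^2, the trivial one
      and four from the triple 3-4-5. The resulting five equations are linear and homogeneous in
      \<open>R1\<close>, \<open>R2\<close>, \<open>\<tau>\<close>, \<open>trT2 x\<close> and
      \<open>k'\<close>, and together they force \<open>\<tau>\<close> to vanish.\<close>
    have e1: "R2 - 4 * \<tau> + 8 * \<tau> - 4 * trT2 x = k'"
      using E[of 1 0 1] by (simp add: k'_def \<tau>_def R2_def)
    note E' = E[folded k'_def \<tau>_def R1_def R2_def]
    have e2: "9/16 * R1 + R2 - 25 * \<tau> - 25 * \<tau> - 75/8 * trT2 x - 625/16 * trT2 x = k' * (256/25)"
      using E'[of "5/4" "3/4" 2] by (simp add: eval_nat_numeral field_simps)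
    have e3: "9/16 * R1 + R2 - 25/16 * \<tau> + 275/64 * \<tau> + 75/32 * trT2 x - 625/256 * trT2 x = k' * (1/25)"
      using E'[of "5/4" "- 3/4" "1/2"] by (simp add: eval_nat_numeral field_simps)
    have e4: "16/9 * R1 + R2 - 100 * \<tau> - 600 * \<tau> - 400/9 * trT2 x - 2500/9 * trT2 x = k' * (729/25)"
      using E'[of "5/3" "4/3" 3] by (simp add: eval_nat_numeral field_simps)
    have e5: "16/9 * R1 + R2 - 100/81 * \<tau> + 2600/729 * \<tau> + 400/81 * trT2 x - 2500/729 * trT2 x = k' * (1/225)"
      using E'[of "5/3" "- 4/3" "1/3"] by (simp add: eval_nat_numeral field_simps)
    have "\<tau> = 0" using e1 e2 e3 e4 e5 by linarith
    then show ?thesis using Bp by (simp add: \<tau>_def)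
  qed
  have orth: "sy i (x, w) = 0" if w: "be (x, w) = 0" for w
  proof (cases "w = 0")
    case True then show ?thesis by (simp add: sy_def)
  next
    case False
    have A: "Aq (x, w) > 0" using Aq_pos[of "(x, w)"] x False by simp
    \<comment> \<open>The factor that brings w to the length of b.\<close>
    define k where "k = sqrt (B x / Aq (x, w))"
    have k: "k \<noteq> 0" "k\<^sup>2 = B x / Aq (x, w)" using A Bp by (auto simp: k_def)
    have "t2 (x, k *\<^sub>R w) = 0"
      by (rule t0) (use k False w A quad_scale[OF quad_Aq, of x k w] in \<open>auto simp: be_scale\<close>)
    from t2_zero_imp_sy_zero[OF x this, of i] have "k * sy i (x, w) = 0" by (simp add: sy_def sum_distrib_left mult_ac)
    then show ?thesis using k by simp
  qed
  have "sy i (x, axis j 1) = 0"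
  proof -
    obtain p w where "axis j 1 = p *\<^sub>R Bu x + w" "be (x, w) = 0" using decompose[OF x] .
    then show ?thesis using sy_Bu[OF x, of i p w] orth[of w] by simp
  qed
  then show ?thesis by (simp add: sy_def)
qed

end
end

section \<open>Second derivatives of a singular quotient\<close>

text \<open>Modelled on the spray coefficients of F, with d = \<Delta> and g = s_0. The factor g is
  kept apart because along the curve used later it vanishes while its derivatives need not.\<close>

lemma dd_singular:
  assumes Y: "open Y" "z \<in> Y" and nz: "\<And>u. u \<in> Y \<Longrightarrow> d u \<noteq> 0"
    and sm: "sm Y W" "sm Y d" "sm Y g" "sm Y V"
    and f: "\<And>u. u \<in> Y \<Longrightarrow> f u = W u / d u + g u * V u / (d u)\<^sup>2"
  shows "dd v f z = dd v W z / d z - W z * dd v d z / (d z)\<^sup>2 + (dd v g z * V z + g z * dd v V z) / (d z)\<^sup>2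
     - 2 * g z * V z * dd v d z / d z ^ 3"
proof -
  note h = sm_has_derivative[OF sm(1) Y(2)] sm_has_derivative[OF sm(2) Y(2)]
    sm_has_derivative[OF sm(3) Y(2)] sm_has_derivative[OF sm(4) Y(2)]
  have "dd v f z = dd v (\<lambda>u. W u / d u + g u * V u / (d u)\<^sup>2) z" by (rule dd_cong[OF Y f])
  also have "\<dots> = dd v W z / d z - W z * dd v d z / (d z)\<^sup>2 + (dd v g z * V z + g z * dd v V z) / (d z)\<^sup>2
     - 2 * g z * V z * dd v d z / d z ^ 3"
    by (rule dd_eqI[THEN trans])
       (use nz[OF Y(2)] in \<open>auto intro!: derivative_eq_intros h simp: field_simps eval_nat_numeral\<close>)
  finally show ?thesis .
qed

text \<open>With g = 0 at the point every term of order d^-4 drops out, so d^-3 is the worst that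
  remains.\<close>

lemma dd_dd_singular:
  assumes Y: "open Y" "z \<in> Y" and nz: "\<And>u. u \<in> Y \<Longrightarrow> d u \<noteq> 0"
    and sm: "sm Y W" "sm Y d" "sm Y g" "sm Y V"
    and f: "\<And>u. u \<in> Y \<Longrightarrow> f u = W u / d u + g u * V u / (d u)\<^sup>2" and g: "g z = 0"
  shows "dd w (dd v f) z = dd w (dd v W) z / d z
     - (dd v W z * dd w d z + dd w W z * dd v d z + W z * dd w (dd v d) z) / (d z)\<^sup>2
     + 2 * W z * dd v d z * dd w d z / d z ^ 3
     + (dd w (dd v g) z * V z + dd v g z * dd w V z + dd w g z * dd v V z) / (d z)\<^sup>2
     - 2 * V z * (dd v g z * dd w d z + dd w g z * dd v d z) / d z ^ 3"
proof -
  note h = sm_has_derivative[OF sm(1) Y(2)] sm_has_derivative[OF sm(2) Y(2)]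
    sm_has_derivative[OF sm(3) Y(2)] sm_has_derivative[OF sm(4) Y(2)]
    sm_has_derivative[OF sm_dd[OF sm(1)] Y(2)] sm_has_derivative[OF sm_dd[OF sm(2)] Y(2)]
    sm_has_derivative[OF sm_dd[OF sm(3)] Y(2)] sm_has_derivative[OF sm_dd[OF sm(4)] Y(2)]
  have "dd w (dd v f) z = dd w (\<lambda>z. dd v W z / d z - W z * dd v d z / (d z)\<^sup>2
     + (dd v g z * V z + g z * dd v V z) / (d z)\<^sup>2 - 2 * g z * V z * dd v d z / d z ^ 3) z"
    by (rule dd_cong[OF Y dd_singular[OF Y(1) _ nz sm f]])
  also have "\<dots> = dd w (dd v W) z / d z - dd v W z * dd w d z / (d z)\<^sup>2
     - (dd w W z * dd v d z + W z * dd w (dd v d) z) / (d z)\<^sup>2 + 2 * W z * dd v d z * dd w d z / d z ^ 3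
     + (dd w (dd v g) z * V z + dd v g z * dd w V z + dd w g z * dd v V z + g z * dd w (dd v V) z) / (d z)\<^sup>2
     - 2 * (dd v g z * V z + g z * dd v V z) * dd w d z / d z ^ 3
     - 2 * (dd w g z * V z * dd v d z + g z * dd w V z * dd v d z + g z * V z * dd w (dd v d) z) / d z ^ 3
     + 6 * g z * V z * dd v d z * dd w d z / d z ^ 4"
    by (rule dd_eqI[THEN trans])
       (use nz[OF Y(2)] in \<open>auto intro!: derivative_eq_intros h simp: field_simps eval_nat_numeral\<close>)
  finally show ?thesis
    unfolding g using nz[OF Y(2)] by (simp add: add_divide_distrib diff_divide_distrib algebra_simps)
qed

lemma sum_comb9: "(\<Sum>i\<in>I. \<Sum>l\<in>J. k1 * X1 i l + k2 * X2 i l + k3 * X3 i l + k4 * X4 i l + k5 * X5 i l + k6 * X6 i l + k7 * X7 i l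
     + k8 * X8 i l + k9 * (X9 i l :: real)) = k1 * (\<Sum>i\<in>I. \<Sum>l\<in>J. X1 i l) + k2 * (\<Sum>i\<in>I. \<Sum>l\<in>J. X2 i l)
     + k3 * (\<Sum>i\<in>I. \<Sum>l\<in>J. X3 i l) + k4 * (\<Sum>i\<in>I. \<Sum>l\<in>J. X4 i l) + k5 * (\<Sum>i\<in>I. \<Sum>l\<in>J. X5 i l)
     + k6 * (\<Sum>i\<in>I. \<Sum>l\<in>J. X6 i l) + k7 * (\<Sum>i\<in>I. \<Sum>l\<in>J. X7 i l) + k8 * (\<Sum>i\<in>I. \<Sum>l\<in>J. X8 i l)
     + k9 * (\<Sum>i\<in>I. \<Sum>l\<in>J. X9 i l)"
  by (simp only: sum.distrib sum_distrib_left)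

lemma sum_comb4: "(\<Sum>i\<in>I. \<Sum>l\<in>J. k1 * X1 i l + k2 * X2 i l + k3 * X3 i l + k4 * (X4 i l :: real))
   = k1 * (\<Sum>i\<in>I. \<Sum>l\<in>J. X1 i l) + k2 * (\<Sum>i\<in>I. \<Sum>l\<in>J. X2 i l) + k3 * (\<Sum>i\<in>I. \<Sum>l\<in>J. X3 i l) + k4 * (\<Sum>i\<in>I. \<Sum>l\<in>J. X4 i l)"
  by (simp only: sum.distrib sum_distrib_left)

section \<open>Blow-up of the Ricci curvature at the direction b\<close>

context sq_chart
begin

text \<open>\<open>Wf\<close> is the numerator over \<Delta> in the spray of F, its regular part
  being multiplied by \<Delta>; \<open>Vf\<close> is what accompanies s_0 / \<Delta>^2. Both are
  smooth across the direction b, so the singularity sits in the powers of \<Delta> alone.\<close>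

definition Wf :: "'n \<Rightarrow> 'n tangent \<Rightarrow> real" where
  "Wf i z = \<Delta> z * G i z + 2 * (al z)\<^sup>2 * t i z - al z ^ 3 / bl z * su i (fst z) + \<Delta> z * (c (fst z) * al z / bl z) * snd z $ i"
definition Vf :: "'n \<Rightarrow> 'n tangent \<Rightarrow> real" where
  "Vf i z = al z / bl z * (be z * snd z $ i - (al z)\<^sup>2 * bu i (fst z))"

lemma H_singular: assumes z: "z \<in> Zd" shows "H i z = Wf i z / \<Delta> z + s0 z * Vf i z / (\<Delta> z)\<^sup>2"
  using Zd_nz[OF z] unfolding H_def D_def Wf_def Vf_def qf_def vf_def pf_def uf_def
  by (simp add: field_simps eval_nat_numeral)

lemma sm_Wf: "sm Z0 (Wf i)"
  unfolding Wf_def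
  by (intro sm_add sm_diff sm_mult sm_divide sm_power sm_const sm_snd_nth open_Z0 sm_al sm_\<Delta>
      sm_subset[OF sm_bl Z0_\<Omega>] sm_subset[OF sm_t Z0_\<Omega>] sm_subset[OF sm_G Z0_\<Omega>]
      sm_subset[OF sm_base[OF sm_su] Z0_\<Omega>] sm_subset[OF sm_base[OF sm_c] Z0_\<Omega>])
     (use bl_pos Z0_S in \<open>fastforce+\<close>)

lemma sm_Vf: "sm Z0 (Vf i)"
  unfolding Vf_def
  by (intro sm_add sm_diff sm_mult sm_divide sm_power sm_const sm_snd_nth open_Z0 sm_al
      sm_subset[OF sm_bl Z0_\<Omega>] sm_subset[OF sm_be Z0_\<Omega>] sm_subset[OF sm_base[OF sm_bu] Z0_\<Omega>])
     (use bl_pos Z0_S in \<open>fastforce+\<close>)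

lemma dy_\<Delta>: "z \<in> Z0 \<Longrightarrow> dy l \<Delta> z = bl z * yl l z / al z - b (fst z) $ l"
  by (simp add: dd_\<Delta> dy_al dy_bl dy_be Z0_S)

lemma dy_dy_\<Delta>: assumes z: "z \<in> Z0"
  shows "dy l (dy m \<Delta>) z = bl z * (a (fst z) $ m $ l / al z - yl m z * yl l z / al z ^ 3)"
proof -
  have S: "fst z \<in> S" using z by (rule Z0_S)
  have "z \<in> \<Omega>" using z Z0_\<Omega> by auto
  note d = sm_differentiable[OF sm_rho z] sm_differentiable[OF sm_base[OF sm_b] this]
  have "dy l (dy m \<Delta>) z = dy l (\<lambda>z. rho m z - 2 * b (fst z) $ m) z"
    by (rule dd_cong[OF open_Z0 z]) (simp add: dy_\<Delta> rho_def)
  also have "\<dots> = dy l (rho m) z"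
    using d by (subst dd_diff) (auto simp: dd_cmult dy_base[OF sm_b S] intro!: differentiable_mult)
  finally show ?thesis unfolding dy_rho[OF z] .
qed

text \<open>At y = b the bracket in \<open>Vf\<close> is zero, so only its own derivative survives,
  and there \<alpha> equals b and y_l equals b_l.\<close>

lemma dy_Vf: assumes z: "z \<in> Z0" and 0: "be z = B (fst z)" "(al z)\<^sup>2 = B (fst z)" "snd z = Bu (fst z)"
  shows "dy l (Vf i) z = B (fst z) * axis l 1 $ i - b (fst z) $ l * bu i (fst z)"
proof -
  have S: "fst z \<in> S" using z by (rule Z0_S)
  have ab: "al z = bl z" using 0(2) bl_sq[OF S] al_pos[OF z] bl_pos[OF S]
    by (metis less_imp_le power2_eq_iff_nonneg)
  have yl: "yl l z = b (fst z) $ l" using yl_bu_pair[OF S] 0(3) by (metis prod.collapse)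
  have bz: "be z * snd z $ i - (al z)\<^sup>2 * bu i (fst z) = 0" unfolding 0 by simp
  have *: "dd v (Vf i) z = (dd v al z * bl z - al z * dd v bl z) / (bl z)\<^sup>2 * (be z * snd z $ i - (al z)\<^sup>2 * bu i (fst z))
      + al z / bl z * (dd v be z * snd z $ i + be z * dd v (\<lambda>z. snd z $ i) z - 2 * al z * dd v al z * bu i (fst z)
        - (al z)\<^sup>2 * dd v (\<lambda>z. bu i (fst z)) z)" for v
    unfolding Vf_def
    by (rule dd_eqI[THEN trans])
       (use bl_pos[OF S] in \<open>auto intro!: derivative_eq_intros hd_al[OF z] hd_\<Omega>[OF sm_bl S] hd_\<Omega>[OF sm_be S] hd_snd
          hd_\<Omega>[OF sm_base[OF sm_bu] S] simp: field_simps eval_nat_numeral\<close>)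
  show ?thesis
    unfolding *[of "(0, axis l 1)"] bz dy_al[OF z] dy_be[OF S] dy_base[OF sm_bu S] using bl_pos[OF S]
    by (simp add: 0 yl ab)
qed

lemma sl_norm_zero_imp_zero: assumes x: "x \<in> S" "(\<Sum>i\<in>UNIV. sl i x * su i x) = 0" shows "sl i x = 0"
proof -
  let ?v = "\<chi> i. su i x"
  have yl: "yl i (x, ?v) = sl i x" for i using a_su[OF x(1)] by (simp add: yl_def)
  have "Aq (x, ?v) = 0" using x(2) unfolding Aq_def yl by (simp add: mult.commute)
  then have v: "?v = 0" using Aq_pos[of "(x, ?v)"] x by auto
  show ?thesis unfolding yl[symmetric] v by (simp add: yl_def)
qed

lemma dd_H: assumes z: "z \<in> Zd"
  shows "dd v (H i) z = dd v (Wf i) z / \<Delta> z - Wf i z * dd v \<Delta> z / (\<Delta> z)\<^sup>2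
     + (dd v s0 z * Vf i z + s0 z * dd v (Vf i) z) / (\<Delta> z)\<^sup>2 - 2 * s0 z * Vf i z * dd v \<Delta> z / \<Delta> z ^ 3"
  by (rule dd_singular[OF open_Zd z Zd_nz(2) sm_subset[OF sm_Wf Zd_Z0] sm_subset[OF sm_\<Delta> Zd_Z0]
        sm_subset[OF sm_s0 Zd_\<Omega>] sm_subset[OF sm_Vf Zd_Z0] H_singular])

lemma dd_dd_H: assumes z: "z \<in> Zd" "s0 z = 0"
  shows "dd w (dd v (H i)) z = dd w (dd v (Wf i)) z / \<Delta> z
     - (dd v (Wf i) z * dd w \<Delta> z + dd w (Wf i) z * dd v \<Delta> z + Wf i z * dd w (dd v \<Delta>) z) / (\<Delta> z)\<^sup>2
     + 2 * Wf i z * dd v \<Delta> z * dd w \<Delta> z / \<Delta> z ^ 3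
     + (dd w (dd v s0) z * Vf i z + dd v s0 z * dd w (Vf i) z + dd w s0 z * dd v (Vf i) z) / (\<Delta> z)\<^sup>2
     - 2 * Vf i z * (dd v s0 z * dd w \<Delta> z + dd w s0 z * dd v \<Delta> z) / \<Delta> z ^ 3"
  by (rule dd_dd_singular[OF open_Zd z(1) Zd_nz(2) sm_subset[OF sm_Wf Zd_Z0] sm_subset[OF sm_\<Delta> Zd_Z0]
        sm_subset[OF sm_s0 Zd_\<Omega>] sm_subset[OF sm_Vf Zd_Z0] H_singular z(2)])

text \<open>F^2 is continuous at the direction b, so e^6 times the right-hand side of the Einstein
  equation tends to 0. The limit of the left-hand side is -6 (n + 1) (b^2)^2 \<kappa>^3 s_i s^i with
  \<kappa> = 2 / U.\<close>

lemma singular_directions: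
  assumes x: "x \<in> S" and K: "\<And>y. (x, y) \<in> Zs \<Longrightarrow> ricci Fs x y = k * (Fs x y)\<^sup>2"
  shows "sl j x = 0"
proof -
  \<comment> \<open>Orthogonality to b keeps the curve in nondegenerate directions; orthogonality to
    s makes s_0 vanish along it.\<close>
  obtain u where u0: "u \<noteq> 0" and ub: "u \<bullet> b x = 0" and us: "u \<bullet> (\<chi> i. sl i x) = 0"
    using exists_orthogonal_pair .
  have beu: "be (x, u) = 0" using ub by (simp add: be_def inner_vec_def mult.commute)
  have s0u: "s0 (x, u) = 0" using us by (simp add: s0_def inner_vec_def mult.commute)
  define U where "U = Aq (x, u)"
  have U: "U > 0" using Aq_pos[of "(x, u)"] x u0 by (simp add: U_def)
  have Bp: "B x > 0" using B_pos[OF x] .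
  let ?z = "(x, Bu x)" and ?F = "at_right (0::real)"
  define \<gamma> where "\<gamma> e = (x, Bu x + e *\<^sub>R u)" for e :: real
  have \<gamma>0: "\<gamma> 0 = ?z" by (simp add: \<gamma>_def)
  have z0: "?z \<in> Z0" using x bu_nz[OF x] by (simp add: Z0_def)
  have z0S: "fst ?z \<in> S" using x by simp
  define q where "q = sqrt (B x)"
  have bpos: "q > 0" using Bp by (simp add: q_def)
  have b2: "q * q = B x" using Bp by (simp add: q_def)
  have Azz: "Aq ?z = B x" by (rule Aq_bu[OF x])
  have al0: "al ?z = q" by (simp add: al_def Azz q_def)
  have bl0: "bl ?z = q" by (simp add: bl_def q_def)
  have be0: "be ?z = B x" by (rule be_Bu)
  have ylz: "yl i ?z = b x $ i" for i by (rule yl_bu_pair[OF x])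
  have s00: "s0 ?z = 0" using bu_sl[of x] by (simp add: s0_def mult.commute)
  have cont\<gamma>: "(\<gamma> \<longlongrightarrow> ?z) ?F"
  proof -
    have "continuous (at 0) \<gamma>" unfolding \<gamma>_def by (intro continuous_intros)
    then have "(\<gamma> \<longlongrightarrow> \<gamma> 0) (at 0)" by (simp add: continuous_at)
    then show ?thesis unfolding \<gamma>0 by (rule tendsto_mono[OF at_le, rotated]) simp
  qed
  have lim: "((\<lambda>e. g (\<gamma> e)) \<longlongrightarrow> g ?z) ?F" if "sm Z0 g" for g
    using isCont_tendsto_compose[OF sm_isCont[OF open_Z0 that z0] cont\<gamma>] .
  have pos: "eventually (\<lambda>e. e > (0::real)) ?F" by (simp add: eventually_at_filter)
  have inZs: "\<gamma> e \<in> Zs" if "e > 0" for e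
    using comb_in_Zs[OF x, of "e *\<^sub>R u" 1] that u0 beu by (simp add: \<gamma>_def be_scale)
  have inZ0: "\<gamma> e \<in> Z0" if "e > 0" for e using inZs[OF that] Zs_Z0 by blast
  have inZd: "\<gamma> e \<in> Zd" if "e > 0" for e using inZs[OF that] Zs_Zd by blast
  have A\<gamma>: "Aq (\<gamma> e) = B x + e\<^sup>2 * U" for e
    using Aq_comb[OF x, of 1 "e *\<^sub>R u"] quad_scale[OF quad_Aq, of x e u]
    by (simp add: \<gamma>_def be_scale beu U_def)
  have be\<gamma>: "be (\<gamma> e) = B x" for e using be_comb[of x 1 "e *\<^sub>R u"] by (simp add: \<gamma>_def be_scale beu)
  have bl\<gamma>: "bl (\<gamma> e) = q" for e by (simp add: bl_def \<gamma>_def q_def)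
  have s0\<gamma>: "s0 (\<gamma> e) = 0" for e
    using s00 s0u by (simp add: \<gamma>_def s0_def distrib_left sum.distrib mult.left_commute flip: sum_distrib_left)
  have fst\<gamma>: "fst (\<gamma> e) = x" for e by (simp add: \<gamma>_def)
  have snd\<gamma>: "snd (\<gamma> e) $ i = bu i x + e * u $ i" for e i by (simp add: \<gamma>_def)
  have yl\<gamma>: "yl i (\<gamma> e) = b x $ i + e * yl i (x, u)" for e i
    by (simp add: \<gamma>_def yl_add yl_scale yl_bu_pair[OF x])
  have alpos: "al (\<gamma> e) > 0" if "e > 0" for e using al_pos[OF inZ0[OF that]] .
  have al2: "(al (\<gamma> e))\<^sup>2 = B x + e\<^sup>2 * U" if "e > 0" for e using al_sq[OF inZ0[OF that]] A\<gamma> by simp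
  have limal: "((\<lambda>e. al (\<gamma> e)) \<longlongrightarrow> q) ?F" using lim[OF sm_al] unfolding al0 .
  have lime: "((\<lambda>e. e) \<longlongrightarrow> (0::real)) ?F" by (rule tendsto_ident_at)

  \<comment> \<open>The weights: \<open>\<Delta>\<close> vanishes to second order along \<open>\<gamma>\<close>, while \<open>d\<Delta>\<close> and \<open>V\<close> vanish to first order.\<close>
  define E where "E e = e\<^sup>2 / \<Delta> (\<gamma> e)" for e
  have E: "(E \<longlongrightarrow> 2 / U) ?F"
  proof -
    have "eventually (\<lambda>e. (al (\<gamma> e) + q) / (q * U) = E e) ?F"
      using pos
    proof eventually_elim
      case (elim e)
      \<comment> \<open>Multiplying by the conjugate removes the square root: \<Delta> is q
        (\<alpha> - q), and \<alpha>^2 - q^2 = e^2 U.\<close>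
      have "\<Delta> (\<gamma> e) * (al (\<gamma> e) + q) = q * ((al (\<gamma> e))\<^sup>2 - B x)"
      proof -
        have "\<Delta> (\<gamma> e) = q * (al (\<gamma> e) - q)" unfolding \<Delta>_def bl\<gamma> be\<gamma> by (simp only: right_diff_distrib b2)
        moreover have "w * (v - w) * (v + w) = w * (v\<^sup>2 - w * w)" for v w :: real
          by (simp add: algebra_simps power2_eq_square)
        ultimately have "\<Delta> (\<gamma> e) * (al (\<gamma> e) + q) = q * ((al (\<gamma> e))\<^sup>2 - q * q)" by metis
        then show ?thesis unfolding b2 .
      qed
      also have "\<dots> = q * U * e\<^sup>2" unfolding al2[OF elim] by simp
      finally have "\<Delta> (\<gamma> e) * (al (\<gamma> e) + q) = q * U * e\<^sup>2" .
      moreover have "\<Delta> (\<gamma> e) \<noteq> 0" using Zd_nz[OF inZd[OF elim]] by simp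
      ultimately show ?case unfolding E_def using bpos U alpos[OF elim] by (simp add: field_simps)
    qed
    moreover have "((\<lambda>e. (al (\<gamma> e) + q) / (q * U)) \<longlongrightarrow> (q + q) / (q * U)) ?F"
      by (intro tendsto_intros limal) (use bpos U in auto)
    ultimately show ?thesis using bpos by (simp add: tendsto_cong)
  qed
  have d\<Delta>: "((\<lambda>e. dy l \<Delta> (\<gamma> e) / e) \<longlongrightarrow> yl l (x, u)) ?F" for l
  proof -
    have "eventually (\<lambda>e. - (e * U) / ((al (\<gamma> e) + q) * al (\<gamma> e)) * b x $ l + q / al (\<gamma> e) * yl l (x, u) = dy l \<Delta> (\<gamma> e) / e) ?F"
      using pos
    proof eventually_elim
      case (elim e)
      have a: "al (\<gamma> e) > 0" by (rule alpos[OF elim])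
      have "(q - al (\<gamma> e)) * (al (\<gamma> e) + q) = - (e * U) * e"
        using al2[OF elim] b2 by (simp add: algebra_simps power2_eq_square)
      then have "q - al (\<gamma> e) = - (e * U) * e / (al (\<gamma> e) + q)" using a bpos by (simp add: field_simps)
      moreover have "(q / al (\<gamma> e) - 1) / e = (q - al (\<gamma> e)) / (al (\<gamma> e) * e)"
        using a elim by (simp add: field_simps)
      moreover have "(- (e * U) * e / h) / (al (\<gamma> e) * e) = - (e * U) / (h * al (\<gamma> e))" for h
        using a elim by simp
      ultimately have "(q / al (\<gamma> e) - 1) / e = - (e * U) / ((al (\<gamma> e) + q) * al (\<gamma> e))" by simp
      moreover have "dy l \<Delta> (\<gamma> e) / e = (q / al (\<gamma> e) - 1) / e * b x $ l + q / al (\<gamma> e) * yl l (x, u)"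
        unfolding dy_\<Delta>[OF inZ0[OF elim]] bl\<gamma> yl\<gamma> fst\<gamma> using a elim by (simp add: field_simps)
      ultimately show ?case by simp
    qed
    moreover have "((\<lambda>e. - (e * U) / ((al (\<gamma> e) + q) * al (\<gamma> e)) * b x $ l + q / al (\<gamma> e) * yl l (x, u))
        \<longlongrightarrow> - (0 * U) / ((q + q) * q) * b x $ l + q / q * yl l (x, u)) ?F"
      by (intro tendsto_intros limal lime) (use bpos in auto)
    ultimately show ?thesis using bpos by (simp add: tendsto_cong)
  qed
  have V: "((\<lambda>e. Vf i (\<gamma> e) / e) \<longlongrightarrow> B x * u $ i) ?F" for i
  proof -
    have "eventually (\<lambda>e. al (\<gamma> e) / q * (B x * u $ i - e * U * bu i x) = Vf i (\<gamma> e) / e) ?F"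
      using pos
    proof eventually_elim
      case (elim e)
      show ?case unfolding Vf_def bl\<gamma> be\<gamma> al2[OF elim] fst\<gamma> snd\<gamma> using elim bpos
        by (simp add: field_simps power2_eq_square)
    qed
    moreover have "((\<lambda>e. al (\<gamma> e) / q * (B x * u $ i - e * U * bu i x)) \<longlongrightarrow> q / q * (B x * u $ i - 0 * U * bu i x)) ?F"
      by (intro tendsto_intros limal lime) (use bpos in auto)
    ultimately show ?thesis using bpos by (simp add: tendsto_cong)
  qed
  have d\<Delta>0: "dy l \<Delta> ?z = 0" for l
    unfolding dy_\<Delta>[OF z0] al0 bl0 ylz using bpos by simp
  have V0: "Vf i ?z = 0" for i
    unfolding Vf_def be0 al_sq[OF z0] Azz by simp

  let ?W = "\<lambda>i. Wf i ?z" and ?\<kappa> = "2 / U" and ?ul = "\<lambda>l. yl l (x, u)" and ?\<sigma> = "\<lambda>l. sl l x"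
  have sm_s0': "sm Z0 s0" by (rule sm_subset[OF sm_s0 Z0_\<Omega>])
  note limW = lim[OF sm_Wf] lim[OF sm_dd[OF sm_Wf]] lim[OF sm_dd[OF sm_dd[OF sm_Wf]]]
    lim[OF sm_dd[OF sm_\<Delta>]] lim[OF sm_dd[OF sm_dd[OF sm_\<Delta>]]]
    lim[OF sm_dd[OF sm_s0']] lim[OF sm_dd[OF sm_dd[OF sm_s0']]]
    lim[OF sm_Vf] lim[OF sm_dd[OF sm_Vf]]

  \<comment> \<open>The coefficients are of order e^-2, and each vertical derivative costs one more
    power of e; hence the weights 2, 3 and 4.\<close>
  have H0: "((\<lambda>e. e\<^sup>2 * H i (\<gamma> e)) \<longlongrightarrow> ?W i * ?\<kappa>) ?F" for i
  proof -
    have "eventually (\<lambda>e. Wf i (\<gamma> e) * E e = e\<^sup>2 * H i (\<gamma> e)) ?F"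
      using pos
    proof eventually_elim
      case (elim e) show ?case unfolding H_singular[OF inZd[OF elim]] s0\<gamma> E_def by simp
    qed
    moreover have "((\<lambda>e. Wf i (\<gamma> e) * E e) \<longlongrightarrow> ?W i * ?\<kappa>) ?F" by (intro tendsto_intros limW E)
    ultimately show ?thesis by (simp add: tendsto_cong)
  qed
  \<comment> \<open>Derivatives of \<Delta> in x need not vanish at b, so order e^-4 can occur,
    which is still beaten by the weight 6.\<close>
  have Hx: "((\<lambda>e. e ^ 6 * dx l (H i) (\<gamma> e)) \<longlongrightarrow> 0) ?F" for i l
  proof -
    let ?v = "(axis l 1, 0)"
    have "eventually (\<lambda>e. e\<^sup>2 * (e\<^sup>2 * dd ?v (Wf i) (\<gamma> e) * E e - Wf i (\<gamma> e) * dd ?v \<Delta> (\<gamma> e) * (E e)\<^sup>2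
        + dd ?v s0 (\<gamma> e) * Vf i (\<gamma> e) * (E e)\<^sup>2) = e ^ 6 * dx l (H i) (\<gamma> e)) ?F"
      using pos
    proof eventually_elim
      case (elim e)
      show ?case unfolding dd_H[OF inZd[OF elim]] s0\<gamma> E_def using Zd_nz[OF inZd[OF elim]]
        by (simp add: field_simps eval_nat_numeral)
    qed
    moreover have "((\<lambda>e. e\<^sup>2 * (e\<^sup>2 * dd ?v (Wf i) (\<gamma> e) * E e - Wf i (\<gamma> e) * dd ?v \<Delta> (\<gamma> e) * (E e)\<^sup>2
        + dd ?v s0 (\<gamma> e) * Vf i (\<gamma> e) * (E e)\<^sup>2))
       \<longlongrightarrow> 0\<^sup>2 * (0\<^sup>2 * dd ?v (Wf i) ?z * ?\<kappa> - ?W i * dd ?v \<Delta> ?z * ?\<kappa>\<^sup>2 + dd ?v s0 ?z * Vf i ?z * ?\<kappa>\<^sup>2)) ?F"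
      by (intro tendsto_intros limW E lime)
    ultimately show ?thesis by (simp add: tendsto_cong)
  qed
  have Hy: "((\<lambda>e. e ^ 3 * dy l (H i) (\<gamma> e)) \<longlongrightarrow> - ?W i * ?ul l * ?\<kappa>\<^sup>2 + ?\<sigma> l * (B x * u $ i) * ?\<kappa>\<^sup>2) ?F" for i l
  proof -
    have ds: "dy l s0 (\<gamma> e) = ?\<sigma> l" for e using x by (simp add: dy_s0 fst\<gamma>)
    have "eventually (\<lambda>e. e * dy l (Wf i) (\<gamma> e) * E e - Wf i (\<gamma> e) * (dy l \<Delta> (\<gamma> e) / e) * (E e)\<^sup>2
        + ?\<sigma> l * (Vf i (\<gamma> e) / e) * (E e)\<^sup>2 = e ^ 3 * dy l (H i) (\<gamma> e)) ?F"
      using pos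
    proof eventually_elim
      case (elim e)
      show ?case unfolding dd_H[OF inZd[OF elim]] s0\<gamma> ds E_def using Zd_nz[OF inZd[OF elim]] elim
        by (simp add: field_simps eval_nat_numeral)
    qed
    moreover have "((\<lambda>e. e * dy l (Wf i) (\<gamma> e) * E e - Wf i (\<gamma> e) * (dy l \<Delta> (\<gamma> e) / e) * (E e)\<^sup>2
        + ?\<sigma> l * (Vf i (\<gamma> e) / e) * (E e)\<^sup>2)
       \<longlongrightarrow> 0 * dy l (Wf i) ?z * ?\<kappa> - ?W i * ?ul l * ?\<kappa>\<^sup>2 + ?\<sigma> l * (B x * u $ i) * ?\<kappa>\<^sup>2) ?F"
      by (intro tendsto_intros limW E lime d\<Delta> V)
    ultimately show ?thesis by (simp add: tendsto_cong)
  qed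
  \<comment> \<open>The terms with \<Delta>^-3 carry a vertical derivative of \<Delta> or
    \<open>Vf\<close> as a factor, and these vanish at b; the rest is at most of order e^-4.\<close>
  have Hxy: "((\<lambda>e. e ^ 6 * dy m (dx l (H i)) (\<gamma> e)) \<longlongrightarrow> 0) ?F" for i l m
  proof -
    let ?v = "(axis l 1, 0)" and ?w = "(0, axis m 1)"
    let ?T = "\<lambda>E e z. e\<^sup>2 * (e\<^sup>2 * dd ?w (dd ?v (Wf i)) z * E
         - (dd ?v (Wf i) z * dd ?w \<Delta> z + dd ?w (Wf i) z * dd ?v \<Delta> z + Wf i z * dd ?w (dd ?v \<Delta>) z) * E\<^sup>2
         + (dd ?w (dd ?v s0) z * Vf i z + dd ?v s0 z * dd ?w (Vf i) z + dd ?w s0 z * dd ?v (Vf i) z) * E\<^sup>2)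
         + 2 * Wf i z * dd ?v \<Delta> z * dd ?w \<Delta> z * E ^ 3
         - 2 * Vf i z * (dd ?v s0 z * dd ?w \<Delta> z + dd ?w s0 z * dd ?v \<Delta> z) * E ^ 3"
    have "eventually (\<lambda>e. ?T (E e) e (\<gamma> e) = e ^ 6 * dy m (dx l (H i)) (\<gamma> e)) ?F"
      using pos
    proof eventually_elim
      case (elim e)
      show ?case unfolding dd_dd_H[OF inZd[OF elim] s0\<gamma>] E_def using Zd_nz[OF inZd[OF elim]]
        by (simp add: field_simps eval_nat_numeral)
    qed
    moreover have "((\<lambda>e. ?T (E e) e (\<gamma> e)) \<longlongrightarrow> ?T ?\<kappa> 0 ?z) ?F"
      by (intro tendsto_intros limW E lime)
    ultimately show ?thesis by (simp add: tendsto_cong d\<Delta>0 V0)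
  qed
  have Hyy: "((\<lambda>e. e ^ 4 * dy m (dy l (H i)) (\<gamma> e)) \<longlongrightarrow>
      - ?W i * (dy m (dy l \<Delta>) ?z) * ?\<kappa>\<^sup>2 + 2 * ?W i * ?ul l * ?ul m * ?\<kappa> ^ 3
      + (?\<sigma> l * dy m (Vf i) ?z + ?\<sigma> m * dy l (Vf i) ?z) * ?\<kappa>\<^sup>2
      - 2 * (B x * u $ i) * (?\<sigma> l * ?ul m + ?\<sigma> m * ?ul l) * ?\<kappa> ^ 3) ?F" for i l m
  proof -
    have ds: "dy l s0 (\<gamma> e) = ?\<sigma> l" for e l using x by (simp add: dy_s0 fst\<gamma>)
    have ds0: "dy l s0 ?z = ?\<sigma> l" for l using x by (simp add: dy_s0)
    let ?T = "\<lambda>E e z Dl Dm V. e\<^sup>2 * dy m (dy l (Wf i)) z * E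
         - (dy l (Wf i) z * dy m \<Delta> z + dy m (Wf i) z * dy l \<Delta> z + Wf i z * dy m (dy l \<Delta>) z) * E\<^sup>2
         + (dy m (dy l s0) z * Vf i z + ?\<sigma> l * dy m (Vf i) z + ?\<sigma> m * dy l (Vf i) z) * E\<^sup>2
         + 2 * Wf i z * Dl * Dm * E ^ 3
         - 2 * V * (?\<sigma> l * Dm + ?\<sigma> m * Dl) * E ^ 3"
    have "eventually (\<lambda>e. ?T (E e) e (\<gamma> e) (dy l \<Delta> (\<gamma> e) / e) (dy m \<Delta> (\<gamma> e) / e) (Vf i (\<gamma> e) / e)
        = e ^ 4 * dy m (dy l (H i)) (\<gamma> e)) ?F"
      using pos
    proof eventually_elim
      case (elim e)
      show ?case unfolding dd_dd_H[OF inZd[OF elim] s0\<gamma>] ds E_def using Zd_nz[OF inZd[OF elim]] elim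
        by (simp add: field_simps eval_nat_numeral)
    qed
    moreover have "((\<lambda>e. ?T (E e) e (\<gamma> e) (dy l \<Delta> (\<gamma> e) / e) (dy m \<Delta> (\<gamma> e) / e) (Vf i (\<gamma> e) / e))
        \<longlongrightarrow> ?T ?\<kappa> 0 ?z (?ul l) (?ul m) (B x * u $ i)) ?F"
      by (intro tendsto_intros limW E lime d\<Delta> V)
    ultimately show ?thesis by (simp add: tendsto_cong d\<Delta>0 V0 algebra_simps)
  qed

  have W: "?W i = - 3 * B x * su i x" for i
  proof -
    have D0: "\<Delta> ?z = 0" unfolding \<Delta>_def al0 bl0 be0 b2 by simp
    have t: "t i ?z = - su i x" using T_bu_general[OF x] by (simp add: t_def)
    have "(al ?z)\<^sup>2 = B x" unfolding al_sq[OF z0] Azz ..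
    moreover have "al ?z ^ 3 / bl ?z = B x" unfolding al0 bl0 using bpos b2 by (simp add: power3_eq_cube)
    ultimately show ?thesis unfolding Wf_def D0 t by simp
  qed
  have ddD: "dy l (dy i \<Delta>) ?z = a x $ i $ l - b x $ i * b x $ l / B x" for i l
  proof -
    have "q * (p / q - p' / q ^ 3) = p - p' / (q * q)" for p p'
      using bpos by (simp add: field_simps power3_eq_cube)
    from this[of "a x $ i $ l" "b x $ i * b x $ l"] show ?thesis
      unfolding dy_dy_\<Delta>[OF z0] al0 bl0 ylz b2 by simp
  qed
  have dV: "dy l (Vf i) ?z = B x * axis l 1 $ i - b x $ l * bu i x" for i l
    using dy_Vf[OF z0] be0 al_sq[OF z0] Azz by simp

  \<comment> \<open>By the following orthogonality relations every double sum below is 0 or a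
    multiple of s_i s^i.\<close>
  let ?S = "\<Sum>i\<in>UNIV. ?\<sigma> i * su i x" and ?s = "\<lambda>i. su i x"
  have f1: "(\<Sum>i\<in>UNIV. b x $ i * ?s i) = 0" by (rule b_su[OF x])
  have f2: "(\<Sum>i\<in>UNIV. ?ul i * ?s i) = 0" using yl_su[of "(x, u)"] x s0u by simp
  have f3: "(\<Sum>i\<in>UNIV. ?\<sigma> i * u $ i) = 0" using s0u by (simp add: s0_def)
  have f4: "(\<Sum>i\<in>UNIV. ?ul i * u $ i) = U" unfolding U_def using yl_y[of "(x, u)"] by simp
  have f5: "(\<Sum>i\<in>UNIV. b x $ i * bu i x) = B x" by (rule b_bu)
  have f6: "(\<Sum>i\<in>UNIV. bu i x * ?\<sigma> i) = 0" by (rule bu_sl)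
  have t1: "(\<Sum>i\<in>UNIV. \<Sum>l\<in>UNIV. ?s i * (a x $ i $ l * ?s l)) = ?S"
    unfolding sum_distrib_left[symmetric] a_su[OF x] by (simp add: mult.commute)
  have t1': "(\<Sum>i\<in>UNIV. \<Sum>l\<in>UNIV. (b x $ i * ?s i) * (b x $ l * ?s l)) = 0"
    unfolding sum_distrib_left[symmetric] f1 by simp
  have t2: "(\<Sum>i\<in>UNIV. \<Sum>l\<in>UNIV. (?ul i * ?s i) * (?ul l * ?s l)) = 0"
    unfolding sum_distrib_left[symmetric] f2 by simp
  have t3: "(\<Sum>i\<in>UNIV. \<Sum>l\<in>UNIV. ?\<sigma> i * (?s l * axis l 1 $ i)) = ?S"
    unfolding sum_distrib_left[symmetric] by simp
  have t3': "(\<Sum>i\<in>UNIV. \<Sum>l\<in>UNIV. (bu i x * ?\<sigma> i) * (b x $ l * ?s l)) = 0"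
    unfolding sum_distrib_left[symmetric] f1 by simp
  have t4: "(\<Sum>i::'n\<in>UNIV. \<Sum>l\<in>UNIV. ?\<sigma> l * ?s l) = real CARD('n) * ?S"
    by simp
  have t4': "(\<Sum>i\<in>UNIV. \<Sum>l\<in>UNIV. (b x $ i * bu i x) * (?\<sigma> l * ?s l)) = B x * ?S"
    unfolding sum_distrib_left[symmetric] sum_distrib_right[symmetric] f5 by simp
  have t5: "(\<Sum>i\<in>UNIV. \<Sum>l\<in>UNIV. (?\<sigma> i * u $ i) * (?ul l * ?s l)) = 0"
    unfolding sum_distrib_left[symmetric] f2 by simp
  have t5': "(\<Sum>i\<in>UNIV. \<Sum>l\<in>UNIV. (?ul i * u $ i) * (?\<sigma> l * ?s l)) = U * ?S"
    unfolding sum_distrib_left[symmetric] sum_distrib_right[symmetric] f4 by simp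
  have t6: "(\<Sum>i\<in>UNIV. \<Sum>l\<in>UNIV. (?\<sigma> i * ?s i) * (?ul l * u $ l)) = U * ?S"
    unfolding sum_distrib_left[symmetric] sum_distrib_right[symmetric] f4 by simp
  have t7: "(\<Sum>i\<in>UNIV. \<Sum>l\<in>UNIV. (?\<sigma> i * u $ i) * (?\<sigma> l * u $ l)) = 0"
    unfolding sum_distrib_left[symmetric] f3 by simp

  let ?M = "\<lambda>i l. - ?W i * ?ul l * ?\<kappa>\<^sup>2 + ?\<sigma> l * (B x * u $ i) * ?\<kappa>\<^sup>2"
  let ?L = "\<lambda>i l. - ?W i * (dy l (dy i \<Delta>) ?z) * ?\<kappa>\<^sup>2 + 2 * ?W i * ?ul i * ?ul l * ?\<kappa> ^ 3
      + (?\<sigma> i * dy l (Vf i) ?z + ?\<sigma> l * dy i (Vf i) ?z) * ?\<kappa>\<^sup>2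
      - 2 * (B x * u $ i) * (?\<sigma> i * ?ul l + ?\<sigma> l * ?ul i) * ?\<kappa> ^ 3"
  \<comment> \<open>The weight 6 splits as 2 + 4 for the coefficients times their second derivatives
    and as 3 + 3 for the products of first derivatives; the terms with derivatives in x tend to
    0.\<close>
  have limR: "((\<lambda>e. e ^ 6 * Rm H i i (\<gamma> e)) \<longlongrightarrow> 2 * 0 - (\<Sum>l\<in>UNIV. 0 * snd ?z $ l)
      + 2 * (\<Sum>l\<in>UNIV. (?W l * ?\<kappa>) * ?L i l) - (\<Sum>l\<in>UNIV. ?M i l * ?M l i)) ?F" for i
  proof -
    have e: "2 * (e ^ 6 * dx i (H i) (\<gamma> e)) - (\<Sum>l\<in>UNIV. (e ^ 6 * dy i (dx l (H i)) (\<gamma> e)) * snd (\<gamma> e) $ l)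
      + 2 * (\<Sum>l\<in>UNIV. (e\<^sup>2 * H l (\<gamma> e)) * (e ^ 4 * dy l (dy i (H i)) (\<gamma> e)))
      - (\<Sum>l\<in>UNIV. (e ^ 3 * dy l (H i) (\<gamma> e)) * (e ^ 3 * dy i (H l) (\<gamma> e))) = e ^ 6 * Rm H i i (\<gamma> e)" for e
      unfolding Rm_def by (simp add: algebra_simps sum_distrib_left eval_nat_numeral)
    show ?thesis
      unfolding e[symmetric]
      by (intro tendsto_intros Hx Hxy H0 Hyy Hy lim[OF sm_snd_nth])
  qed
  have "((\<lambda>e. \<Sum>i\<in>UNIV. e ^ 6 * Rm H i i (\<gamma> e)) \<longlongrightarrow> (\<Sum>i\<in>UNIV. 2 * 0 - (\<Sum>l\<in>UNIV. 0 * snd ?z $ l)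
      + 2 * (\<Sum>l\<in>UNIV. (?W l * ?\<kappa>) * ?L i l) - (\<Sum>l\<in>UNIV. ?M i l * ?M l i))) ?F"
    by (rule tendsto_sum) (rule limR)
  moreover have "((\<lambda>e. \<Sum>i\<in>UNIV. e ^ 6 * Rm H i i (\<gamma> e)) \<longlongrightarrow> 0 ^ 6 * (k * P ?z)) ?F"
  proof -
    have "eventually (\<lambda>e. e ^ 6 * (k * P (\<gamma> e)) = (\<Sum>i\<in>UNIV. e ^ 6 * Rm H i i (\<gamma> e))) ?F"
      using pos
    proof eventually_elim
      case (elim e)
      have z: "(x, Bu x + e *\<^sub>R u) \<in> Zs" using inZs[OF elim] by (simp add: \<gamma>_def)
      have "ricci Fs x (Bu x + e *\<^sub>R u) = (\<Sum>i\<in>UNIV. Rm H i i (\<gamma> e))"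
        unfolding ricci_def riemann_Fs[OF z] \<gamma>_def ..
      then show ?case using K[OF z] unfolding Fs_sq by (simp add: \<gamma>_def flip: sum_distrib_left)
    qed
    moreover have "((\<lambda>e. e ^ 6 * (k * P (\<gamma> e))) \<longlongrightarrow> 0 ^ 6 * (k * P ?z)) ?F"
      by (intro tendsto_intros lime lim[OF sm_P])
    ultimately show ?thesis by (simp only: tendsto_cong)
  qed
  ultimately have "(\<Sum>i\<in>UNIV. 2 * 0 - (\<Sum>l\<in>UNIV. 0 * snd ?z $ l)
      + 2 * (\<Sum>l\<in>UNIV. (?W l * ?\<kappa>) * ?L i l) - (\<Sum>l\<in>UNIV. ?M i l * ?M l i)) = 0 ^ 6 * (k * P ?z)"
    by (rule tendsto_unique[rotated]) simp
  then have eq: "2 * (\<Sum>i\<in>UNIV. \<Sum>l\<in>UNIV. (?W l * ?\<kappa>) * ?L i l) - (\<Sum>i\<in>UNIV. \<Sum>l\<in>UNIV. ?M i l * ?M l i) = 0"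
    by (simp add: sum_subtractf flip: sum_distrib_left)
  define \<kappa> where "\<kappa> = 2 / U"
  have \<kappa>: "\<kappa> > 0" "\<kappa> * U = 2" using U by (auto simp: \<kappa>_def)
  have aii: "axis i 1 $ i = (1::real)" for i :: 'n by (simp add: axis_def)
  have key: "(?W l * \<kappa>) * (- ?W i * (dy l (dy i \<Delta>) ?z) * \<kappa>\<^sup>2 + 2 * ?W i * ?ul i * ?ul l * \<kappa> ^ 3
      + (?\<sigma> i * dy l (Vf i) ?z + ?\<sigma> l * dy i (Vf i) ?z) * \<kappa>\<^sup>2
      - 2 * (B x * u $ i) * (?\<sigma> i * ?ul l + ?\<sigma> l * ?ul i) * \<kappa> ^ 3)
    = (- 9 * (B x)\<^sup>2 * \<kappa> ^ 3) * (?s i * (a x $ i $ l * ?s l)) + (9 * B x * \<kappa> ^ 3) * ((b x $ i * ?s i) * (b x $ l * ?s l))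
      + (18 * (B x)\<^sup>2 * \<kappa> ^ 4) * ((?ul i * ?s i) * (?ul l * ?s l))
      + (- 3 * (B x)\<^sup>2 * \<kappa> ^ 3) * (?\<sigma> i * (?s l * axis l 1 $ i)) + (3 * B x * \<kappa> ^ 3) * ((bu i x * ?\<sigma> i) * (b x $ l * ?s l))
      + (- 3 * (B x)\<^sup>2 * \<kappa> ^ 3) * (?\<sigma> l * ?s l) + (3 * B x * \<kappa> ^ 3) * ((b x $ i * bu i x) * (?\<sigma> l * ?s l))
      + (6 * (B x)\<^sup>2 * \<kappa> ^ 4) * ((?\<sigma> i * u $ i) * (?ul l * ?s l)) + (6 * (B x)\<^sup>2 * \<kappa> ^ 4) * ((?ul i * u $ i) * (?\<sigma> l * ?s l))" for i l
  proof -
    \<comment> \<open>Naming the quotient keeps the division by b^2 out of the algebra.\<close>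
    define h where "h = b x $ i * b x $ l / B x"
    have h': "b x $ i * b x $ l = B x * h" unfolding h_def using Bp by simp
    have h'': "b x $ i * ?s i * (b x $ l * ?s l) = B x * h * (?s i * ?s l)" unfolding h'[symmetric] by (simp add: mult_ac)
    show ?thesis unfolding ddD dV W aii h'' h_def[symmetric]
      by (simp add: algebra_simps eval_nat_numeral)
  qed
  have "(\<Sum>i\<in>UNIV. \<Sum>l\<in>UNIV. (?W l * ?\<kappa>) * ?L i l) = - 9 * (B x)\<^sup>2 * \<kappa> ^ 3 * ?S - 3 * (B x)\<^sup>2 * \<kappa> ^ 3 * ?S
      - 3 * (B x)\<^sup>2 * \<kappa> ^ 3 * (real CARD('n) * ?S) + 3 * B x * \<kappa> ^ 3 * (B x * ?S) + 6 * (B x)\<^sup>2 * \<kappa> ^ 4 * (U * ?S)"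
    unfolding \<kappa>_def[symmetric] key sum_comb9 t1 t1' t2 t3 t3' t4 t4' t5 t5' by simp
  moreover have "(\<Sum>i\<in>UNIV. \<Sum>l\<in>UNIV. ?M i l * ?M l i) = 6 * (B x)\<^sup>2 * \<kappa> ^ 4 * (U * ?S)"
  proof -
    have M: "?M i l * ?M l i = (9 * (B x)\<^sup>2 * \<kappa> ^ 4) * ((?ul i * ?s i) * (?ul l * ?s l)) + (3 * (B x)\<^sup>2 * \<kappa> ^ 4) * ((?\<sigma> i * ?s i) * (?ul l * u $ l))
       + (3 * (B x)\<^sup>2 * \<kappa> ^ 4) * ((?ul i * u $ i) * (?\<sigma> l * ?s l)) + ((B x)\<^sup>2 * \<kappa> ^ 4) * ((?\<sigma> i * u $ i) * (?\<sigma> l * u $ l))" for i l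
      unfolding W \<kappa>_def[symmetric] by (simp add: algebra_simps eval_nat_numeral)
    show ?thesis unfolding M sum_comb4 t2 t5' t6 t7 by simp
  qed
  \<comment> \<open>With \<kappa> U = 2 the coefficients add up to -24 - 6 n + 6 + 12 = -6 (n +
    1).\<close>
  ultimately have "- 24 * ((B x)\<^sup>2 * \<kappa> ^ 3 * ?S) - 6 * real CARD('n) * ((B x)\<^sup>2 * \<kappa> ^ 3 * ?S) + 6 * ((B x)\<^sup>2 * \<kappa> ^ 3 * ?S) + 6 * ((B x)\<^sup>2 * \<kappa> ^ 3 * ?S) * (\<kappa> * U) = 0"
    using eq by (simp add: algebra_simps eval_nat_numeral)
  then have "(B x)\<^sup>2 * \<kappa> ^ 3 * ?S * (real CARD('n) + 1) = 0"
    unfolding \<kappa>(2) by (simp add: algebra_simps)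
  then have "?S = 0" using Bp \<kappa> by (simp add: add_eq_0_iff)
  then show ?thesis by (rule sl_norm_zero_imp_zero[OF x])
qed

end

section \<open>Localisation and the remaining facts in a chart\<close>

lemma Ck_on_subset: "Ck_on k S f \<Longrightarrow> U \<subseteq> S \<Longrightarrow> Ck_on k U f"
  by (induction k arbitrary: f) (auto intro: continuous_on_subset)

lemma smooth_on_subset: "smooth_on S f \<Longrightarrow> U \<subseteq> S \<Longrightarrow> smooth_on U f"
  unfolding smooth_on_def using Ck_on_subset by blast

context sq_chart
begin

lemma s_partial: assumes x: "x \<in> S"
  shows "s i j x = 1/2 * (partial j (\<lambda>u. b u $ i) x - partial i (\<lambda>u. b u $ j) x)"
  unfolding s_def cov_deriv_def by (simp add: Gam_sym[OF x, of _ i j])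

text \<open>Symmetry of the second derivatives of b^2 says d(c \<beta>) = 0, that is, dc \<and>
  \<beta> + c d\<beta> = 0. Contraction with b, where s_i = 0 is used, makes dc proportional to
  \<beta>, so the first term vanishes by itself.\<close>

lemma c_s_zero:
  assumes sl0: "\<And>x k. x \<in> S \<Longrightarrow> sl k x = 0" and x: "x \<in> S"
  shows "c x * s l k x = 0"
proof -
  let ?dc = "\<lambda>k. partial k c x" and ?db = "\<lambda>k l. partial k (\<lambda>u. b u $ l) x"
  have 1: "dd (axis k 1) (dd (axis l 1) B) x = 2 * (?dc k * b x $ l + c x * ?db k l)" for k l
  proof -
    note d = sm_differentiable[OF sm_c x] sm_differentiable[OF sm_b x]
    have "dd (axis k 1) (dd (axis l 1) B) x = dd (axis k 1) (\<lambda>x. 2 * (c x * b x $ l)) x"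
      by (rule dd_cong[OF open_S x]) (use partial_B sl0 in \<open>simp add: partial_eq_dd\<close>)
    also have "\<dots> = 2 * dd (axis k 1) (\<lambda>x. c x * b x $ l) x"
      by (rule dd_cmult) (intro differentiable_mult d)
    finally show ?thesis by (simp add: dd_mult d partial_eq_dd)
  qed
  have 2: "?dc k * b x $ l - ?dc l * b x $ k + 2 * (c x * s l k x) = 0" for k l
    using dd_commute[OF open_S sm_B x, of "axis k 1" "axis l 1"]
    unfolding 1 s_partial[OF x] by (simp add: algebra_simps)
  have 3: "?dc k * B x = (\<Sum>l\<in>UNIV. ?dc l * bu l x) * b x $ k" for k
  proof -
    have "(\<Sum>l\<in>UNIV. bu l x * (?dc k * b x $ l - ?dc l * b x $ k + 2 * (c x * s l k x))) = 0" by (simp only: 2) simp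
    then have "?dc k * (\<Sum>l\<in>UNIV. bu l x * b x $ l) - (\<Sum>l\<in>UNIV. ?dc l * bu l x) * b x $ k
        + 2 * c x * (\<Sum>l\<in>UNIV. bu l x * s l k x) = 0"
      by (simp add: algebra_simps sum.distrib sum_subtractf sum_distrib_left sum_distrib_right)
    then show ?thesis using sl0[OF x, of k] by (simp add: sl_def B_def)
  qed
  have "B x * (?dc k * b x $ l) = B x * (?dc l * b x $ k)"
  proof -
    have "B x * (?dc k * b x $ l) = (?dc k * B x) * b x $ l" by simp
    also have "\<dots> = (?dc l * B x) * b x $ k" unfolding 3 by simp
    finally show ?thesis by simp
  qed
  then have "?dc k * b x $ l = ?dc l * b x $ k" using B_pos[OF x] by simp
  then show ?thesis using 2[of k l] by simp
qed

text \<open>The Killing argument differentiates consequences of c = 0 and s_i = 0 and so needs them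
  on an open set; the chart is shrunk to such a set.\<close>

lemma restrict_chart:
  assumes "open U" "U \<subseteq> S" shows "sq_chart U a b c"
proof unfold_locales
  show "smooth_on U (\<lambda>x. a x $ i $ j)" "smooth_on U (\<lambda>x. b x $ i)" for i j
    using smooth_on_subset[OF _ assms(2)] smooth_a smooth_b by auto
qed (use assms sym_a pos_a b_nz conf card3 in auto)

lemma parallel_of_constant_ricci:
  assumes K: "\<And>x y. (x, y) \<in> Zs \<Longrightarrow> ricci Fs x y = k * (Fs x y)\<^sup>2" and x: "x \<in> S"
  shows "s i j x = 0"
proof (rule ccontr)
  assume nz: "s i j x \<noteq> 0"
  have sl0: "sl k x = 0" if "x \<in> S" for x k using singular_directions[OF that K] .
  \<comment> \<open>On \<open>U\<close> the component s_ij is nonzero, so c vanishes there by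
    \<open>c_s_zero\<close>, and \<open>Killing_parallel\<close> yields the contradiction.\<close>
  define U where "U = S \<inter> s i j -` (- {0})"
  have U: "open U" "U \<subseteq> S" "x \<in> U"
    unfolding U_def using x nz continuous_open_preimage[OF sm_continuous_on[OF sm_s] open_S, of "- {0}"] by auto
  interpret U: sq_chart U a b c by (rule restrict_chart[OF U(1,2)])
  have "U.Zs \<subseteq> Zs" using U(2) unfolding U.Zs_def U.Zd_def U.Z0_def Zs_def Zd_def Z0_def by auto
  then have "s i j x = 0"
    using U.Killing_parallel[OF _ _ U(3), of k i j] c_s_zero[OF sl0, of _ i j] sl0 U(2) K
    by (fastforce simp: U_def)
  with nz show False by simp
qed

text \<open>Euler's relation for homogeneity of degree one; the trace of the flag curvature equation
  requires it.\<close>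

lemma Fs_homogeneous: assumes z: "(x, y) \<in> Z0"
  shows "(\<Sum>k\<in>UNIV. y $ k * partial k (Fs x) y) = Fs x y"
proof -
  let ?z = "(x, y)"
  have al: "al ?z > 0" using al_pos[OF z] .
  have dF: "partial k (Fs x) y = 2 * r ?z * rho k ?z / al ?z - (r ?z)\<^sup>2 * yl k ?z / al ?z ^ 3" for k
  proof -
    have "sm Z0 (\<lambda>z. (r z)\<^sup>2 / al z)" by (intro sm_divide sm_power open_Z0 sm_r sm_al) (use al_nz in auto)
    then have "partial k (Fs x) y = dy k (\<lambda>z. (r z)\<^sup>2 / al z) ?z"
      by (intro partial_snd_cong[OF open_Z0 z]) (simp add: Fs_def)
    also have "\<dots> = 2 * r ?z * dy k r ?z / al ?z - (r ?z)\<^sup>2 * dy k al ?z / (al ?z)\<^sup>2"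
      by (rule dd_eqI[THEN trans])
         (use al in \<open>auto intro!: derivative_eq_intros hd_al[OF z] hd_r[OF z] simp: field_simps eval_nat_numeral\<close>)
    finally show ?thesis using al by (simp add: dy_r[OF z] dy_al[OF z] field_simps eval_nat_numeral)
  qed
  have yy: "(\<Sum>k\<in>UNIV. y $ k * yl k ?z) = al ?z * al ?z"
    using al_sq[OF z] by (simp add: Aq_def power2_eq_square)
  have yr: "(\<Sum>k\<in>UNIV. y $ k * rho k ?z) = r ?z"
    using rho_sum[of ?z "\<lambda>l. y $ l"] b_y[of ?z] yy al by (simp add: r_def mult.commute)
  have "(\<Sum>k\<in>UNIV. y $ k * partial k (Fs x) y)
     = 2 * r ?z / al ?z * (\<Sum>k\<in>UNIV. y $ k * rho k ?z) - (r ?z)\<^sup>2 / al ?z ^ 3 * (\<Sum>k\<in>UNIV. y $ k * yl k ?z)"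
    unfolding dF by (simp add: right_diff_distrib sum_subtractf sum_distrib_left sum_divide_distrib mult_ac)
  then show ?thesis unfolding yy yr Fs_def using al by (simp add: field_simps eval_nat_numeral)
qed

lemma flag_imp_ricci:
  assumes z: "(x, y) \<in> Zs"
    and K: "\<And>i k. riemann Fs x y $ i $ k = K * ((Fs x y)\<^sup>2 * (if i = k then 1 else 0) - Fs x y * y $ i * partial k (Fs x) y)"
  shows "ricci Fs x y = (real CARD('n) - 1) * K * (Fs x y)\<^sup>2"
proof -
  have "ricci Fs x y = (\<Sum>m::'n\<in>UNIV. K * (Fs x y)\<^sup>2) - K * Fs x y * (\<Sum>m\<in>UNIV. y $ m * partial m (Fs x) y)"
    unfolding ricci_def K by (simp add: sum_subtractf right_diff_distrib sum_distrib_left mult_ac)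
  then show ?thesis
    unfolding Fs_homogeneous[OF Zs_Z0[OF z]] by (simp add: algebra_simps power2_eq_square)
qed

lemma fc_sq: "x \<in> S \<Longrightarrow> (c x)\<^sup>2 = (fc x)\<^sup>2 * B x"
  using B_pos[of x] by (simp add: fc_def power_divide)

lemma dfc_zero:
  assumes e: "\<And>x. x \<in> S \<Longrightarrow> (c x)\<^sup>2 = - \<mu> * B x" and x: "x \<in> S"
  shows "partial k fc x = 0" "(fc x)\<^sup>2 = - \<mu>"
proof -
  have f: "(fc x)\<^sup>2 = - \<mu>" if "x \<in> S" for x
  proof -
    have "(fc x)\<^sup>2 * B x = (- \<mu>) * B x" using e[OF that] fc_sq[OF that] by simp
    then show ?thesis by (subst (asm) mult_cancel_right) (use B_pos[OF that] in simp)
  qed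
  show "(fc x)\<^sup>2 = - \<mu>" by (rule f[OF x])
  show "partial k fc x = 0"
  \<comment> \<open>For \<mu> = 0 the function f is identically zero, and 2 f df = 0 cannot be
    divided by it.\<close>
  proof (cases "\<mu> = 0")
    case True
    have "partial k fc x = partial k (\<lambda>x. 0) x"
      by (rule partial_cong[OF open_S x]) (use f True in auto)
    then show ?thesis by (simp add: partial_eq_dd)
  next
    case False
    note d = sm_differentiable[OF sm_fc x]
    have "2 * (fc x * partial k fc x) = partial k (\<lambda>x. (fc x)\<^sup>2) x"
      unfolding partial_eq_dd by (simp add: dd_power d)
    also have "\<dots> = partial k (\<lambda>x. - \<mu>) x" by (rule partial_cong[OF open_S x]) (rule f)
    finally have "fc x * partial k fc x = 0" by (simp add: partial_eq_dd)
    moreover have "fc x \<noteq> 0" using f[OF x] False by auto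
    ultimately show ?thesis by simp
  qed
qed

text \<open>The chart image need not be connected, so constancy is claimed near each point only;
  connectedness of M enters in \<open>ratio_constant\<close>.\<close>

lemma fc_locally_constant:
  assumes d: "\<And>x k. x \<in> S \<Longrightarrow> partial k fc x = 0" and x: "x \<in> S"
  obtains V where "open V" "x \<in> V" "V \<subseteq> S" "\<And>u. u \<in> V \<Longrightarrow> fc u = fc x"
proof -
  obtain e where e: "e > 0" "ball x e \<subseteq> S" using open_S x open_contains_ball by blast
  have "fc u = fc x" if "u \<in> ball x e" for u
  proof (rule has_derivative_zero_unique[OF convex_ball, of x e fc])
    show "(fc has_derivative (\<lambda>h. 0)) (at v within ball x e)" if "v \<in> ball x e" for v
    proof -
      have v: "v \<in> S" using that e by blast
      have "(\<lambda>h. dd h fc v) = (\<lambda>h. 0)"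
      proof
        fix h show "dd h fc v = 0"
          using dd_axis[OF sm_differentiable[OF sm_fc v], of h] d[OF v] by (simp flip: partial_eq_dd)
      qed
      then show ?thesis using has_derivative_at_withinI[OF sm_has_derivative[OF sm_fc v], of "ball x e"] by (simp only:)
    qed
  qed (use that e in auto)
  from that[OF open_ball _ e(2) this] e(1) show ?thesis by simp
qed

end

section \<open>From charts to the manifold\<close>

locale sq_manifold =
  fixes M :: "'m topology" and \<A> :: "('m, 'n::finite) chart set"
    and a :: "('m, 'n) chart \<Rightarrow> real^'n \<Rightarrow> real^'n^'n" and b :: "('m, 'n) chart \<Rightarrow> real^'n \<Rightarrow> real^'n"
    and c :: "'m \<Rightarrow> real"
  assumes mfd: "smooth_manifold M \<A>" and conn: "connected_space M" and card: "CARD('n) \<ge> 3"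
    and met: "riemannian_metric \<A> a" and form: "one_form \<A> b" and nv: "nowhere_vanishing \<A> b"
    and cf: "conformal_form \<A> a b c"
begin

definition cc :: "('m, 'n) chart \<Rightarrow> real^'n \<Rightarrow> real" where "cc C x = c (inv_into (fst C) (snd C) x)"

lemma chart_props:
  assumes "C \<in> \<A>"
  shows "openin M (fst C)" "open (snd C ` fst C)" "inj_on (snd C) (fst C)"
    "homeomorphic_map (subtopology M (fst C)) (top_of_set (snd C ` fst C)) (snd C)"
proof -
  have ch: "is_chart M C" using mfd assms by (simp add: smooth_manifold_def)
  then show 1: "openin M (fst C)" "open (snd C ` fst C)"
    and 2: "homeomorphic_map (subtopology M (fst C)) (top_of_set (snd C ` fst C)) (snd C)"
    by (auto simp: is_chart_def case_prod_beta)
  have "topspace (subtopology M (fst C)) = fst C" using openin_subset[OF 1(1)] by auto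
  then show "inj_on (snd C) (fst C)" using homeomorphic_imp_injective_map[OF 2] by simp
qed

lemma cc_eq: "C \<in> \<A> \<Longrightarrow> p \<in> fst C \<Longrightarrow> cc C (snd C p) = c p"
  unfolding cc_def using chart_props(3) by simp

lemma sq_chart: assumes C: "C \<in> \<A>" shows "sq_chart (snd C ` fst C) (a C) (b C) (cc C)"
proof unfold_locales
  show "open (snd C ` fst C)" by (rule chart_props(2)[OF C])
  show "smooth_on (snd C ` fst C) (\<lambda>x. a C x $ i $ j)" for i j using met C unfolding riemannian_metric_def by blast
  show "a C x $ i $ j = a C x $ j $ i" if "x \<in> snd C ` fst C" for x i j using met C that unfolding riemannian_metric_def by blast
  show "0 < y \<bullet> (a C x *v y)" if "x \<in> snd C ` fst C" "y \<noteq> 0" for x y using met C that unfolding riemannian_metric_def by blast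
  show "smooth_on (snd C ` fst C) (\<lambda>x. b C x $ i)" for i using form C unfolding one_form_def by blast
  show "b C x \<noteq> 0" if "x \<in> snd C ` fst C" for x using nv C that unfolding nowhere_vanishing_def by blast
  show "1/2 * (cov_deriv (a C) (b C) x i j + cov_deriv (a C) (b C) x j i) = cc C x * a C x $ i $ j"
    if x: "x \<in> snd C ` fst C" for x i j
  proof -
    obtain p where p: "p \<in> fst C" "x = snd C p" using x by blast
    then show ?thesis using cf C cc_eq[OF C p(1)] unfolding conformal_form_def by auto
  qed
qed (rule card)

lemma alpha_eq: "alpha a C = sq_chart.Fa (a C)" if C: "C \<in> \<A>"
proof -
  interpret sq_chart "snd C ` fst C" "a C" "b C" "cc C" by (rule sq_chart[OF C])
  show ?thesis
    by (intro ext) (simp add: alpha_def Fa_def al_def Aq_def yl_def sum_distrib_left mult_ac)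
qed

lemma form_length_eq: "form_length a b C x = sqrt (sq_chart.B (a C) (b C) x)" if C: "C \<in> \<A>"
proof -
  interpret sq_chart "snd C ` fst C" "a C" "b C" "cc C" by (rule sq_chart[OF C])
  show ?thesis by (simp add: form_length_def B_def bu_def sum_ac)
qed

lemma metric_eq: "singular_square_metric a b C = sq_chart.Fs (a C) (b C)" if C: "C \<in> \<A>"
proof -
  interpret sq_chart "snd C ` fst C" "a C" "b C" "cc C" by (rule sq_chart[OF C])
  show ?thesis
    by (intro ext) (simp add: singular_square_metric_def Fs_def r_def bl_def be_def beta_def
        form_length_eq[OF C] alpha_eq[OF C] Fa_def)
qed

lemma closed_form_iff:
  "closed_form \<A> b \<longleftrightarrow> (\<forall>C\<in>\<A>. \<forall>x\<in>snd C ` fst C. \<forall>i j. sq_chart.s (a C) (b C) i j x = 0)"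
proof -
  have "(\<forall>i j. partial i (\<lambda>u. b C u $ j) x = partial j (\<lambda>u. b C u $ i) x) \<longleftrightarrow> (\<forall>i j. sq_chart.s (a C) (b C) i j x = 0)"
    if C: "C \<in> \<A>" and x: "x \<in> snd C ` fst C" for C x
  proof -
    interpret sq_chart "snd C ` fst C" "a C" "b C" "cc C" by (rule sq_chart[OF C])
    show ?thesis unfolding s_partial[OF x] by auto
  qed
  then show ?thesis unfolding closed_form_def by blast
qed

text \<open>With J the Jacobian, the metrics satisfy a_C = J^T a_D J and the forms b_C = J^T b_D.
  Hence J carries the vector b^i of C to that of D, and the pairing b_i b^i is preserved.\<close>

lemma form_length_invariant:
  assumes C: "C \<in> \<A>" and D: "D \<in> \<A>" and p: "p \<in> fst C" "p \<in> fst D"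
  shows "form_length a b C (snd C p) = form_length a b D (snd D p)"
proof -
  interpret C: sq_chart "snd C ` fst C" "a C" "b C" "cc C" by (rule sq_chart[OF C])
  interpret D: sq_chart "snd D ` fst D" "a D" "b D" "cc D" by (rule sq_chart[OF D])
  let ?x = "snd C p" and ?y = "snd D p"
  have x: "?x \<in> snd C ` fst C" and y: "?y \<in> snd D ` fst D" using p by auto
  let ?J = "jac C D ?x"
  have a: "a C ?x $ i $ j = (\<Sum>k\<in>UNIV. \<Sum>l\<in>UNIV. a D ?y $ k $ l * ?J $ k $ i * ?J $ l $ j)" for i j
    using met C D p unfolding riemannian_metric_def by blast
  have b: "b C ?x $ i = (\<Sum>k\<in>UNIV. b D ?y $ k * ?J $ k $ i)" for i
    using form C D p unfolding one_form_def by blast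
  have aM: "a C ?x = transpose ?J ** a D ?y ** ?J"
    unfolding vec_eq_iff
  proof (intro allI)
    fix i j
    have "a C ?x $ i $ j = (\<Sum>l\<in>UNIV. \<Sum>k\<in>UNIV. a D ?y $ k $ l * ?J $ k $ i * ?J $ l $ j)"
      unfolding a by (rule sum.swap)
    then show "a C ?x $ i $ j = (transpose ?J ** a D ?y ** ?J) $ i $ j"
      by (simp add: matrix_matrix_mult_def transpose_def sum_ac)
  qed
  have bM: "b C ?x = transpose ?J *v b D ?y"
    unfolding vec_eq_iff b matrix_vector_mult_def transpose_def by (simp add: mult.commute)
  \<comment> \<open>Invertibility of the Jacobian comes from the transformation rule of the metric:
    the nonzero determinant of a_C contains det J as a factor.\<close>
  have Jinv: "invertible (transpose ?J)"
  proof -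
    have "det (a C ?x) \<noteq> 0" using C.invertible_a[OF x] invertible_det_nz by blast
    then have "det ?J \<noteq> 0" unfolding aM by (simp add: det_mul)
    then show ?thesis by (simp add: invertible_det_nz det_transpose)
  qed
  have aB: "a C ?x *v C.Bu ?x = b C ?x"
    using C.a_bu[OF x] by (simp add: vec_eq_iff matrix_vector_mult_def)
  have aB': "a D ?y *v D.Bu ?y = b D ?y"
    using D.a_bu[OF y] by (simp add: vec_eq_iff matrix_vector_mult_def)
  let ?v = "?J *v C.Bu ?x"
  have "transpose ?J *v (a D ?y *v ?v) = transpose ?J *v b D ?y"
    using aB unfolding aM bM by (simp add: matrix_vector_mul_assoc matrix_mul_assoc)
  then have "transpose ?J *v (a D ?y *v ?v - b D ?y) = 0" by (simp add: matrix_vector_mult_diff_distrib)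
  then have "a D ?y *v ?v = b D ?y"
    using Jinv matrix_left_invertible_ker[of "transpose ?J"] invertible_left_inverse[of "transpose ?J"] by auto
  then have "a D ?y *v (?v - D.Bu ?y) = 0" using aB' by (simp add: matrix_vector_mult_diff_distrib)
  then have "?v - D.Bu ?y = 0" by (rule D.a_ker[OF y])
  then have v: "?v = D.Bu ?y" by simp
  have "C.B ?x = C.Bu ?x \<bullet> b C ?x" by (simp add: C.B_def inner_vec_def)
  also have "\<dots> = ?v \<bullet> b D ?y" unfolding bM by (simp add: dot_lmul_matrix[symmetric] transpose_matrix_vector inner_commute)
  also have "\<dots> = D.B ?y" unfolding v by (simp add: D.B_def inner_vec_def)
  finally show ?thesis by (simp add: form_length_eq C D)
qed

text \<open>f^2 = c^2 / b^2 as a function on M. By \<open>form_length_invariant\<close> it does not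
  matter which chart is chosen.\<close>

definition ratio :: "'m \<Rightarrow> real" where
  "ratio p = (c p)\<^sup>2 / (form_length a b (SOME C. C \<in> \<A> \<and> p \<in> fst C) (snd (SOME C. C \<in> \<A> \<and> p \<in> fst C) p))\<^sup>2"

lemma ratio_eq:
  assumes C: "C \<in> \<A>" and p: "p \<in> fst C"
  shows "ratio p = (sq_chart.fc (a C) (b C) (cc C) (snd C p))\<^sup>2"
proof -
  interpret C: sq_chart "snd C ` fst C" "a C" "b C" "cc C" by (rule sq_chart[OF C])
  have x: "snd C p \<in> snd C ` fst C" using p by auto
  define D where "D = (SOME C. C \<in> \<A> \<and> p \<in> fst C)"
  have D: "D \<in> \<A>" "p \<in> fst D"
    using someI[of "\<lambda>C. C \<in> \<A> \<and> p \<in> fst C" C] C p unfolding D_def by auto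
  have "(form_length a b D (snd D p))\<^sup>2 = C.B (snd C p)"
    unfolding form_length_invariant[OF C D(1) p D(2), symmetric] form_length_eq[OF C] using C.B_pos[OF x] by simp
  then show ?thesis
    unfolding ratio_def D_def[symmetric] using C.fc_sq[OF x] C.B_pos[OF x] cc_eq[OF C p] by simp
qed

text \<open>A locally constant function on a connected space is constant: a level set and its
  complement are both open.\<close>

lemma ratio_constant:
  assumes d: "\<And>C x k. C \<in> \<A> \<Longrightarrow> x \<in> snd C ` fst C \<Longrightarrow> partial k (sq_chart.fc (a C) (b C) (cc C)) x = 0"
  obtains m where "\<And>p. p \<in> topspace M \<Longrightarrow> ratio p = m"
proof (cases "topspace M = {}")
  case False
  then obtain q where q: "q \<in> topspace M" by blast
  have nbhd: "\<exists>W. openin M W \<and> p \<in> W \<and> (\<forall>w\<in>W. ratio w = ratio p)" if p: "p \<in> topspace M" for p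
  proof -
    obtain C where C: "C \<in> \<A>" "p \<in> fst C" using mfd p unfolding smooth_manifold_def by blast
    interpret C: sq_chart "snd C ` fst C" "a C" "b C" "cc C" by (rule sq_chart[OF C(1)])
    have x: "snd C p \<in> snd C ` fst C" using C by auto
    obtain V where V: "open V" "snd C p \<in> V" "V \<subseteq> snd C ` fst C" "\<And>u. u \<in> V \<Longrightarrow> C.fc u = C.fc (snd C p)"
      using C.fc_locally_constant[OF d[OF C(1)] x] by blast
    have "continuous_map (subtopology M (fst C)) (top_of_set (snd C ` fst C)) (snd C)"
      using chart_props(4)[OF C(1)] homeomorphic_imp_continuous_map by blast
    moreover have "openin (top_of_set (snd C ` fst C)) V" using V by (auto simp: openin_open)
    ultimately have "openin (subtopology M (fst C)) {w \<in> topspace (subtopology M (fst C)). snd C w \<in> V}"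
      by (rule openin_continuous_map_preimage)
    then have 1: "openin M {w \<in> topspace (subtopology M (fst C)). snd C w \<in> V}" (is "openin M ?W")
      using chart_props(1)[OF C(1)] openin_trans_full by blast
    have 2: "p \<in> ?W" using p C(2) V(2) by simp
    have 3: "ratio w = ratio p" if "w \<in> ?W" for w
    proof -
      have w: "w \<in> fst C" "snd C w \<in> V" using that by auto
      show ?thesis unfolding ratio_eq[OF C(1) w(1)] ratio_eq[OF C] V(4)[OF w(2)] by (rule refl)
    qed
    show ?thesis using 1 2 3 by blast
  qed
  let ?E = "{p \<in> topspace M. ratio p = ratio q}" and ?E' = "{p \<in> topspace M. ratio p \<noteq> ratio q}"
  have E: "openin M ?E"
  proof (subst openin_subopen, intro ballI)
    fix p assume p: "p \<in> ?E"
    then obtain W where W: "openin M W" "p \<in> W" "\<forall>w\<in>W. ratio w = ratio p" using nbhd[of p] by auto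
    then have "W \<subseteq> ?E" using p openin_subset[OF W(1)] by fastforce
    then show "\<exists>T. openin M T \<and> p \<in> T \<and> T \<subseteq> ?E" using W(1,2) by blast
  qed
  have E': "openin M ?E'"
  proof (subst openin_subopen, intro ballI)
    fix p assume p: "p \<in> ?E'"
    then obtain W where W: "openin M W" "p \<in> W" "\<forall>w\<in>W. ratio w = ratio p" using nbhd[of p] by auto
    then have "W \<subseteq> ?E'" using p openin_subset[OF W(1)] by fastforce
    then show "\<exists>T. openin M T \<and> p \<in> T \<and> T \<subseteq> ?E'" using W(1,2) by blast
  qed
  have "closedin M ?E"
  proof -
    have "topspace M - ?E = ?E'" by auto
    then show ?thesis using E' by (simp add: closedin_def)
  qed
  then have "?E = topspace M" using E conn q unfolding connected_space_clopen_in by blast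
  then show ?thesis using that[of "ratio q"] by blast
qed (use that in blast)

lemma chart_in_topspace: "C \<in> \<A> \<Longrightarrow> p \<in> fst C \<Longrightarrow> p \<in> topspace M"
  using chart_props(1) openin_subset by blast

text \<open>The last conjunct, K = 0 together with f^2 = -\<mu> and df = 0, is carried along for
  \<open>constant_flag_imp\<close>.\<close>

lemma constant_ricci_imp:
  assumes K: "constant_ricci \<A> (singular_square_metric a b) K"
  shows "\<exists>\<mu>. constant_ricci \<A> (alpha a) \<mu> \<and> closed_form \<A> b \<and>
    (\<forall>C\<in>\<A>. \<forall>p\<in>fst C. (c p)\<^sup>2 = - \<mu> * (form_length a b C (snd C p))\<^sup>2) \<and>
    (\<forall>C\<in>\<A>. \<forall>x\<in>snd C ` fst C. K = 0 \<and> (sq_chart.fc (a C) (b C) (cc C) x)\<^sup>2 = - \<mu>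
       \<and> (\<forall>k. partial k (sq_chart.fc (a C) (b C) (cc C)) x = 0))"
proof -
  have loc: "(\<forall>i j. sq_chart.s (a C) (b C) i j x = 0) \<and> K = 0 \<and> (\<forall>k. partial k (sq_chart.fc (a C) (b C) (cc C)) x = 0)
     \<and> (\<forall>y. y \<noteq> 0 \<longrightarrow> ricci (alpha a C) x y = - (real CARD('n) - 1) * (sq_chart.fc (a C) (b C) (cc C) x)\<^sup>2 * (alpha a C x y)\<^sup>2)"
    if C: "C \<in> \<A>" and x: "x \<in> snd C ` fst C" for C x
  proof -
    interpret sq_chart "snd C ` fst C" "a C" "b C" "cc C" by (rule sq_chart[OF C])
    have R: "ricci Fs x y = (real CARD('n) - 1) * K * (Fs x y)\<^sup>2" if "(x, y) \<in> Zs" for x y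
    proof -
      have xS: "x \<in> snd C ` fst C" using Z0_S[OF Zs_Z0[OF that]] by simp
      then show ?thesis
        using K C nondegenerate_Fs[OF xS, of y] that unfolding constant_ricci_def metric_eq[OF C, symmetric] by blast
    qed
    have s: "s i j x = 0" if "x \<in> snd C ` fst C" for x i j
      by (rule parallel_of_constant_ricci[OF R that])
    note cl = ricci_const_closed[OF s x R]
    have "ricci (alpha a C) x y = - (real CARD('n) - 1) * (fc x)\<^sup>2 * (alpha a C x y)\<^sup>2" if "y \<noteq> 0" for y
    proof -
      have z: "(x, y) \<in> Z0" using x that by (simp add: Z0_def)
      show ?thesis unfolding alpha_eq[OF C] ricci_Fa[OF z] Fa_sq[OF z] by (rule cl(3))
    qed
    then show ?thesis using s[OF x] cl(1,2) by blast
  qed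
  obtain m where m: "\<And>p. p \<in> topspace M \<Longrightarrow> ratio p = m" using ratio_constant loc by blast
  have fc: "(sq_chart.fc (a C) (b C) (cc C) x)\<^sup>2 = m" if C: "C \<in> \<A>" and x: "x \<in> snd C ` fst C" for C x
    using m chart_in_topspace[OF C] ratio_eq[OF C] x by auto
  show ?thesis
  proof (intro exI[of _ "- m"] conjI ballI)
    show "constant_ricci \<A> (alpha a) (- m)"
      unfolding constant_ricci_def nondegenerate_def using loc fc by (simp add: algebra_simps)
    show "closed_form \<A> b" unfolding closed_form_iff using loc by blast
    show "(c p)\<^sup>2 = - (- m) * (form_length a b C (snd C p))\<^sup>2" if C: "C \<in> \<A>" and p: "p \<in> fst C" for C p
    proof -
      interpret sq_chart "snd C ` fst C" "a C" "b C" "cc C" by (rule sq_chart[OF C])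
      have x: "snd C p \<in> snd C ` fst C" using p by auto
      show ?thesis using fc_sq[OF x] fc[OF C x] B_pos[OF x] unfolding cc_eq[OF C p] form_length_eq[OF C] by simp
    qed
  qed (use loc fc in \<open>simp_all del: ball_simps image_iff\<close>)
qed

text \<open>Stated for the full Riemann tensor so that it serves both converses: flag curvature
  directly, Ricci curvature after taking the trace.\<close>

lemma converse_chart:
  assumes C: "C \<in> \<A>" and x: "x \<in> snd C ` fst C" and cl: "closed_form \<A> b"
    and mu: "\<forall>C\<in>\<A>. \<forall>p\<in>fst C. (c p)\<^sup>2 = - \<mu> * (form_length a b C (snd C p))\<^sup>2"
    and nd: "nondegenerate (singular_square_metric a b C) x y"
  shows "riemann (singular_square_metric a b C) x y $ i $ k = riemann (alpha a C) x y $ i $ k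
     - \<mu> * ((alpha a C x y)\<^sup>2 * (if i = k then 1 else 0) - y $ i * (\<Sum>j\<in>UNIV. a C x $ k $ j * y $ j))"
proof -
  interpret sq_chart "snd C ` fst C" "a C" "b C" "cc C" by (rule sq_chart[OF C])
  have s: "s i j x = 0" if "x \<in> snd C ` fst C" for x i j
    using cl C that unfolding closed_form_iff by blast
  have e: "(cc C x)\<^sup>2 = - \<mu> * B x" if x: "x \<in> snd C ` fst C" for x
  proof -
    obtain p where p: "p \<in> fst C" "x = snd C p" using x by blast
    then show ?thesis using mu C B_pos[OF x] cc_eq[OF C p(1)] form_length_eq[OF C] by simp
  qed
  have z: "(x, y) \<in> Zs" using nd nondegenerate_Fs[OF x] unfolding metric_eq[OF C] by blast
  have z0: "(x, y) \<in> Z0" by (rule Zs_Z0[OF z])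
  have "Rm H i k (x, y) = Rm G i k (x, y) + (fc x)\<^sup>2 * (Aq (x, y) * (if i = k then 1 else 0) - y $ i * yl k (x, y))"
    using Rm_closed_const[OF s z, of i k] dfc_zero(1)[OF e x] by simp
  then show ?thesis
    unfolding metric_eq[OF C] alpha_eq[OF C] riemann_Fs[OF z] riemann_Fa[OF z0] Fa_sq[OF z0]
    by (simp add: yl_def dfc_zero(2)[OF e x])
qed

lemma nondegenerate_nonzero: "nondegenerate F x y \<Longrightarrow> y \<noteq> 0"
  by (simp add: nondegenerate_def)

lemma constant_ricci_converse:
  assumes R: "constant_ricci \<A> (alpha a) \<mu>" and cl: "closed_form \<A> b"
    and mu: "\<forall>C\<in>\<A>. \<forall>p\<in>fst C. (c p)\<^sup>2 = - \<mu> * (form_length a b C (snd C p))\<^sup>2"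
  shows "constant_ricci \<A> (singular_square_metric a b) 0"
  unfolding constant_ricci_def
proof (intro ballI allI impI)
  fix C x y assume C: "C \<in> \<A>" and x: "x \<in> snd C ` fst C" and nd: "nondegenerate (singular_square_metric a b C) x y"
  interpret sq_chart "snd C ` fst C" "a C" "b C" "cc C" by (rule sq_chart[OF C])
  have z0: "(x, y) \<in> Z0" using x nondegenerate_nonzero[OF nd] by (simp add: Z0_def)
  have ra: "ricci (alpha a C) x y = (real CARD('n) - 1) * \<mu> * (alpha a C x y)\<^sup>2"
  proof -
    have "nondegenerate (alpha a C) x y"
      unfolding alpha_eq[OF C] nondegenerate_Fa[OF x] by (rule nondegenerate_nonzero[OF nd])
    then show ?thesis using R C x unfolding constant_ricci_def by blast
  qed
  have yy: "(\<Sum>m\<in>UNIV. y $ m * (\<Sum>j\<in>UNIV. a C x $ m $ j * y $ j)) = (alpha a C x y)\<^sup>2"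
    unfolding alpha_eq[OF C] Fa_sq[OF z0] by (simp add: Aq_def yl_def)
  have "ricci (singular_square_metric a b C) x y = ricci (alpha a C) x y
     - \<mu> * ((\<Sum>m::'n\<in>UNIV. (alpha a C x y)\<^sup>2) - (\<Sum>m\<in>UNIV. y $ m * (\<Sum>j\<in>UNIV. a C x $ m $ j * y $ j)))"
    unfolding ricci_def converse_chart[OF C x cl mu nd] by (simp add: sum_subtractf flip: sum_distrib_left)
  then show "ricci (singular_square_metric a b C) x y = (real CARD('n) - 1) * 0 * (singular_square_metric a b C x y)\<^sup>2"
    unfolding yy ra by (simp add: algebra_simps)
qed

lemma constant_flag_converse:
  assumes R: "constant_sectional \<A> a \<mu>" and cl: "closed_form \<A> b"
    and mu: "\<forall>C\<in>\<A>. \<forall>p\<in>fst C. (c p)\<^sup>2 = - \<mu> * (form_length a b C (snd C p))\<^sup>2"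
  shows "constant_flag \<A> (singular_square_metric a b) 0"
  unfolding constant_flag_def
proof (intro ballI allI impI)
  fix C x y i k assume C: "C \<in> \<A>" and x: "x \<in> snd C ` fst C" and nd: "nondegenerate (singular_square_metric a b C) x y"
  have "riemann (alpha a C) x y $ i $ k = \<mu> * ((alpha a C x y)\<^sup>2 * (if i = k then 1 else 0) - y $ i * (\<Sum>j\<in>UNIV. a C x $ k $ j * y $ j))"
    using R C x nondegenerate_nonzero[OF nd] unfolding constant_sectional_def by blast
  then show "riemann (singular_square_metric a b C) x y $ i $ k = 0 * ((singular_square_metric a b C x y)\<^sup>2 * (if i = k then 1 else 0)
      - singular_square_metric a b C x y * y $ i * partial k (singular_square_metric a b C x) y)"
    unfolding converse_chart[OF C x cl mu nd] by simp
qed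

lemma constant_flag_imp_ricci:
  assumes K: "constant_flag \<A> (singular_square_metric a b) K"
  shows "constant_ricci \<A> (singular_square_metric a b) K"
  unfolding constant_ricci_def
proof (intro ballI allI impI)
  fix C x y assume C: "C \<in> \<A>" and x: "x \<in> snd C ` fst C" and nd: "nondegenerate (singular_square_metric a b C) x y"
  interpret sq_chart "snd C ` fst C" "a C" "b C" "cc C" by (rule sq_chart[OF C])
  have z: "(x, y) \<in> Zs" using nd nondegenerate_Fs[OF x] unfolding metric_eq[OF C] by blast
  have "riemann (singular_square_metric a b C) x y $ i $ k = K * ((singular_square_metric a b C x y)\<^sup>2 * (if i = k then 1 else 0)
      - singular_square_metric a b C x y * y $ i * partial k (singular_square_metric a b C x) y)" for i k
    using K C x nd unfolding constant_flag_def by blast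
  then show "ricci (singular_square_metric a b C) x y = (real CARD('n) - 1) * K * (singular_square_metric a b C x y)\<^sup>2"
    unfolding metric_eq[OF C] by (rule flag_imp_ricci[OF z])
qed

text \<open>The Ricci case gives everything but the sectional curvature. With K = 0 the Riemann
  tensor of F vanishes in nondegenerate directions, and \<open>flag_closed\<close> extends the
  resulting formula for \<alpha> to all directions.\<close>

lemma constant_flag_imp:
  assumes K: "constant_flag \<A> (singular_square_metric a b) K"
  shows "\<exists>\<mu>. constant_sectional \<A> a \<mu> \<and> closed_form \<A> b \<and>
    (\<forall>C\<in>\<A>. \<forall>p\<in>fst C. (c p)\<^sup>2 = - \<mu> * (form_length a b C (snd C p))\<^sup>2)"
proof -
  obtain \<mu> where cl: "closed_form \<A> b"
    and mu: "\<forall>C\<in>\<A>. \<forall>p\<in>fst C. (c p)\<^sup>2 = - \<mu> * (form_length a b C (snd C p))\<^sup>2"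
    and fc: "\<forall>C\<in>\<A>. \<forall>x\<in>snd C ` fst C. K = 0 \<and> (sq_chart.fc (a C) (b C) (cc C) x)\<^sup>2 = - \<mu>
       \<and> (\<forall>k. partial k (sq_chart.fc (a C) (b C) (cc C)) x = 0)"
    using constant_ricci_imp[OF constant_flag_imp_ricci[OF K]] by (elim exE conjE) rule
  have "constant_sectional \<A> a \<mu>"
    unfolding constant_sectional_def
  proof (intro ballI allI impI)
    fix C x y i k assume C: "C \<in> \<A>" and x: "x \<in> snd C ` fst C" and y: "(y::real^'n) \<noteq> 0"
    interpret sq_chart "snd C ` fst C" "a C" "b C" "cc C" by (rule sq_chart[OF C])
    have s: "s i j x = 0" if "x \<in> snd C ` fst C" for x i j
      using cl C that unfolding closed_form_iff by blast
    have z0: "(x, y) \<in> Z0" using x y by (simp add: Z0_def)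
    have f: "K = 0" "(fc x)\<^sup>2 = - \<mu>" "partial k fc x = 0" for k using bspec[OF bspec[OF fc C] x] by blast+
    have "riemann Fs x y $ i $ k = 0" if "(x, y) \<in> Zs" for y
    proof -
      have "nondegenerate (singular_square_metric a b C) x y"
        unfolding metric_eq[OF C] nondegenerate_Fs[OF x] by (rule that)
      then have "riemann (singular_square_metric a b C) x y $ i $ k = K * ((singular_square_metric a b C x y)\<^sup>2 * (if i = k then 1 else 0)
          - singular_square_metric a b C x y * y $ i * partial k (singular_square_metric a b C x) y)"
        using K C x unfolding constant_flag_def by blast
      then show ?thesis unfolding f(1) metric_eq[OF C] by simp
    qed
    from flag_closed[OF s x f(3) this]
    have "Rm G i k (x, y) = \<mu> * (Aq (x, y) * (if i = k then 1 else 0) - y $ i * yl k (x, y))" unfolding f(2) by simp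
    then show "riemann (alpha a C) x y $ i $ k = \<mu> * ((alpha a C x y)\<^sup>2 * (if i = k then 1 else 0)
        - y $ i * (\<Sum>j\<in>UNIV. a C x $ k $ j * y $ j))"
      unfolding alpha_eq[OF C] riemann_Fa[OF z0] Fa_sq[OF z0] by (simp add: yl_def)
  qed
  then show ?thesis using cl mu by blast
qed

end

theorem theorem1p3:
  fixes M :: "'m topology"
    and \<A> :: "('m, 'n::finite) chart set"
    and a :: "('m, 'n) chart \<Rightarrow> real^'n \<Rightarrow> real^'n^'n"
    and b :: "('m, 'n) chart \<Rightarrow> real^'n \<Rightarrow> real^'n"
    and c :: "'m \<Rightarrow> real"
  assumes "smooth_manifold M \<A>" and "connected_space M" and "CARD('n) \<ge> 3"
    and "riemannian_metric \<A> a"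
    and "one_form \<A> b" and "nowhere_vanishing \<A> b"
    and "conformal_form \<A> a b c"
  shows "((\<exists>K. constant_ricci \<A> (singular_square_metric a b) K) \<longleftrightarrow>
            (\<exists>\<mu>. constant_ricci \<A> (alpha a) \<mu> \<and> closed_form \<A> b \<and>
                 (\<forall>C\<in>\<A>. \<forall>p\<in>fst C. (c p)\<^sup>2 = - \<mu> * (form_length a b C (snd C p))\<^sup>2)))
       \<and> ((\<exists>K. constant_flag \<A> (singular_square_metric a b) K) \<longleftrightarrow>
            (\<exists>\<mu>. constant_sectional \<A> a \<mu> \<and> closed_form \<A> b \<and>
                 (\<forall>C\<in>\<A>. \<forall>p\<in>fst C. (c p)\<^sup>2 = - \<mu> * (form_length a b C (snd C p))\<^sup>2)))"
proof -
  interpret sq_manifold M \<A> a b c by unfold_locales (use assms in auto)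
  show ?thesis
  proof (intro conjI iffI)
    assume "\<exists>K. constant_ricci \<A> (singular_square_metric a b) K"
    then obtain K where "constant_ricci \<A> (singular_square_metric a b) K" ..
    from constant_ricci_imp[OF this] show "\<exists>\<mu>. constant_ricci \<A> (alpha a) \<mu> \<and> closed_form \<A> b \<and>
        (\<forall>C\<in>\<A>. \<forall>p\<in>fst C. (c p)\<^sup>2 = - \<mu> * (form_length a b C (snd C p))\<^sup>2)"
      by (elim ex_forward) (elim conjE, intro conjI)
  next
    assume "\<exists>K. constant_flag \<A> (singular_square_metric a b) K"
    then obtain K where "constant_flag \<A> (singular_square_metric a b) K" ..
    from constant_flag_imp[OF this] show "\<exists>\<mu>. constant_sectional \<A> a \<mu> \<and> closed_form \<A> b \<and>
        (\<forall>C\<in>\<A>. \<forall>p\<in>fst C. (c p)\<^sup>2 = - \<mu> * (form_length a b C (snd C p))\<^sup>2)" .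
  qed (elim exE conjE, rule exI, rule constant_ricci_converse constant_flag_converse; assumption)+
qed

end
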